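(* For any dihedral group $G=I_2(N)$ with constant multiplicity $m\in\mathbb Z_{\ge0}$, $$\mathrm{Ker}\,\pi_m=I_m,$$ where $\pi_m:Q_m\to H_m$ is the linear map $\pi_m(q)=\mathcal L_q(w_m)$ and $I_m$ is the ideal of $Q_m$ generated by the basic invariants $\sigma_1,\sigma_2$.
   Context: $G=I_2(N)$, $N\ge2$, is the dihedral group of order $2N$ acting on the Euclidean plane with coordinates $(x_1,x_2)$, generated by the reflections in the lines $(\alpha^j,x)=0$, $\alpha^j=(-\sin\frac{\pi j}{N},\cos\frac{\pi j}{N})$, $j=0,\ldots,N-1$; $A=\{\alpha^0,\ldots,\alpha^{N-1}\}$. All multiplicities equal $m\in\mathbb Z_{\ge0}$. Put $z=x_1+ix_2$, $\bar z=x_1-ix_2$. Polynomials have complex coefficients. The ring $S^G$ of $G$-invariant polynomials is freely generated by $\sigma_1=z\bar z$, $\sigma_2=z^N+\bar z^N$. $Q_m$ is the ring of $m$-quasiinvariants: polynomials $q(x_1,x_2)$ such that for each $\alpha\in A$ the derivatives $\partial_\alpha^{s}q$, $s=1,3,\ldots,2m-1$, vanish on the line $(\alpha,x)=0$, where $\partial_\alpha=(\alpha,\partial/\partial x)$. $\mathcal L=\Delta-2m\sum_{\alpha\in A}\frac{1}{(\alpha,x)}\partial_\alpha$. There is a (known) algebra homomorphism $\chi_m$ from $Q_m$ to a commutative algebra of differential operators with rational coefficients, $q\mapsto\mathcal L_q=\chi_m(q)$, given for homogeneous $q$ of degree $d$ by $\mathcal L_q=\frac{1}{2^dd!}(\mathrm{ad}_{\mathcal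 L})^d\hat q$, where $\mathrm{ad}_{\mathcal L}B=\mathcal LB-B\mathcal L$ and $\hat q$ is multiplication by $q$, extended linearly. $\mathcal L_1=\chi_m(\sigma_1)=\mathcal L$, $\mathcal L_2=\chi_m(\sigma_2)$, and $H_m$ is the space of $m$-harmonic polynomials, i.e. polynomials in $\ker\mathcal L_1\cap\ker\mathcal L_2$. Finally $w_m=\prod_{\alpha\in A}(\alpha,x)^{2m+1}$. *)

theory Defs
  imports Complex_Main
    "HOL-Computational_Algebra.Polynomial_Factorial"
begin

text \<open>
  The ring \<open>\<complex>[x\<^sub>1, x\<^sub>2]\<close> is represented as \<open>\<complex>[x\<^sub>1][x\<^sub>2]\<close>: the inner variable is \<open>x\<^sub>1\<close>
  and the outer one is \<open>x\<^sub>2\<close>. Its field of fractions is \<open>\<complex>(x\<^sub>1, x\<^sub>2)\<close>.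
\<close>

type_synonym poly2 = "complex poly poly"
type_synonym ratfun2 = "complex poly poly fract"

definition const2 :: "complex \<Rightarrow> poly2" where
  "const2 c = [:[:c:]:]"

definition X1 :: poly2 where
  "X1 = [:[:0, 1:]:]"

definition X2 :: poly2 where
  "X2 = [:0, 1:]"

definition eval2 :: "poly2 \<Rightarrow> real \<times> real \<Rightarrow> complex" where
  "eval2 q x = poly (poly q [:of_real (snd x):]) (of_real (fst x))"

lemma eval2_simps [simp]:
  "eval2 (p + q) x = eval2 p x + eval2 q x"
  "eval2 (p * q) x = eval2 p x * eval2 q x"
  "eval2 (const2 c) x = c"
  "eval2 X1 x = of_real (fst x)"
  "eval2 X2 x = of_real (snd x)"
  by (simp_all add: eval2_def const2_def X1_def X2_def)


subsection \<open>Partial derivatives\<close>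

definition poly_dx1 :: "poly2 \<Rightarrow> poly2" where
  "poly_dx1 q = map_poly pderiv q"

definition poly_dx2 :: "poly2 \<Rightarrow> poly2" where
  "poly_dx2 q = pderiv q"

lemma coeff_poly_dx1: "coeff (poly_dx1 q) n = pderiv (coeff q n)"
  by (simp add: poly_dx1_def coeff_map_poly)

lemma pderiv_sum_coeff: "pderiv (sum f A) = (\<Sum>i\<in>A. pderiv (f i))"
  by (induction A rule: infinite_finite_induct) (simp_all add: pderiv_add)

lemma poly_dx1_mult: "poly_dx1 (p * q) = p * poly_dx1 q + q * poly_dx1 p"
proof (rule poly_eqI)
  fix n
  have "coeff (q * poly_dx1 p) n = coeff (poly_dx1 p * q) n"
    by (subst mult.commute) (rule refl)
  also have "\<dots> = (\<Sum>i\<le>n. coeff q (n - i) * pderiv (coeff p i))"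
    unfolding coeff_mult coeff_poly_dx1 by (intro sum.cong refl mult.commute)
  finally show "coeff (poly_dx1 (p * q)) n = coeff (p * poly_dx1 q + q * poly_dx1 p) n"
    by (simp add: coeff_poly_dx1 coeff_mult pderiv_sum_coeff pderiv_mult sum.distrib)
qed

lemma poly_dx2_mult: "poly_dx2 (p * q) = p * poly_dx2 q + q * poly_dx2 p"
  by (simp add: poly_dx2_def pderiv_mult)

lemma quotient_rule_respects:
  fixes D :: "'a::idom \<Rightarrow> 'a"
  assumes D: "\<And>p q. D (p * q) = p * D q + q * D p"
    and "a * d = c * b" "b \<noteq> 0" "d \<noteq> 0"
  shows "(D a * b - a * D b) * (d * d) = (D c * d - c * D d) * (b * b)"
proof -
  have "D (a * d) = D (c * b)"
    using assms(2) by simp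
  then have "a * D d + d * D a = c * D b + b * D c"
    by (simp add: D)
  with assms(2) show ?thesis by algebra
qed

(* Polynomial_Factorial leaves a lifting setup for fractions over gcd rings only in place. *)
setup_lifting Quotient_fract

lift_definition dx1 :: "ratfun2 \<Rightarrow> ratfun2"
  is "\<lambda>x. (poly_dx1 (fst x) * snd x - fst x * poly_dx1 (snd x), snd x * snd x)"
proof -
  fix x y :: "poly2 \<times> poly2"
  assume "fractrel x y"
  then show "fractrel (poly_dx1 (fst x) * snd x - fst x * poly_dx1 (snd x), snd x * snd x)
      (poly_dx1 (fst y) * snd y - fst y * poly_dx1 (snd y), snd y * snd y)"
    unfolding fractrel_iff fst_conv snd_conv
    by (intro conjI quotient_rule_respects[OF poly_dx1_mult]) simp_all
qed

lift_definition dx2 :: "ratfun2 \<Rightarrow> ratfun2"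
  is "\<lambda>x. (poly_dx2 (fst x) * snd x - fst x * poly_dx2 (snd x), snd x * snd x)"
proof -
  fix x y :: "poly2 \<times> poly2"
  assume "fractrel x y"
  then show "fractrel (poly_dx2 (fst x) * snd x - fst x * poly_dx2 (snd x), snd x * snd x)
      (poly_dx2 (fst y) * snd y - fst y * poly_dx2 (snd y), snd y * snd y)"
    unfolding fractrel_iff fst_conv snd_conv
    by (intro conjI quotient_rule_respects[OF poly_dx2_mult]) simp_all
qed

lemma dx1_Fract:
  "b \<noteq> 0 \<Longrightarrow> dx1 (Fract a b) = Fract (poly_dx1 a * b - a * poly_dx1 b) (b * b)"
  by (simp add: Fract.abs_eq dx1.abs_eq)

lemma dx2_Fract:
  "b \<noteq> 0 \<Longrightarrow> dx2 (Fract a b) = Fract (poly_dx2 a * b - a * poly_dx2 b) (b * b)"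
  by (simp add: Fract.abs_eq dx2.abs_eq)

definition poly_dir :: "real \<times> real \<Rightarrow> poly2 \<Rightarrow> poly2" where
  "poly_dir \<alpha> q = const2 (of_real (fst \<alpha>)) * poly_dx1 q + const2 (of_real (snd \<alpha>)) * poly_dx2 q"

definition dir :: "real \<times> real \<Rightarrow> ratfun2 \<Rightarrow> ratfun2" where
  "dir \<alpha> f = to_fract (const2 (of_real (fst \<alpha>))) * dx1 f + to_fract (const2 (of_real (snd \<alpha>))) * dx2 f"


subsection \<open>Homogeneous components\<close>

definition hcomp :: "nat \<Rightarrow> poly2 \<Rightarrow> poly2" where
  "hcomp d q = (\<Sum>i\<le>d. const2 (coeff (coeff q i) (d - i)) * X1 ^ (d - i) * X2 ^ i)"

lemma coeff_X1_X2:
  "coeff (coeff (const2 c * X1 ^ j * X2 ^ i) k) l = (if k = i \<and> l = j then c else 0)"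
proof -
  have "X2 ^ i = monom 1 i"
    by (simp add: X2_def monom_altdef)
  moreover have "X1 ^ j = [:monom 1 j:]"
    by (induction j) (simp_all add: X1_def monom_Suc one_pCons)
  ultimately have "const2 c * X1 ^ j * X2 ^ i = monom (monom c j) i"
    by (simp add: const2_def smult_monom)
  then show ?thesis by simp
qed

lemma coeff_hcomp:
  "coeff (coeff (hcomp d q) k) l = (if k + l = d then coeff (coeff q k) l else 0)"
proof -
  have "coeff (coeff (hcomp d q) k) l =
      (\<Sum>i\<le>d. if k = i \<and> l = d - i then coeff (coeff q i) (d - i) else 0)"
    by (simp add: hcomp_def coeff_sum coeff_X1_X2)
  also have "\<dots> = (\<Sum>i\<le>d. if i = k then (if k + l = d then coeff (coeff q k) l else 0) else 0)"
    by (rule sum.cong) auto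
  also have "\<dots> = (if k + l = d then coeff (coeff q k) l else 0)"
    by (auto simp: sum.delta)
  finally show ?thesis .
qed

lemma finite_hcomp: "finite {d. hcomp d q \<noteq> 0}"
proof -
  define M where "M = Max ((\<lambda>k. degree (coeff q k)) ` {..degree q})"
  have "d \<le> degree q + M" if "hcomp d q \<noteq> 0" for d
  proof -
    from that obtain k l where "coeff (coeff (hcomp d q) k) l \<noteq> 0"
      by (metis coeff_0 poly_eqI)
    then have kl: "k + l = d" "coeff (coeff q k) l \<noteq> 0"
      by (auto simp: coeff_hcomp split: if_splits)
    then have k: "k \<le> degree q"
      by (metis coeff_0 le_degree)
    have "l \<le> degree (coeff q k)"
      using kl(2) by (rule le_degree)
    also have "\<dots> \<le> M"
      unfolding M_def using k by (intro Max_ge finite_imageI finite_atMost imageI) simp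
    finally show ?thesis using k kl(1) by simp
  qed
  then have "{d. hcomp d q \<noteq> 0} \<subseteq> {..degree q + M}"
    by blast
  then show ?thesis
    by (rule finite_subset) (rule finite_atMost)
qed

lemma sum_hcomp: "(\<Sum>d | hcomp d q \<noteq> 0. hcomp d q) = q"
proof (intro poly_eqI)
  fix k l
  have "coeff (coeff (\<Sum>d | hcomp d q \<noteq> 0. hcomp d q) k) l =
      (\<Sum>d | hcomp d q \<noteq> 0. if k + l = d then coeff (coeff q k) l else 0)"
    by (simp add: coeff_sum coeff_hcomp)
  also have "\<dots> = (if hcomp (k + l) q \<noteq> 0 then coeff (coeff q k) l else 0)"
    by (simp add: sum.delta' finite_hcomp)
  also have "\<dots> = coeff (coeff q k) l"
    by (metis coeff_0 coeff_hcomp)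
  finally show "coeff (coeff (\<Sum>d | hcomp d q \<noteq> 0. hcomp d q) k) l = coeff (coeff q k) l" .
qed


subsection \<open>The dihedral arrangement, basic invariants and quasiinvariants\<close>

definition dihedral_roots :: "nat \<Rightarrow> (real \<times> real) set" where
  "dihedral_roots N = (\<lambda>j. (- sin (pi * real j / real N), cos (pi * real j / real N))) ` {..<N}"

definition lin_form :: "real \<times> real \<Rightarrow> poly2" where
  "lin_form \<alpha> = const2 (of_real (fst \<alpha>)) * X1 + const2 (of_real (snd \<alpha>)) * X2"

definition Z :: poly2 where
  "Z = X1 + const2 \<i> * X2"

definition Zbar :: poly2 where
  "Zbar = X1 - const2 \<i> * X2"

definition sigma1 :: poly2 where
  "sigma1 = Z * Zbar"

definition sigma2 :: "nat \<Rightarrow> poly2" where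
  "sigma2 N = Z ^ N + Zbar ^ N"

definition quasiinvariants :: "nat \<Rightarrow> nat \<Rightarrow> poly2 set" where
  "quasiinvariants N m =
    {q. \<forall>\<alpha>\<in>dihedral_roots N. \<forall>s. odd s \<and> s < 2 * m \<longrightarrow>
      (\<forall>x. fst \<alpha> * fst x + snd \<alpha> * snd x = 0 \<longrightarrow> eval2 ((poly_dir \<alpha> ^^ s) q) x = 0)}"

text \<open>
  The quasiinvariants form a commutative ring with unit, so its ideal generated by
  \<open>\<sigma>\<^sub>1, \<sigma>\<^sub>2\<close> consists of the combinations with quasiinvariant coefficients.
\<close>

definition invariant_ideal :: "nat \<Rightarrow> nat \<Rightarrow> poly2 set" where
  "invariant_ideal N m =
    {p * sigma1 + q * sigma2 N | p q. p \<in> quasiinvariants N m \<and> q \<in> quasiinvariants N m}"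


subsection \<open>Calogero--Moser operators\<close>

text \<open>
  A differential operator with rational coefficients is identified with the
  \<open>\<complex>\<close>-linear map on \<open>\<complex>(x\<^sub>1, x\<^sub>2)\<close> that it induces; this identification is faithful.
\<close>

definition CM_op :: "nat \<Rightarrow> nat \<Rightarrow> ratfun2 \<Rightarrow> ratfun2" where
  "CM_op N m f = dx1 (dx1 f) + dx2 (dx2 f)
     - of_nat (2 * m) * (\<Sum>\<alpha>\<in>dihedral_roots N. dir \<alpha> f / to_fract (lin_form \<alpha>))"

definition ad_op :: "(ratfun2 \<Rightarrow> ratfun2) \<Rightarrow> (ratfun2 \<Rightarrow> ratfun2) \<Rightarrow> ratfun2 \<Rightarrow> ratfun2" where
  "ad_op L B = (\<lambda>f. L (B f) - B (L f))"

definition mult_op :: "poly2 \<Rightarrow> ratfun2 \<Rightarrow> ratfun2" where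
  "mult_op q f = to_fract q * f"

text \<open>
  \<open>chi_hom N m d\<close> is meant for homogeneous \<open>q\<close> of degree \<open>d\<close>; \<open>chi\<close> is its linear extension.
\<close>

definition chi_hom :: "nat \<Rightarrow> nat \<Rightarrow> nat \<Rightarrow> poly2 \<Rightarrow> ratfun2 \<Rightarrow> ratfun2" where
  "chi_hom N m d q f =
    to_fract (const2 (1 / (2 ^ d * fact d))) * (ad_op (CM_op N m) ^^ d) (mult_op q) f"

definition chi :: "nat \<Rightarrow> nat \<Rightarrow> poly2 \<Rightarrow> ratfun2 \<Rightarrow> ratfun2" where
  "chi N m q f = (\<Sum>d | hcomp d q \<noteq> 0. chi_hom N m d (hcomp d q) f)"

definition harmonics :: "nat \<Rightarrow> nat \<Rightarrow> poly2 set" where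
  "harmonics N m =
    {p. chi N m sigma1 (to_fract p) = 0 \<and> chi N m (sigma2 N) (to_fract p) = 0}"

definition w_poly :: "nat \<Rightarrow> nat \<Rightarrow> poly2" where
  "w_poly N m = (\<Prod>\<alpha>\<in>dihedral_roots N. lin_form \<alpha> ^ (2 * m + 1))"

definition pi_map :: "nat \<Rightarrow> nat \<Rightarrow> poly2 \<Rightarrow> ratfun2" where
  "pi_map N m q = chi N m q (to_fract (w_poly N m))"

end

theory Submission
  imports Defs "HOL-Computational_Algebra.Polynomial_FPS"
begin

text \<open>
  Write a homogeneous polynomial of degree \<open>n\<close> as \<open>w\<^sup>n u(z/w)\<close> with \<open>w\<close> the conjugate of \<open>z\<close>. It is
  quasiinvariant iff on each residue class of exponents \<open>a\<close> modulo \<open>N\<close> the odd moments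
  \<open>\<Sum> u\<^sub>a (2a - n)\<^sup>s\<close> with \<open>s < 2m\<close> vanish. The operator \<open>\<L>\<close> preserves these conditions and, by
  the Vandermonde determinant, a nonzero class has degree at least \<open>mN\<close> plus the residues of both
  exponents; an anti-invariant has degree at least \<open>M = (2m + 1)N = deg w\<^sub>m\<close>.

  Since \<open>\<L>(w\<^sub>m) = 0\<close>, for \<open>q\<close> of degree \<open>d\<close> the polynomial \<open>\<pi>\<^sub>m(q)\<close> is a nonzero multiple of
  \<open>\<L>\<^sup>d(q w\<^sub>m)\<close>. For \<open>\<L>\<^sup>d\<^sup>+\<^sup>1(q w\<^sub>m)\<close>, \<open>\<L>\<^sup>d\<^sup>+\<^sup>2(\<sigma>\<^sub>1 q w\<^sub>m)\<close> and \<open>\<L>\<^sup>d\<^sup>+\<^sup>N(\<sigma>\<^sub>2 q w\<^sub>m)\<close> the degree is below the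
  bound of the class, so \<open>\<pi>\<^sub>m(q)\<close> is harmonic and the ideal lies in the kernel.

  Conversely, modulo \<open>\<sigma>\<^sub>1\<close> and \<open>\<sigma>\<^sub>2\<close> every homogeneous quasiinvariant reduces to \<open>1\<close>, \<open>w\<^sub>m\<close> or one of
  the \<open>f\<^sub>l\<close> of lowest degree \<open>mN + l\<close> in its class. There \<open>\<pi>\<^sub>m\<close> does not vanish: the angular part of
  \<open>\<L>\<close> is self-adjoint for the constant-term pairing with weight \<open>(z\<^sup>N - w\<^sup>N)\<^sup>-\<^sup>2\<^sup>m\<close>, and the pairing of
  \<open>f\<^sub>l w\<^sub>m\<close> with the dual \<open>f\<^sub>N\<^sub>-\<^sub>l\<close> reduces to the middle coefficient of \<open>(z\<^sup>N - w\<^sup>N)\<^sup>2\<^sup>m\<^sup>+\<^sup>2\<close>.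
\<close>

text \<open>L has poles on the mirrors; the moment conditions are what makes its values polynomials
  again. Through \<open>CM_op_form\<close> it is moved to the coefficients of u, where it is an
  exact division and no rational functions occur. No degree bound kills an image by itself. L^d
  takes q w_m from degree d + M to degree M - d, and w_m reverses the parity under reflections, so
  the bounds of q and of its image are used jointly. If the reflection preserves the class, one of
  the two is anti-invariant and would need degree M; otherwise the two bounds are incompatible with
  the sum of the two degrees. For the nonvanishing, L^k is multiplied back by sigma_1^k. All
  iterates then have the same degree, and sigma_1 L is a scalar depending on the step plus one fixed
  angular operator. Against an eigenvector of the latter, L^d multiplies the pairing by a product of
  scalars. For f_l none of them is 0. For w_m with m > 0 the eigenvector is constant in the angle
  and exactly one scalar is 0, so that case needs a generalised eigenvector.\<close>

definition wt :: "nat \<Rightarrow> nat \<Rightarrow> complex" where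
  "wt n a = 2 * of_nat a - of_nat n"

section \<open>Weighted coefficient sums and odd moments\<close>

definition wsum :: "(nat \<Rightarrow> complex) \<Rightarrow> complex poly \<Rightarrow> complex" where
  "wsum F p = (\<Sum>a\<le>degree p. coeff p a * F a)"

lemma wsum_bound: "degree p \<le> B \<Longrightarrow> wsum F p = (\<Sum>a\<le>B. coeff p a * F a)"
  unfolding wsum_def by (rule sum.mono_neutral_left) (auto simp: coeff_eq_0)

lemma wsum_0 [simp]: "wsum F 0 = 0"
  by (simp add: wsum_def)

lemma wsum_add: "wsum F (p + q) = wsum F p + wsum F q"
proof -
  define B where "B = max (degree p) (degree q)"
  have "degree (p + q) \<le> B"
    unfolding B_def by (rule degree_add_le_max)
  then show ?thesis
    by (simp add: wsum_bound[of "p + q" B] wsum_bound[of p B] wsum_bound[of q B] B_def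
        ring_distribs sum.distrib)
qed

lemma wsum_smult: "wsum F (smult c p) = c * wsum F p"
  by (simp add: wsum_bound[of "smult c p" "degree p"] wsum_def sum_distrib_left mult.assoc
      degree_smult_le)

lemma wsum_minus: "wsum F (- p) = - wsum F p"
  by (simp add: wsum_def sum_negf)

lemma wsum_diff: "wsum F (p - q) = wsum F p - wsum F q"
  using wsum_add[of F p "- q"] by (simp add: wsum_minus)

lemma wsum_cong: "(\<And>a. coeff p a \<noteq> 0 \<Longrightarrow> F a = G a) \<Longrightarrow> wsum
    F p = wsum G p"
  unfolding wsum_def by (rule sum.cong) auto

lemma wsum_zero: "(\<And>a. coeff p a \<noteq> 0 \<Longrightarrow> F a = 0) \<Longrightarrow> wsum F p = 0"
  unfolding wsum_def by (rule sum.neutral) auto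

lemma wsum_add_fun: "wsum (\<lambda>a. F a + G a) p = wsum F p + wsum G p"
  by (simp add: wsum_def ring_distribs sum.distrib)

lemma wsum_diff_fun: "wsum (\<lambda>a. F a - G a) p = wsum F p - wsum G p"
  by (simp add: wsum_def ring_distribs sum_subtractf)

lemma wsum_mult_fun: "wsum (\<lambda>a. c * F a) p = c * wsum F p"
  by (simp add: wsum_def sum_distrib_left mult.left_commute)

lemma wsum_sum_fun: "wsum (\<lambda>a. \<Sum>i\<in>I. F i a) p = (\<Sum>i\<in>I. wsum (F i) p)"
  unfolding wsum_def by (subst sum.swap) (simp add: sum_distrib_left)

lemma wsum_monom_mult: "wsum F (monom 1 k * p) = wsum (\<lambda>a. F (a + k)) p"
proof -
  have deg: "degree (monom 1 k * p) \<le> degree p + k"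
    by (metis add.commute add_le_mono1 degree_monom_le degree_mult_le order_trans)
  have "wsum F (monom 1 k * p) = (\<Sum>a\<le>degree p + k. coeff (monom 1 k * p) a * F a)"
    by (rule wsum_bound[OF deg])
  also have "\<dots> = (\<Sum>a\<in>{k..degree p + k}. coeff (monom 1 k * p) a * F a)"
    by (rule sum.mono_neutral_right) (auto simp: coeff_monom_mult)
  also have "\<dots> = (\<Sum>a\<in>{0..degree p}. coeff (monom 1 k * p) (a + k) * F (a + k))"
    using sum.shift_bounds_cl_nat_ivl[of "\<lambda>a. coeff (monom 1 k * p) a * F a" 0 k "degree p"] by simp
  finally show ?thesis
    by (simp add: wsum_def coeff_monom_mult atMost_atLeast0)
qed

definition odd_poly :: "complex poly \<Rightarrow> bool" where
  "odd_poly P \<longleftrightarrow> (\<forall>i. coeff P i \<noteq> 0 \<longrightarrow> odd i)"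

text \<open>Only odd powers below \<open>2 * k\<close> occur in \<open>P\<close>, and each of them
  is one of the \<open>k\<close> vanishing moments. \<open>Q\<close> will select a residue class of
  exponents.\<close>

lemma wsum_odd_poly:
  assumes "odd_poly P" "\<And>i. i \<ge> 2 * k \<Longrightarrow> coeff P i = 0"
    and "\<And>r. r < k \<Longrightarrow> wsum (\<lambda>a. if Q a then f a ^ (2 * r + 1) else 0) u = 0"
  shows "wsum (\<lambda>a. if Q a then poly P (f a) else 0) u = 0"
proof -
  have "(\<lambda>a. if Q a then poly P (f a) else 0) =
      (\<lambda>a. \<Sum>i\<le>degree P. coeff P i * (if Q a then f a ^ i else 0))"
    by (auto simp: poly_altdef)
  then have "wsum (\<lambda>a. if Q a then poly P (f a) else 0) u =
      (\<Sum>i\<le>degree P. coeff P i * wsum (\<lambda>a. if Q a then f a ^ i else 0) u)"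
    by (simp only: wsum_sum_fun wsum_mult_fun)
  also have "\<dots> = 0"
  proof (rule sum.neutral, rule ballI)
    fix i
    show "coeff P i * wsum (\<lambda>a. if Q a then f a ^ i else 0) u = 0"
    proof (cases "coeff P i = 0")
      case False
      then have "odd i" "i < 2 * k"
        using assms(1,2) by (auto simp: odd_poly_def not_le[symmetric])
      then obtain r where "i = 2 * r + 1" "r < k"
        by (auto elim!: oddE)
      then show ?thesis
        using assms(3)[of r] by (simp only:) simp
    qed simp
  qed
  finally show ?thesis .
qed

lemma odd_poly_X_mult_square: "odd_poly ([:0, 1:] * pcompose p [:0, 0, 1:])"
proof -
  have "coeff (pcompose p [:0, 0, 1:]) i = (if even i then coeff p (i div 2) else 0)" for i
  proof (induction p arbitrary: i)
    case (pCons c p)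
    have "[:0, 0, 1:] = monom (1::complex) 2"
      by (simp add: monom_altdef power2_eq_square)
    then show ?case
      using pCons by (auto simp: pcompose_pCons coeff_monom_mult coeff_pCons split: nat.split
          elim!: oddE evenE)
  qed simp
  then show ?thesis
    by (auto simp: odd_poly_def coeff_pCons split: nat.splits)
qed

text \<open>The Vandermonde argument in dual form: an odd polynomial that vanishes at all nodes but
  one isolates a single coefficient. Odd polynomials cannot see the node 0 and cannot separate x
  from -x, hence the hypotheses on \<open>f\<close>.\<close>

lemma odd_moments_vanish_imp_zero:
  assumes mom: "\<And>r. r < k \<Longrightarrow> wsum (\<lambda>a. f a ^ (2 * r + 1)) u = 0"
    and supp: "\<And>a. coeff u a \<noteq> 0 \<Longrightarrow> a \<in> A"
    and A: "finite A" "card A \<le> k"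
    and f: "\<And>a. a \<in> A \<Longrightarrow> f a \<noteq> 0" "inj_on (\<lambda>a. (f a)\<^sup>2) A"
  shows "u = 0"
proof (rule ccontr)
  assume "u \<noteq> 0"
  then obtain b where b: "coeff u b \<noteq> 0"
    by (meson leading_coeff_neq_0)
  then have bA: "b \<in> A" by (rule supp)
  \<comment> \<open>\<open>P\<close> becomes x times the product of x^2 - f(a)^2 over the other
    nodes a. Its degree is at most \<open>2 * card A - 1\<close>, below \<open>2 * k\<close>, so the
    moments annihilate it.\<close>
  define p where "p = (\<Prod>a\<in>A - {b}. [:- (f a)\<^sup>2, 1:])"
  define P where "P = [:0, 1:] * pcompose p [:0, 0, 1:]"
  have CMfps: "poly P x = x * (\<Prod>a\<in>A - {b}. x\<^sup>2 - (f a)\<^sup>2)" for x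
    by (simp add: P_def p_def poly_pcompose poly_prod power2_eq_square)
  have "degree p = card (A - {b})"
    unfolding p_def by (subst degree_prod_eq_sum_degree) auto
  also have "\<dots> = card A - 1"
    using bA A by simp
  finally have dp: "degree p = card A - 1" .
  have "card A > 0"
    using bA A card_gt_0_iff by blast
  have "degree P \<le> 1 + 2 * degree p"
    unfolding P_def using degree_mult_le[of "[:0, 1:]" "pcompose p [:0, 0, 1:]"]
      degree_pcompose_le[of p "[:0,0,1:]"] by (simp add: mult.commute)
  then have degP: "degree P < 2 * k"
    using dp A(2) \<open>card A > 0\<close> by linarith
  have "wsum (\<lambda>a. if True then poly P (f a) else 0) u = 0"
  proof (rule wsum_odd_poly[of _ k])
    show "odd_poly P"
      unfolding P_def by (rule odd_poly_X_mult_square)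
    show "coeff P i = 0" if "2 * k \<le> i" for i
      using that degP by (simp add: coeff_eq_0)
  qed (use mom in simp)
  moreover have "wsum (\<lambda>a. poly P (f a)) u = wsum (\<lambda>a. if a = b then poly P (f b) else 0) u"
  proof (rule wsum_cong)
    fix a assume "coeff u a \<noteq> 0"
    then have "a \<in> A" by (rule supp)
    then show "poly P (f a) = (if a = b then poly P (f b) else 0)"
      using A by (auto simp: CMfps)
  qed
  moreover have "b \<le> degree u"
    using b by (rule le_degree)
  then have "wsum (\<lambda>a. if a = b then poly P (f b) else 0) u = coeff u b * poly P (f b)"
    by (simp add: wsum_def if_distrib[of "\<lambda>x. coeff u _ * x"] sum.delta cong: if_cong)
  ultimately have "poly P (f b) = 0"
    using b by simp
  then show False
    using A f bA by (auto simp: CMfps inj_on_def)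
qed

text \<open>These are the weights of a divided difference. Starting from the single node
  \<open>b\<close> and adding one node at a time keeps the weight of \<open>b\<close>
  nonzero.\<close>

lemma moment_weights_exist:
  fixes X :: "'a \<Rightarrow> 'b::field"
  assumes "finite A" "inj_on X A" "b \<in> A" "card A = Suc k"
  shows "\<exists>c. c b \<noteq> 0 \<and> (\<forall>r<k. (\<Sum>a\<in>A. c a * X a ^ r) = 0)"
proof -
  define B where "B = A - {b}"
  have "finite B" "b \<notin> B" "inj_on X (insert b B)" "A = insert b B" "card B = k"
    using assms by (auto simp: B_def insert_absorb)
  then show ?thesis
  proof (induction B arbitrary: k A rule: finite_induct)
    case empty
    then show ?case by (auto intro: exI[of _ "\<lambda>_. 1"])
  next
    case (insert y B)
    then obtain j where j: "k = Suc j" "card B = j"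
      by (metis card_insert_disjoint)
    obtain c where c: "c b \<noteq> 0" "\<And>r. r < j \<Longrightarrow> (\<Sum>a\<in>insert b B. c
        a * X a ^ r) = 0"
      using insert.IH[of "insert b B" j] insert.prems j by (auto simp: inj_on_def)
    define S where "S = insert b B"
    have S: "finite S" "y \<notin> S" "\<And>a. a \<in> S \<Longrightarrow> X a - X y \<noteq> 0"
      using insert by (auto simp: S_def inj_on_def)
    \<comment> \<open>The old weights are divided by X a - X y and the new node balances the total.
      As (x^r - y^r)/(x - y) has degree r - 1 in x, the power r is reduced to powers that the old
      weights annihilate.\<close>
    define c' where "c' = (\<lambda>a. if a = y then - (\<Sum>a\<in>S. c a / (X a - X y)) else c a /
        (X a - X y))"
    have "(\<Sum>a\<in>insert y S. c' a * X a ^ r) = 0" if "r < k" for r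
    proof -
      have "(\<Sum>a\<in>insert y S. c' a * X a ^ r) =
          (\<Sum>a\<in>S. c a / (X a - X y) * X a ^ r) - (\<Sum>a\<in>S. c a / (X a - X y)) * X y ^ r"
        using S by (auto simp: c'_def intro!: sum.cong)
      also have "\<dots> = (\<Sum>a\<in>S. c a / (X a - X y) * (X a ^ r - X y ^ r))"
        by (simp add: sum_distrib_right right_diff_distrib sum_subtractf)
      also have "\<dots> = (\<Sum>a\<in>S. \<Sum>i<r. X y ^ (r - Suc i) * (c a * X a ^ i))"
        using S by (intro sum.cong refl)
          (simp add: power_diff_sumr2 sum_distrib_left mult_ac)
      also have "\<dots> = (\<Sum>i<r. X y ^ (r - Suc i) * (\<Sum>a\<in>S. c a * X a ^ i))"
        by (subst sum.swap) (simp add: sum_distrib_left)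
      also have "\<dots> = 0"
        using c(2) that j by (intro sum.neutral) (auto simp: S_def)
      finally show ?thesis .
    qed
    moreover have "c' b \<noteq> 0"
      using c(1) S insert by (auto simp: c'_def S_def)
    moreover have "A = insert y S"
      using insert by (auto simp: S_def)
    ultimately show ?case by blast
  qed
qed

section \<open>Quasiinvariance in terms of moments, and L as an exact division\<close>

definition ang_form :: "nat \<Rightarrow> complex poly \<Rightarrow> complex poly" where
  "ang_form n u = smult 2 (pCons 0 (pderiv u)) - smult (of_nat n) u"

text \<open>\<open>ang_form n\<close> is z d/dz - w d/dw acting on w^n u(z/w), the angular momentum
  up to a constant.\<close>

lemma coeff_ang_form: "coeff (ang_form n u) a = wt n a * coeff u a"
  by (cases a) (auto simp: ang_form_def wt_def coeff_pderiv algebra_simps)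

lemma degree_le_iff_coeff: "degree (u :: 'a::zero poly) \<le> n \<longleftrightarrow> (\<forall>a>n.
    coeff u a = 0)"
  by (metis degree_le coeff_eq_0 le_less_trans)

lemma all_shift: "(\<forall>e::int. P (e - 1)) \<longleftrightarrow> (\<forall>e. P e)"
  by (metis add_diff_cancel_right')

locale dihedral =
  fixes N m :: nat
  assumes N2: "2 \<le> N"
begin

lemma N_pos: "N > 0" "int N > 0"
  using N2 by auto

abbreviation moment :: "nat \<Rightarrow> int \<Rightarrow> nat \<Rightarrow> complex poly
    \<Rightarrow> complex" where
  "moment n e r \<equiv> wsum (\<lambda>a. if int N dvd int a - e then wt n a ^ (2 * r + 1) else 0)"

text \<open>This says that \<open>form n u\<close> is quasiinvariant of degree n, see
  \<open>quasi_form_iff\<close>. The class \<open>e\<close> is an arbitrary integer rather than a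
  reduced residue, so that it can be shifted freely.\<close>

definition qform :: "nat \<Rightarrow> complex poly \<Rightarrow> bool" where
  "qform n u \<longleftrightarrow> degree u \<le> n \<and>
     (\<forall>e. \<forall>r<m. moment n e r u = 0)"

lemma qform_degree: "qform n u \<Longrightarrow> degree u \<le> n"
  by (simp add: qform_def)

lemma qform_coeff: "qform n u \<Longrightarrow> a > n \<Longrightarrow> coeff u a = 0"
  using qform_degree[of n u] by (simp add: coeff_eq_0)

lemma qform_0 [simp]: "qform n 0"
  by (simp add: qform_def)

lemma qform_add: "qform n u \<Longrightarrow> qform n v \<Longrightarrow> qform n (u + v)"
  by (simp add: qform_def wsum_add degree_add_le)

lemma qform_diff: "qform n u \<Longrightarrow> qform n v \<Longrightarrow> qform n (u - v)"
  by (simp add: qform_def wsum_diff degree_diff_le)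

lemma qform_smult: "qform n u \<Longrightarrow> qform n (smult c u)"
  by (auto simp: qform_def wsum_smult intro: order_trans[OF degree_smult_le])

lemma qform_odd_poly:
  assumes "qform n u" "odd_poly P" "\<And>i. i \<ge> 2 * m \<Longrightarrow> coeff P i = 0"
  shows "wsum (\<lambda>a. if int N dvd int a - e then poly P (wt n a) else 0) u = 0"
  using assms by (intro wsum_odd_poly[of _ m]) (auto simp: qform_def)

definition mn :: complex where "mn = of_nat (m * N)"

text \<open>With denominators cleared, sigma_1 (z^N - w^N) L/4 multiplies z^a w^b by z^N b (a - mN)
  - w^N a (b - mN). The two factors are written so that n (n - 2mN), which depends on the degree
  only, is separated from the angular momentum.\<close>

definition up_part :: "nat \<Rightarrow> complex poly \<Rightarrow> complex poly" where
  "up_part n u = smult (1/4) (smult (of_nat n * (of_nat n - 2 * mn)) u - ang_form n (ang_form n u) +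
      smult (2 * mn) (ang_form n u))"

definition down_part :: "nat \<Rightarrow> complex poly \<Rightarrow> complex poly" where
  "down_part n u = smult (1/4) (smult (of_nat n * (of_nat n - 2 * mn)) u - ang_form n (ang_form n u)
      - smult (2 * mn) (ang_form n u))"

lemma coeff_up_part: "coeff (up_part n u) a = (of_nat n - of_nat a) * (of_nat a - mn) * coeff u a"
  by (simp add: up_part_def coeff_ang_form wt_def field_simps)

lemma coeff_down_part: "coeff (down_part n u) a = of_nat a * (of_nat n - of_nat a - mn) * coeff u a"
  by (simp add: down_part_def coeff_ang_form wt_def field_simps)

text \<open>
  On forms \<open>\<L>/4\<close> is division of \<open>z\<^sup>N up - down\<close> by \<open>\<sigma>\<^sub>1 (z\<^sup>N - w\<^sup>N)\<close>; \<open>CMcoeff\<close> are the coefficients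
  of the quotient obtained by long division, and the first moment makes the division exact.
\<close>

definition CMcoeff :: "nat \<Rightarrow> complex poly \<Rightarrow> nat \<Rightarrow> complex" where
  "CMcoeff n u a = of_nat a * (of_nat n - of_nat a - mn) * coeff u a
     - mn * (\<Sum>c<a. if int N dvd int c - int a then wt n c * coeff u c else 0)"

definition CMf :: "nat \<Rightarrow> complex poly \<Rightarrow> complex poly" where
  "CMf n u = (\<Sum>a\<in>{1..<n}. monom (CMcoeff n u a) (a - 1))"

lemma coeff_CMf: "coeff (CMf n u) b = (if b + 1 < n then CMcoeff n u (b + 1) else 0)"
proof -
  have "coeff (CMf n u) b = (\<Sum>a\<in>{1..<n}. if a = b + 1 then CMcoeff n u a else 0)"
    unfolding CMf_def coeff_sum by (intro sum.cong) auto
  then show ?thesis by simp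
qed

lemma CMcoeff_add: "CMcoeff n (u + v) a = CMcoeff n u a + CMcoeff n v a"
proof -
  have "(\<Sum>c<a. if int N dvd int c - int a then wt n c * (coeff u c + coeff v c) else 0) =
     (\<Sum>c<a. if int N dvd int c - int a then wt n c * coeff u c else 0) +
     (\<Sum>c<a. if int N dvd int c - int a then wt n c * coeff v c else 0)"
    unfolding sum.distrib[symmetric] by (rule sum.cong) (auto simp: algebra_simps)
  then show ?thesis unfolding CMcoeff_def coeff_add by (simp only: ring_distribs) simp
qed

lemma CMcoeff_smult: "CMcoeff n (smult k u) a = k * CMcoeff n u a"
proof -
  have "(\<Sum>c<a. if int N dvd int c - int a then wt n c * (k * coeff u c) else 0) =
     k * (\<Sum>c<a. if int N dvd int c - int a then wt n c * coeff u c else 0)"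
    unfolding sum_distrib_left by (rule sum.cong) (auto simp: algebra_simps)
  then show ?thesis unfolding CMcoeff_def coeff_smult by (simp add: right_diff_distrib)
qed

lemma CMf_add: "CMf n (u + v) = CMf n u + CMf n v"
  by (rule poly_eqI) (simp add: coeff_CMf CMcoeff_add)

lemma CMf_smult: "CMf n (smult k u) = smult k (CMf n u)"
  by (rule poly_eqI) (simp add: coeff_CMf CMcoeff_smult)

lemma CMf_0 [simp]: "CMf n 0 = 0"
  using CMf_smult[of n 0 0] by simp

lemma CMf_small: "n < 2 \<Longrightarrow> CMf n u = 0"
  by (simp add: CMf_def)

lemma degree_CMf: "degree (CMf n u) \<le> n - 2"
  by (auto simp: degree_le_iff_coeff coeff_CMf)

text \<open>The long division stops here: from \<open>n\<close> on, the partial sum together with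
  the term c = a is the whole moment r = 0 of the class.\<close>

lemma CMcoeff_ge:
  assumes "qform n u" "n \<le> a"
  shows "CMcoeff n u a = 0"
proof (cases "m = 0")
  \<comment> \<open>There is no moment condition to use, but the partial sum carries the factor
    \<open>mn\<close>, which is 0.\<close>
  case True
  then show ?thesis
    using assms(2) qform_coeff[OF assms(1), of a]
    unfolding CMcoeff_def mn_def by (cases "a = n") simp_all
next
  case False
  define S where "S = (\<Sum>c<a. if int N dvd int c - int a then wt n c * coeff u c else 0)"
  have "0 = wsum (\<lambda>c. if int N dvd int c - int a then wt n c ^ (2 * 0 + 1) else 0) u"
    using assms(1) False unfolding qform_def by (metis neq0_conv)
  also have "\<dots> = (\<Sum>c\<le>a. coeff u c * (if int N dvd int c - int a then wt n c ^ (2 * 0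
      + 1) else 0))"
    using assms qform_degree by (intro wsum_bound) fastforce
  also have "\<dots> = S + coeff u a * wt n a"
    unfolding S_def lessThan_Suc_atMost[symmetric] sum.lessThan_Suc
    by (intro arg_cong2[of _ _ _ _ "(+)"] sum.cong) auto
  finally have "S = - (coeff u a * wt n a)"
    by (simp add: eq_neg_iff_add_eq_0)
  moreover have "coeff u a = 0" if "a \<noteq> n"
    using that assms qform_coeff by simp
  ultimately show ?thesis
    unfolding CMcoeff_def S_def[symmetric] by (cases "a = n") (simp_all add: wt_def algebra_simps)
qed

text \<open>The quotient has no coefficient at 0 and none from \<open>n\<close> on, so it is
  divisible by sigma_1 and the cut-off in \<open>CMf\<close> loses nothing.\<close>

lemma coeff_t_CMf: "qform n u \<Longrightarrow> coeff (pCons 0 (CMf n u)) a = CMcoeff n u a"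
  by (cases a) (auto simp: coeff_CMf CMcoeff_ge, auto simp: CMcoeff_def)

text \<open>No exponent strictly between a - N and a lies in the class of a, so the partial sums
  differ by one term. That term completes the coefficient at a - N to the one of
  \<open>up_part\<close>.\<close>

lemma CMcoeff_diff:
  assumes "N \<le> a"
  shows "CMcoeff n u (a - N) - CMcoeff n u a = coeff (up_part n u) (a - N) - coeff (down_part n u) a"
proof -
  define T where "T k = (\<Sum>c<k. if int N dvd int c - int a then wt n c * coeff u c else 0)" for k
  have "{..<a} = {..<a - N} \<union> {a - N} \<union> {a - N<..<a}"
    using assms N_pos by auto
  moreover have "(\<Sum>c\<in>{..<a - N} \<union> {a - N} \<union> {a - N<..<a}.
        if int N dvd int c - int a then wt n c * coeff u c else 0) =
      T (a - N) + wt n (a - N) * coeff u (a - N) +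
      (\<Sum>c\<in>{a - N<..<a}. if int N dvd int c - int a then wt n c * coeff u c else 0)"
    unfolding T_def using assms by (subst sum.union_disjoint; auto)+
  moreover have "(\<Sum>c\<in>{a - N<..<a}. if int N dvd int c - int a then wt n c * coeff u c else 0) = 0"
  proof (rule sum.neutral, rule ballI)
    fix c assume c: "c \<in> {a - N<..<a}"
    have "\<not> int N dvd int a - int c"
      using c assms by (intro zdvd_not_zless) auto
    then show "(if int N dvd int c - int a then wt n c * coeff u c else 0) = 0"
      by (simp add: dvd_diff_commute)
  qed
  ultimately have T: "T a = T (a - N) + wt n (a - N) * coeff u (a - N)"
    by (simp add: T_def)
  have "int N dvd int c - int (a - N) \<longleftrightarrow> int N dvd int c - int a" for c
  proof -
    have "int c - int (a - N) = (int c - int a) + int N"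
      using assms by simp
    then show ?thesis by (metis dvd_add_triv_right_iff)
  qed
  then have "CMcoeff n u (a - N) = of_nat (a - N) * (of_nat n - of_nat (a - N) - mn) * coeff u (a -
      N) - mn * T (a - N)"
    unfolding CMcoeff_def T_def by presburger
  moreover have "CMcoeff n u a = of_nat a * (of_nat n - of_nat a - mn) * coeff u a - mn * T a"
    by (simp add: CMcoeff_def T_def)
  ultimately show ?thesis
    unfolding T coeff_up_part coeff_down_part wt_def by algebra
qed

definition disc :: "complex poly" where "disc = monom 1 N - 1"

text \<open>The intrinsic description of \<open>CMf\<close>: its symmetry, its relation to the
  rational operator and its power series form are all derived from this equation.\<close>

lemma CMf_eqn:
  assumes "qform n u"
  shows "disc * pCons 0 (CMf n u) = monom 1 N * up_part n u - down_part n u"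
proof (rule poly_eqI)
  fix a
  show "coeff (disc * pCons 0 (CMf n u)) a = coeff (monom 1 N * up_part n u - down_part n u) a"
  proof (cases "N \<le> a")
    case True
    then show ?thesis
      using CMcoeff_diff[OF True, of n u]
      by (simp add: disc_def left_diff_distrib coeff_monom_mult coeff_t_CMf[OF assms] del: mult_pCons_right)
  next
    case False
    have "(\<Sum>c<a. if int N dvd int c - int a then wt n c * coeff u c else 0) = 0"
    proof (rule sum.neutral, rule ballI)
      fix c assume c: "c \<in> {..<a}"
      have "\<not> int N dvd int a - int c"
        using c False by (intro zdvd_not_zless) auto
      then show "(if int N dvd int c - int a then wt n c * coeff u c else 0) = 0"
        by (simp add: dvd_diff_commute)
    qed
    then show ?thesis
      using False
      by (simp add: disc_def left_diff_distrib coeff_monom_mult coeff_t_CMf[OF assms] CMcoeff_def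
          coeff_down_part
          del: mult_pCons_right)
  qed
qed

text \<open>Both sides of \<open>CMf_eqn\<close> are paired with an even power of 2a - n - N on one
  class. Multiplication by z^N raises 2a - n by 2N, so the left side tests the quotient against an
  odd polynomial in 2a - n of degree 2r + 1, and the right side tests \<open>u\<close> against an
  odd polynomial \<open>B\<close>. The lower odd powers on the left vanish by induction.\<close>

lemma qform_CMf_moment:
  assumes "qform n u" "r < m"
  shows "moment n e r (pCons 0 (CMf n u)) = 0"
  using assms(2)
proof (induction r rule: less_induct)
  case (less r)
  define v where "v = pCons 0 (CMf n u)"
  define k where "k = r + 1"
  define c where "c = (of_nat N :: complex)"
  define hplus hminus where "hplus = [:c, 1:] ^ (2 * k)" and "hminus = [:- c, 1:] ^ (2 * k)"
  have cp: "coeff hplus i = (if i \<le> 2 * k then of_nat (2 * k choose i) * c ^ (2 * k - i) else 0)" for i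
    by (auto simp: hplus_def coeff_linear_poly_power coeff_eq_0 degree_linear_power)
  have cm: "coeff hminus i = (if i \<le> 2 * k then of_nat (2 * k choose i) * (- c) ^ (2 * k - i)
      else 0)" for i
    by (auto simp: hminus_def coeff_linear_poly_power coeff_eq_0 degree_linear_power)
  define Q where "Q = hplus - hminus"
  define S where "S = hplus + hminus"
  have cQ: "coeff Q i = (if odd i \<and> i \<le> 2 * k then 2 * of_nat (2 * k choose i) * c ^ (2 * k
      - i) else 0)" for i
    by (cases "even i") (auto simp: Q_def cp cm uminus_power_if)
  have cS: "coeff S i = (if even i \<and> i \<le> 2 * k then 2 * of_nat (2 * k choose i) * c ^ (2 *
      k - i) else 0)" for i
    by (cases "even i") (auto simp: S_def cp cm uminus_power_if)
  define B where "B = smult (1/4) (smult (of_nat n * (of_nat n - 2 * mn)) Q - pCons 0 (pCons 0 Q) +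
      smult (2 * mn) (pCons 0 S))"
  \<comment> \<open>Formally \<open>B\<close> has degree 2k + 1, which is too large when k = m. Its
    top coefficient is a multiple of mN - kN and cancels exactly then; this is where the coefficient
    2m of L enters.\<close>
  have top: "coeff (smult (2 * mn) (pCons 0 S) - pCons 0 (pCons 0 Q)) i = 0" if "i \<ge> 2 * m" for i
  proof (cases "i = 2 * k + 1")
    case True
    then have "m = k" using that less.prems by (auto simp: k_def)
    then have mk: "mn = of_nat k * c"
      unfolding mn_def c_def by simp
    have "coeff Q (2 * k - 1) = 2 * of_nat (2 * k) * c"
      using binomial_symmetric[of 1 "2 * k"] by (simp add: cQ k_def)
    moreover have "coeff S (2 * k) = 2"
      by (simp add: cS)
    ultimately show ?thesis
      using True mk by (simp add: coeff_pCons k_def algebra_simps split: nat.split)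
  next
    case False
    have "k \<le> m" using less.prems by (simp add: k_def)
    then have "even i \<or> 2 * k + 3 \<le> i"
      using that False by presburger
    moreover have "coeff (pCons 0 S) i = (if i = 0 then 0 else coeff S (i - 1))"
      "coeff (pCons 0 (pCons 0 Q)) i = (if i < 2 then 0 else coeff Q (i - 2))"
      by (auto simp: coeff_pCons split: nat.split)
    ultimately show ?thesis
      unfolding coeff_diff coeff_smult by (auto simp: cQ cS)
  qed
  have "odd_poly B"
    by (auto simp: odd_poly_def B_def cQ cS coeff_pCons split: nat.splits if_splits)
  moreover have "coeff B i = 0" if "i \<ge> 2 * m" for i
  proof -
    have "coeff Q i = 0"
      using that less.prems by (auto simp: cQ k_def) presburger
    then show ?thesis
      using top[OF that] unfolding B_def coeff_smult coeff_add coeff_diff by simp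
  qed
  ultimately have B0: "wsum (\<lambda>a. if int N dvd int a - e then poly B (wt n a) else 0) u = 0"
    by (intro qform_odd_poly assms)
  define F where "F a = (if int N dvd int a - e then (wt n a - c) ^ (2 * k) else 0)" for a
  have FN: "F (a + N) = (if int N dvd int a - e then (wt n a + c) ^ (2 * k) else 0)" for a
  proof -
    have "int N dvd int (a + N) - e \<longleftrightarrow> int N dvd int a - e"
      by (metis add.commute add_diff_eq dvd_add_triv_left_iff of_nat_add)
    then show ?thesis
      by (simp add: F_def wt_def c_def algebra_simps)
  qed
  have "wsum (\<lambda>a. F (a + N) - F a) v = wsum F (disc * v)"
    by (simp add: disc_def left_diff_distrib wsum_diff wsum_monom_mult wsum_diff_fun)
  also have "\<dots> = wsum (\<lambda>a. F (a + N)) (up_part n u) - wsum F (down_part n u)"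
    unfolding v_def CMf_eqn[OF assms(1)] wsum_diff wsum_monom_mult by (rule refl)
  also have "\<dots> = wsum (\<lambda>a. if int N dvd int a - e then poly B (wt n a) else 0) u"
  proof -
    have du: "degree (up_part n u) \<le> degree u" "degree (down_part n u) \<le> degree u"
      by (auto simp: degree_le_iff_coeff coeff_up_part coeff_down_part coeff_eq_0)
    have "wsum (\<lambda>a. F (a + N)) (up_part n u) - wsum F (down_part n u) =
       (\<Sum>a\<le>degree u. coeff (up_part n u) a * F (a + N) - coeff (down_part n u) a * F a)"
      by (simp add: wsum_bound[OF du(1)] wsum_bound[OF du(2)] sum_subtractf)
    also have "\<dots> = (\<Sum>a\<le>degree u. coeff u a * (if int N dvd int a - e then poly B (wt
        n a) else 0))"
    proof (rule sum.cong[OF refl])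
      fix a
      define x where "x = wt n a"
      have xa: "of_nat a = (of_nat n + x) / 2"
        by (simp add: x_def wt_def)
      have pB: "poly B x = ((of_nat n * (of_nat n - 2 * mn) - x * x) * ((x + c) ^ (2 * k) - (x - c) ^ (2 * k))
          + 2 * mn * x * ((x + c) ^ (2 * k) + (x - c) ^ (2 * k))) / 4"
        unfolding B_def Q_def S_def hplus_def hminus_def
        by (simp add: poly_power add.commute[of c] left_diff_distrib diff_divide_distrib mult.assoc)
      show "coeff (up_part n u) a * F (a + N) - coeff (down_part n u) a * F a =
        coeff u a * (if int N dvd int a - e then poly B (wt n a) else 0)"
        unfolding FN unfolding F_def x_def[symmetric] coeff_up_part coeff_down_part xa
        by (auto simp: pB field_simps)
    qed
    finally show ?thesis by (simp add: wsum_def)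
  qed
  finally have Fz: "wsum (\<lambda>a. F (a + N) - F a) v = 0"
    using B0 by simp
  \<comment> \<open>This is 4kN, the leading coefficient of \<open>Q\<close>. What remains in
    \<open>Q'\<close> are odd powers below 2r + 1.\<close>
  define a1 where "a1 = coeff Q (2 * r + 1)"
  have a1: "a1 \<noteq> 0"
  proof -
    have "(4 + 4 * of_nat r :: complex) = of_nat (Suc (3 + 4 * r))"
      by simp
    then have "(4 + 4 * of_nat r :: complex) \<noteq> 0"
      by (simp only: of_nat_neq_0 not_False_eq_True)
    then show ?thesis
      using N_pos by (simp add: a1_def cQ k_def c_def)
  qed
  define Q' where "Q' = Q - monom a1 (2 * r + 1)"
  have "wsum (\<lambda>a. if int N dvd int a - e then poly Q' (wt n a) else 0) v = 0"
  proof (rule wsum_odd_poly[of _ r])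
    show "odd_poly Q'"
      by (auto simp: odd_poly_def Q'_def cQ a1_def coeff_diff split: if_splits)
    show "coeff Q' i = 0" if "2 * r \<le> i" for i
    proof (cases "i = 2 * r + 1")
      case True
      then show ?thesis by (simp add: Q'_def a1_def)
    next
      case False
      then have "coeff Q i = 0" using that by (auto simp: cQ k_def elim!: oddE)
      then show ?thesis using False by (simp add: Q'_def)
    qed
  qed (use less in \<open>auto simp: v_def\<close>)
  moreover have "F (a + N) - F a = (if int N dvd int a - e then poly Q' (wt n a) else 0)
      + a1 * (if int N dvd int a - e then wt n a ^ (2 * r + 1) else 0)" for a
    unfolding FN unfolding F_def
    by (auto simp: Q'_def Q_def hplus_def hminus_def poly_power poly_monom add.commute)
  ultimately have "a1 * moment n e r v = 0"
    using Fz by (simp add: wsum_add_fun wsum_mult_fun)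
  then show ?case using a1 by (simp add: v_def)
qed

lemma wsum_pCons: "wsum F (pCons 0 u) = wsum (\<lambda>a. F (a + 1)) u"
proof -
  have u: "pCons 0 u = monom 1 1 * u"
    by (simp add: monom_altdef)
  show ?thesis
    unfolding u by (rule wsum_monom_mult)
qed

text \<open>Multiplication by sigma_1 replaces (a, n) by (a + 1, n + 2), which fixes 2a - n and
  merely renames the classes.\<close>

lemma qform_t:
  assumes "degree u \<le> n"
  shows "qform (n + 2) (pCons 0 u) \<longleftrightarrow> qform n u"
proof -
  have w: "wt (n + 2) (a + 1) = wt n a" for a
    by (simp add: wt_def)
  have s: "int N dvd int (a + 1) - e \<longleftrightarrow> int N dvd int a - (e - 1)" for a e
    by (simp add: algebra_simps)
  have "(\<forall>e. \<forall>r<m. moment (n + 2) e r (pCons 0 u) = 0)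
    \<longleftrightarrow> (\<forall>e. \<forall>r<m. moment n (e - 1) r u = 0)"
    unfolding wsum_pCons w s ..
  also have "\<dots> \<longleftrightarrow> (\<forall>e. \<forall>r<m. moment n e r u = 0)"
    using all_shift[of "\<lambda>e. \<forall>r<m. moment n e r u = 0"] .
  finally have *: "(\<forall>e. \<forall>r<m. moment (n + 2) e r (pCons 0 u) = 0)
    \<longleftrightarrow> (\<forall>e. \<forall>r<m. moment n e r u = 0)" .
  have "degree (pCons 0 u) \<le> n + 2"
    using assms degree_pCons_le[of 0 u] by linarith
  then show ?thesis
    unfolding qform_def using * assms by blast
qed

lemma qform_CMf:
  assumes "qform n u"
  shows "qform (n - 2) (CMf n u)"
proof (cases "n < 2")
  case True
  then show ?thesis by (simp add: CMf_small)
next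
  case False
  then have n: "n = (n - 2) + 2" by simp
  have "degree (pCons 0 (CMf n u)) \<le> n"
    using degree_CMf[of n u] degree_pCons_le[of 0 "CMf n u"] n by linarith
  then have "qform n (pCons 0 (CMf n u))"
    using qform_CMf_moment[OF assms] by (simp add: qform_def)
  then show ?thesis
    using qform_t[OF degree_CMf[of n u]] n by simp
qed

end

section \<open>The reflection exchanging z and w\<close>

definition swap :: "nat \<Rightarrow> complex poly \<Rightarrow> complex poly" where
  "swap n u = (\<Sum>a\<le>n. monom (coeff u a) (n - a))"

lemma coeff_swap: "coeff (swap n u) a = (if a \<le> n then coeff u (n - a) else 0)"
proof -
  have "coeff (swap n u) a = (\<Sum>b\<le>n. if b = n - a \<and> a \<le> n then coeff u b else 0)"
    unfolding swap_def coeff_sum by (intro sum.cong) auto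
  also have "\<dots> = (if a \<le> n then coeff u (n - a) else 0)"
    by (cases "a \<le> n") (auto simp: sum.delta)
  finally show ?thesis .
qed

lemma degree_swap: "degree (swap n u) \<le> n"
  by (auto simp: degree_le_iff_coeff coeff_swap)

lemma swap_swap: "degree u \<le> n \<Longrightarrow> swap n (swap n u) = u"
  by (rule poly_eqI) (auto simp: coeff_swap coeff_eq_0)

lemma swap_add: "swap n (u + v) = swap n u + swap n v"
  by (rule poly_eqI) (auto simp: coeff_swap)

lemma swap_diff: "swap n (u - v) = swap n u - swap n v"
  by (rule poly_eqI) (auto simp: coeff_swap)

lemma swap_smult: "swap n (smult c u) = smult c (swap n u)"
  by (rule poly_eqI) (auto simp: coeff_swap)

lemma swap_0 [simp]: "swap n 0 = 0"
  by (rule poly_eqI) (auto simp: coeff_swap)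

lemma swap_1: "swap n 1 = monom 1 n"
  by (rule poly_eqI) (auto simp: coeff_swap)

lemma swap_monom: "a \<le> n \<Longrightarrow> swap n (monom c a) = monom c (n - a)"
  by (rule poly_eqI) (auto simp: coeff_swap)

text \<open>\<open>reflect_poly\<close> reverses with respect to the actual degree,
  \<open>swap n\<close> with respect to the degree of the form. Through this relation
  multiplicativity carries over in \<open>swap_mult\<close>.\<close>

lemma swap_reflect: "degree u \<le> n \<Longrightarrow> swap n u = monom 1 (n - degree u) * reflect_poly u"
  by (rule poly_eqI) (auto simp: coeff_swap coeff_monom_mult coeff_reflect_poly coeff_eq_0)

lemma swap_mult:
  assumes "degree u \<le> n" "degree v \<le> k"
  shows "swap (n + k) (u * v) = swap n u * swap k v"
proof (cases "u = 0 \<or> v = 0")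
  case False
  have mm: "monom 1 (a + b) = monom 1 a * (monom 1 b :: complex poly)" for a b
    by (simp add: mult_monom)
  from False have d: "degree (u * v) = degree u + degree v"
    by (simp add: degree_mult_eq)
  have "swap (n + k) (u * v) = monom 1 (n - degree u + (k - degree v)) * (reflect_poly u * reflect_poly v)"
    using assms d by (subst swap_reflect) (simp_all add: reflect_poly_mult)
  also have "\<dots> = (monom 1 (n - degree u) * reflect_poly u) * (monom 1 (k - degree v) * reflect_poly v)"
    unfolding mm by (simp only: mult_ac)
  finally show ?thesis
    using assms by (simp add: swap_reflect)
qed auto

lemma swap_pCons: "degree u \<le> n \<Longrightarrow> swap (n + 2) (pCons 0 u) = pCons 0 (swap n u)"
  by (rule poly_eqI) (auto simp: coeff_swap coeff_pCons coeff_eq_0 Suc_diff_le split: nat.split)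

lemma wsum_swap:
  assumes "degree u \<le> n"
  shows "wsum F (swap n u) = wsum (\<lambda>a. F (n - a)) u"
proof -
  have "wsum F (swap n u) = (\<Sum>a\<le>n. coeff u (n - a) * F a)"
    using wsum_bound[OF degree_swap[of n u], of F] by (simp add: coeff_swap)
  also have "\<dots> = (\<Sum>a\<le>n. coeff u a * F (n - a))"
    using sum.nat_diff_reindex[of "\<lambda>a. coeff u a * F (n - a)" "Suc n"]
    by (simp add: lessThan_Suc_atMost)
  also have "\<dots> = wsum (\<lambda>a. F (n - a)) u"
    using wsum_bound[OF assms] by simp
  finally show ?thesis .
qed

context dihedral
begin

text \<open>The exchange negates 2a - n and sends the class e to the class n - e, so odd moments
  only change sign.\<close>

lemma qform_swap:
  assumes "qform n u"
  shows "qform n (swap n u)"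
  unfolding qform_def
proof (intro conjI allI impI degree_swap)
  fix e r assume r: "r < m"
  have "moment n e r (swap n u) =
      wsum (\<lambda>a. if int N dvd int (n - a) - e then wt n (n - a) ^ (2 * r + 1) else 0) u"
    by (rule wsum_swap[OF qform_degree[OF assms]])
  also have "\<dots> = wsum (\<lambda>a. - 1 * (if int N dvd int a - (int n - e) then wt n a ^ (2 *
      r + 1) else 0)) u"
  proof (rule wsum_cong)
    fix a assume "coeff u a \<noteq> 0"
    then have a: "a \<le> n" using qform_coeff[OF assms] by (meson not_le)
    have "int (n - a) - e = - (int a - (int n - e))"
      using a by simp
    then have "int N dvd int (n - a) - e \<longleftrightarrow> int N dvd int a - (int n - e)"
      by (metis dvd_minus_iff)
    moreover have "wt n (n - a) = - wt n a"
      using a by (simp add: wt_def of_nat_diff)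
    ultimately show "(if int N dvd int (n - a) - e then wt n (n - a) ^ (2 * r + 1) else 0) =
        - 1 * (if int N dvd int a - (int n - e) then wt n a ^ (2 * r + 1) else 0)"
      by simp
  qed
  also have "\<dots> = 0"
    using assms r unfolding wsum_mult_fun qform_def by simp
  finally show "moment n e r (swap n u) = 0" .
qed

lemma disc_nz: "disc \<noteq> 0"
proof
  assume "disc = 0"
  then have "coeff disc N = 0" by simp
  then show False using N_pos by (simp add: disc_def coeff_1)
qed

lemma degree_disc: "degree disc \<le> N"
  by (auto simp: degree_le_iff_coeff disc_def coeff_1)

lemma swap_disc: "swap N disc = - disc"
  using N_pos by (auto intro!: poly_eqI simp: coeff_swap disc_def coeff_1)

text \<open>L commutes with the reflection: on \<open>CMf_eqn\<close> it exchanges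
  \<open>up_part\<close> and \<open>down_part\<close> and negates \<open>disc\<close>.\<close>

lemma swap_t_CMf:
  assumes "qform n u"
  shows "swap n (pCons 0 (CMf n u)) = pCons 0 (CMf n (swap n u))"
proof -
  have d: "degree (up_part n u) \<le> n" "degree (down_part n u) \<le> n"
    using qform_coeff[OF assms] by (auto simp: degree_le_iff_coeff coeff_up_part coeff_down_part)
  have d3: "degree (pCons 0 (CMf n u)) \<le> n"
    unfolding degree_le_iff_coeff coeff_t_CMf[OF assms] using CMcoeff_ge[OF assms] by simp
  have s: "swap n (up_part n u) = down_part n (swap n u)" "swap n (down_part n u) = up_part n (swap n u)"
    by (auto intro!: poly_eqI simp: coeff_swap coeff_up_part coeff_down_part of_nat_diff)
  have "- disc * swap n (pCons 0 (CMf n u)) = swap (N + n) (disc * pCons 0 (CMf n u))"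
    using swap_mult[OF degree_disc d3] by (simp add: swap_disc del: mult_pCons_right)
  also have "\<dots> = swap (N + n) (monom 1 N * up_part n u) - swap (N + n) (1 * down_part n u)"
    unfolding CMf_eqn[OF assms] swap_diff by simp
  also have "\<dots> = down_part n (swap n u) - monom 1 N * up_part n (swap n u)"
    using swap_mult[of 1 N "down_part n u" n]
    by (simp add: swap_mult d degree_monom_le swap_monom swap_1 s)
  also have "\<dots> = - disc * pCons 0 (CMf n (swap n u))"
    using CMf_eqn[OF qform_swap[OF assms]] by (simp del: mult_pCons_right)
  finally show ?thesis
    using disc_nz by (metis mult_cancel_left neg_equal_0_iff_equal)
qed

section \<open>Isotypic components and lower bounds for their degrees\<close>

definition isotyp :: "nat \<Rightarrow> int \<Rightarrow> complex \<Rightarrow> complex poly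
    \<Rightarrow> bool" where
  "isotyp n e \<epsilon> u \<longleftrightarrow> qform n u \<and> (\<forall>a. coeff u a \<noteq> 0
      \<longrightarrow> int N dvd int a - e) \<and>
     (\<epsilon> \<noteq> 0 \<longrightarrow> swap n u = smult \<epsilon> u)"

text \<open>Exponents fall by one, and the reflection commutes with L. The sign 0 stands for no
  symmetry requirement, the only useful choice for a class that the reflection moves.\<close>

lemma isotyp_CMf:
  assumes "isotyp n e \<epsilon> u" "2 \<le> n"
  shows "isotyp (n - 2) (e - 1) \<epsilon> (CMf n u)"
proof -
  have qform: "qform n u" using assms(1) by (simp add: isotyp_def)
  have "int N dvd int b - (e - 1)" if "coeff (CMf n u) b \<noteq> 0" for b
  proof -
    have "CMcoeff n u (b + 1) \<noteq> 0"
      using that by (auto simp: coeff_CMf split: if_splits)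
    then consider "coeff u (b + 1) \<noteq> 0"
      | "(\<Sum>c<b + 1. if int N dvd int c - int (b + 1) then wt n c * coeff u c else 0) \<noteq> 0"
      unfolding CMcoeff_def by fastforce
    then have "int N dvd int (b + 1) - e"
    proof cases
      case 1
      then show ?thesis using assms by (auto simp: isotyp_def)
    next
      case 2
      then obtain c where "(if int N dvd int c - int (b + 1) then wt n c * coeff u c else 0) \<noteq> 0"
        by (rule sum.not_neutral_contains_not_neutral)
      then have c: "int N dvd int c - int (b + 1)" "coeff u c \<noteq> 0"
        by (auto split: if_splits)
      then have "int N dvd int c - e"
        using assms by (auto simp: isotyp_def)
      then have "int N dvd (int c - e) - (int c - int (b + 1))"
        using c(1) by (rule dvd_diff)
      then show ?thesis by simp
    qed
    then show ?thesis by (simp add: algebra_simps)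
  qed
  moreover have "swap (n - 2) (CMf n u) = smult \<epsilon> (CMf n u)" if "\<epsilon> \<noteq> 0"
  proof -
    have "pCons 0 (swap (n - 2) (CMf n u)) = swap n (pCons 0 (CMf n u))"
      using swap_pCons[OF degree_CMf[of n u]] assms(2) by (metis le_add_diff_inverse2)
    also have "\<dots> = pCons 0 (smult \<epsilon> (CMf n u))"
      using assms(1) that by (simp add: swap_t_CMf[OF qform] isotyp_def CMf_smult)
    finally show ?thesis by simp
  qed
  ultimately show ?thesis
    using qform_CMf[OF qform] by (simp add: isotyp_def)
qed

lemma isotyp_t:
  assumes "isotyp n e \<epsilon> u"
  shows "isotyp (n + 2) (e + 1) \<epsilon> (pCons 0 u)"
  using assms qform_degree[of n u] qform_t[of u n] swap_pCons[of u n]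
  by (auto simp: isotyp_def coeff_pCons algebra_simps split: nat.splits)

text \<open>The smallest exponent of the class is e mod N, the largest is n - (n - e) mod N, and k +
  1 exponents in steps of N span at least kN.\<close>

lemma card_residue_class:
  assumes "Suc k \<le> card {a. a \<le> n \<and> int N dvd int a - e}"
  shows "int n \<ge> int (k * N) + e mod int N + (int n - e) mod int N"
proof -
  define r where "r = e mod int N"
  have r: "0 \<le> r" "r < int N" using N_pos by (auto simp: r_def)
  define A where "A = {a. a \<le> n \<and> int N dvd int a - e}"
  define q where "q = (int n - r) div int N"
  have A: "int a = r + int N * ((int a - r) div int N) \<and> 0 \<le> (int a - r) div int N \<and>
      (int a - r) div int N \<le> q" if "a \<in> A" for a
  proof -
    have "int N dvd int a - r"
    proof -
      have "int a - r = int a - e + int N * (e div int N)"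
        unfolding r_def by (simp add: minus_mult_div_eq_mod[symmetric])
      moreover have "int N dvd int a - e + int N * (e div int N)"
        using that by (intro dvd_add) (auto simp: A_def)
      ultimately show ?thesis by metis
    qed
    then have eq: "int N * ((int a - r) div int N) = int a - r"
      by simp
    moreover have "(int a - r) div int N \<le> q"
      unfolding q_def using that N_pos by (intro zdiv_mono1) (auto simp: A_def)
    moreover have "0 \<le> (int a - r) div int N"
    proof (rule ccontr)
      assume "\<not> 0 \<le> (int a - r) div int N"
      then have "int N * ((int a - r) div int N) \<le> int N * (- 1)"
        using N_pos by (intro mult_left_mono) auto
      then show False using r eq by simp
    qed
    ultimately show ?thesis by simp
  qed
  have "inj_on (\<lambda>a. (int a - r) div int N) A"
    using A by (intro inj_onI) (metis of_nat_eq_iff)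
  moreover have "(\<lambda>a. (int a - r) div int N) ` A \<subseteq> {0..q}"
    using A by auto
  ultimately have "card A \<le> card {0..q}"
    by (intro card_inj_on_le) auto
  then have "int (Suc k) \<le> q + 1"
    using assms A_def by auto
  then have k: "int k \<le> q" by simp
  have "(int n - e) mod int N = (int n - r) mod int N"
    unfolding r_def by (simp add: mod_diff_right_eq)
  moreover have "int n - r = int N * q + (int n - r) mod int N"
    unfolding q_def by simp
  moreover have "int N * int k \<le> int N * q"
    using k by (intro mult_left_mono) auto
  ultimately show ?thesis
    unfolding r_def[symmetric] by (simp add: mult.commute)
qed

lemma wt_eq_0_iff: "wt n a = 0 \<longleftrightarrow> 2 * a = n"
proof -
  have "wt n a = 0 \<longleftrightarrow> (of_nat (2 * a) :: complex) = of_nat n"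
    by (simp add: wt_def)
  then show ?thesis using of_nat_eq_iff by blast
qed

lemma wt_square_eq_iff: "(wt n a)\<^sup>2 = (wt n b)\<^sup>2 \<longleftrightarrow> a = b \<or> a + b = n"
proof -
  have "wt n a = wt n b \<longleftrightarrow> a = b"
    by (simp add: wt_def)
  moreover have "wt n a = - wt n b \<longleftrightarrow> a + b = n"
  proof -
    have "wt n a = - wt n b \<longleftrightarrow> 2 * (of_nat (a + b) :: complex) = 2 * of_nat n"
      by (auto simp: wt_def algebra_simps)
    then show ?thesis by (metis mult_cancel_left of_nat_eq_iff zero_neq_numeral)
  qed
  ultimately show ?thesis
    by (simp add: power2_eq_iff)
qed

lemma isotyp_moment:
  assumes "isotyp n e \<epsilon> u" "r < m"
  shows "wsum (\<lambda>a. wt n a ^ (2 * r + 1)) u = 0"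
proof -
  have "wsum (\<lambda>a. wt n a ^ (2 * r + 1)) u = moment n e r u"
    using assms(1) by (intro wsum_cong) (auto simp: isotyp_def)
  then show ?thesis
    using assms by (auto simp: isotyp_def qform_def)
qed

text \<open>The reflection a -> n - a preserves the class iff N divides 2e - n. Otherwise no two
  exponents of the class have opposite values of 2a - n, and none has the value 0.\<close>

lemma generic_wt:
  assumes "\<not> int N dvd 2 * e - int n" "int N dvd int a - e"
  shows "wt n a \<noteq> 0"
    and "int N dvd int b - e \<Longrightarrow> (wt n a)\<^sup>2 = (wt n b)\<^sup>2 \<Longrightarrow> a = b"
proof -
  have *: "a + b \<noteq> n" if "int N dvd int b - e" for b
  proof
    assume "a + b = n"
    then have "2 * e - int n = - ((int a - e) + (int b - e))"
      by auto
    then show False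
      using assms that by (metis dvd_add dvd_minus_iff)
  qed
  show "wt n a \<noteq> 0"
    using *[OF assms(2)] by (simp add: wt_eq_0_iff)
  show "a = b" if "int N dvd int b - e" "(wt n a)\<^sup>2 = (wt n b)\<^sup>2"
    using * that by (simp add: wt_square_eq_iff)
qed

text \<open>A nonzero \<open>u\<close> with m vanishing odd moments needs at least m + 1 exponents
  in its class.\<close>

lemma generic_gap:
  assumes "isotyp n e \<epsilon> u" "\<not> int N dvd 2 * e - int n" "u \<noteq> 0"
  shows "int n \<ge> int (m * N) + e mod int N + (int n - e) mod int N"
proof (rule card_residue_class, rule ccontr)
  define A where "A = {a. a \<le> n \<and> int N dvd int a - e}"
  assume "\<not> Suc m \<le> card {a. a \<le> n \<and> int N dvd int a - e}"
  then have "card A \<le> m" by (simp add: A_def)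
  moreover have "finite A" by (simp add: A_def)
  moreover have "a \<in> A" if "coeff u a \<noteq> 0" for a
    using assms(1) that qform_coeff[of n u a] by (auto simp: isotyp_def A_def not_le[symmetric])
  ultimately have "u = 0"
    using isotyp_moment[OF assms(1)] generic_wt[OF assms(2)]
    by (intro odd_moments_vanish_imp_zero[of m "wt n" u A]) (auto simp: A_def inj_on_def)
  then show False using assms by simp
qed

text \<open>An antisymmetric u equals w - swap w, where w is its part above n/2. The odd moments of
  w and of - swap w agree, so those of w vanish; above n/2 the values 2a - n are positive and have
  distinct squares.\<close>

lemma antisym_upper_half:
  assumes u: "isotyp n e (- 1) u"
    and A: "\<And>a. coeff u a \<noteq> 0 \<Longrightarrow> n < 2 * a \<Longrightarrow> a \<in> A"
        "finite A" "card A \<le> m"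
      "\<And>a. a \<in> A \<Longrightarrow> n < 2 * a"
  shows "u = 0"
proof -
  have qform: "qform n u" and sw: "swap n u = - u"
    using u by (auto simp: isotyp_def)
  have anti: "coeff u (n - a) = - coeff u a" if "a \<le> n" for a
    using arg_cong[OF sw, of "\<lambda>p. coeff p a"] that by (simp add: coeff_swap)
  define w where "w = (\<Sum>a\<in>{a. n < 2 * a \<and> a \<le> n}. monom (coeff u a) a)"
  have cw: "coeff w a = (if n < 2 * a then coeff u a else 0)" for a
  proof -
    have "coeff w a = (\<Sum>b\<in>{a. n < 2 * a \<and> a \<le> n}. if b = a then coeff u a else 0)"
      unfolding w_def coeff_sum by (intro sum.cong) auto
    then show ?thesis using qform_coeff[OF qform, of a] by auto
  qed
  have dw: "degree w \<le> n"
    using qform_coeff[OF qform] by (auto simp: degree_le_iff_coeff cw)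
  have "u = w - swap n w"
  proof (rule poly_eqI)
    fix a
    show "coeff u a = coeff (w - swap n w) a"
    proof (cases "a \<le> n")
      case True
      have "coeff u a = 0" if "2 * a = n"
      proof -
        have "n - a = a" using that by simp
        then show ?thesis using anti[OF True] by simp
      qed
      then show ?thesis
        using True anti[of a] anti[of "n - a"] by (auto simp: cw coeff_swap)
    next
      case False
      then show ?thesis using qform_coeff[OF qform] by (simp add: cw coeff_swap)
    qed
  qed
  moreover have "w = 0"
  proof (rule odd_moments_vanish_imp_zero[of m "wt n" _ A])
    fix r assume "r < m"
    then have "0 = wsum (\<lambda>a. wt n a ^ (2 * r + 1)) (w - swap n w)"
      using isotyp_moment[OF u] \<open>u = w - swap n w\<close> by simp
    also have "wsum (\<lambda>a. wt n a ^ (2 * r + 1)) (swap n w) = wsum (\<lambda>a. wt n (n - a) ^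
        (2 * r + 1)) w"
      by (rule wsum_swap[OF dw])
    then have "wsum (\<lambda>a. wt n a ^ (2 * r + 1)) (w - swap n w) =
        wsum (\<lambda>a. wt n a ^ (2 * r + 1)) w - wsum (\<lambda>a. wt n (n - a) ^ (2 * r + 1)) w"
      by (simp add: wsum_diff)
    also have "wsum (\<lambda>a. wt n (n - a) ^ (2 * r + 1)) w = wsum (\<lambda>a. - 1 * wt n a ^ (2
        * r + 1)) w"
    proof (rule wsum_cong)
      fix a assume "coeff w a \<noteq> 0"
      then have "a \<le> n" using dw le_degree order_trans by blast
      then have "wt n (n - a) = - wt n a"
        by (simp add: wt_def of_nat_diff)
      then show "wt n (n - a) ^ (2 * r + 1) = - 1 * wt n a ^ (2 * r + 1)" by simp
    qed
    finally show "wsum (\<lambda>a. wt n a ^ (2 * r + 1)) w = 0"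
      unfolding wsum_mult_fun by simp
  next
    show "inj_on (\<lambda>a. (wt n a)\<^sup>2) A"
    proof (rule inj_onI)
      fix a b assume "a \<in> A" "b \<in> A" "(wt n a)\<^sup>2 = (wt n b)\<^sup>2"
      then show "a = b"
        using A(4)[of a] A(4)[of b] by (auto simp: wt_square_eq_iff)
    qed
    show "wt n a \<noteq> 0" if "a \<in> A" for a
      using A(4)[OF that] by (simp add: wt_eq_0_iff)
  qed (use A in \<open>auto simp: cw split: if_splits\<close>)
  ultimately show ?thesis by simp
qed

text \<open>The class is r, r + N, ..., r + kN with n = 2r + kN. Its upper half has k - k div 2
  exponents, which is at most m unless k is at least 2m + 1.\<close>

lemma antisym_gap:
  assumes u: "isotyp n e (- 1) u" and e: "int N dvd 2 * e - int n" and "u \<noteq> 0"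
  shows "int n \<ge> int ((2 * m + 1) * N) + 2 * (e mod int N)"
proof (rule ccontr)
  assume less: "\<not> ?thesis"
  define r where "r = e mod int N"
  have r: "0 \<le> r" "r < int N" using N_pos by (auto simp: r_def)
  have e_r: "e = r + int N * (e div int N)"
    unfolding r_def by simp
  have "int N dvd int n - 2 * r"
  proof -
    have "int n - 2 * r = int N * (2 * (e div int N)) - (2 * e - int n)"
      using e_r by (simp add: algebra_simps)
    then show ?thesis using e by (metis dvd_diff dvd_triv_left)
  qed
  then obtain k where k: "int n = 2 * r + int N * k"
    by (metis add.commute diff_add_cancel dvdE)
  have k2: "k < 2 * int m + 1"
  proof (rule ccontr)
    assume "\<not> k < 2 * int m + 1"
    then have "int N * (2 * int m + 1) \<le> int N * k"
      by (intro mult_left_mono) auto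
    then show False
      using less k by (simp add: r_def[symmetric] algebra_simps)
  qed
  define A where "A = {a. n < 2 * a \<and> a \<le> n \<and> int N dvd int a - e}"
  have A: "int a = r + int N * ((int a - r) div int N) \<and> k < 2 * ((int a - r) div int N) \<and>
      (int a - r) div int N \<le> k" if "a \<in> A" for a
  proof -
    have "int N dvd int a - r"
    proof -
      have "int a - r = int a - e + int N * (e div int N)"
        using e_r by simp
      moreover have "int N dvd int a - e + int N * (e div int N)"
        using that by (intro dvd_add) (auto simp: A_def)
      ultimately show ?thesis by metis
    qed
    then have eq: "int N * ((int a - r) div int N) = int a - r"
      by simp
    have "int N * k < int N * (2 * ((int a - r) div int N))"
      using eq that k by (auto simp: A_def)
    then have "k < 2 * ((int a - r) div int N)"
      using N_pos by (simp only: mult_less_cancel_left_pos)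
    moreover have "int N * ((int a - r) div int N) < int N * (k + 1)"
      using eq that k r by (auto simp: A_def algebra_simps)
    then have "(int a - r) div int N < k + 1"
      using N_pos by (simp only: mult_less_cancel_left_pos)
    ultimately show ?thesis using eq by auto
  qed
  have "inj_on (\<lambda>a. (int a - r) div int N) A"
    using A by (intro inj_onI) (metis of_nat_eq_iff)
  moreover have "(\<lambda>a. (int a - r) div int N) ` A \<subseteq> {k div 2 + 1..k}"
    using A by force
  ultimately have "card A \<le> card {k div 2 + 1..k}"
    by (intro card_inj_on_le) auto
  also have "\<dots> \<le> m"
    using k2 by simp
  finally have "card A \<le> m" .
  then have "u = 0"
    using u qform_coeff[of n u]
    by (intro antisym_upper_half[OF u, of A]) (auto simp: A_def isotyp_def not_le[symmetric])
  then show False using assms by simp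
qed

end

section \<open>Derivatives, and Taylor expansion along a direction\<close>

lemma const2_hom:
  "const2 0 = 0" "const2 1 = 1" "const2 (a + b) = const2 a + const2 b"
  "const2 (a - b) = const2 a - const2 b" "const2 (- a) = - const2 a"
  "const2 (a * b) = const2 a * const2 b" "const2 (a ^ n) = const2 a ^ n"
proof -
  have 1: "const2 1 = 1" and m: "const2 (a * b) = const2 a * const2 b" for a b
    by (simp_all add: const2_def one_pCons)
  show "const2 (a ^ n) = const2 a ^ n"
    by (induction n) (simp_all only: power_0 power_Suc 1 m)
qed (simp_all add: const2_def one_pCons)

lemma const2_sum: "const2 (sum f A) = (\<Sum>a\<in>A. const2 (f a))"
  by (induction A rule: infinite_finite_induct) (simp_all add: const2_hom)

lemma const2_eq_0_iff [simp]: "const2 c = 0 \<longleftrightarrow> c = 0"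
  by (simp add: const2_def)

lemma const2_of_nat: "const2 (of_nat n) = of_nat n"
  by (induction n) (simp_all add: const2_hom)

lemma poly_dx1_add: "poly_dx1 (p + q) = poly_dx1 p + poly_dx1 q"
  by (rule poly_eqI) (simp add: coeff_poly_dx1 pderiv_add)

lemma poly_dx2_add: "poly_dx2 (p + q) = poly_dx2 p + poly_dx2 q"
  by (simp add: poly_dx2_def pderiv_add)

lemma poly_dx_const2: "poly_dx1 (const2 c) = 0" "poly_dx2 (const2 c) = 0"
  by (rule poly_eqI, simp add: coeff_poly_dx1 const2_def coeff_pCons pderiv_pCons split: nat.split)
    (simp add: poly_dx2_def const2_def pderiv_pCons)

lemma poly_dx_X: "poly_dx1 X1 = 1" "poly_dx1 X2 = 0" "poly_dx2 X1 = 0" "poly_dx2 X2 = 1"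
  by (rule poly_eqI, simp add: coeff_poly_dx1 X1_def coeff_pCons pderiv_pCons one_pCons split: nat.split)
    (rule poly_eqI, simp add: coeff_poly_dx1 X2_def coeff_pCons split: nat.split,
      simp_all add: poly_dx2_def X1_def X2_def pderiv_pCons one_pCons)

lemma poly_dx_Z:
  "poly_dx1 Z = 1" "poly_dx1 Zbar = 1" "poly_dx2 Z = const2 \<i>" "poly_dx2 Zbar = - const2 \<i>"
proof -
  have Zb: "Zbar = X1 + const2 (- \<i>) * X2"
    by (simp add: Zbar_def const2_hom)
  show "poly_dx1 Z = 1" "poly_dx1 Zbar = 1" "poly_dx2 Z = const2 \<i>" "poly_dx2 Zbar = - const2 \<i>"
    unfolding Zb Z_def
    by (simp_all add: poly_dx1_add poly_dx2_add poly_dx1_mult poly_dx2_mult poly_dx_const2 poly_dx_X)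
      (simp add: const2_hom)
qed

lemma poly_dir_add: "poly_dir \<alpha> (p + q) = poly_dir \<alpha> p + poly_dir \<alpha> q"
  by (simp add: poly_dir_def poly_dx1_add poly_dx2_add algebra_simps)

lemma poly_dir_mult: "poly_dir \<alpha> (p * q) = p * poly_dir \<alpha> q + q * poly_dir \<alpha> p"
  by (simp add: poly_dir_def poly_dx1_mult poly_dx2_mult algebra_simps)

lemma poly_dir_const2: "poly_dir \<alpha> (const2 c) = 0"
  by (simp add: poly_dir_def poly_dx_const2)

lemma poly_dir_funpow_add: "(poly_dir \<alpha> ^^ s) (p + q) = (poly_dir \<alpha> ^^ s) p +
    (poly_dir \<alpha> ^^ s) q"
  by (induction s) (simp_all add: poly_dir_add)

lemma poly_dir_funpow_const2: "(poly_dir \<alpha> ^^ Suc s) (const2 c) = 0"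
proof (induction s)
  case (Suc s)
  have "poly_dir \<alpha> 0 = 0"
    using poly_dir_const2[of \<alpha> 0] by (simp add: const2_hom)
  then show ?case
    using Suc by simp
qed (simp add: poly_dir_const2)

text \<open>The Taylor series of t |-> q(x + t \<alpha>). With the factorials it is a ring
  homomorphism, and quasiinvariance means that low odd terms are absent.\<close>

definition jet :: "real \<times> real \<Rightarrow> real \<times> real \<Rightarrow> poly2
    \<Rightarrow> complex fps" where
  "jet \<alpha> x q = Abs_fps (\<lambda>s. eval2 ((poly_dir \<alpha> ^^ s) q) x / fact s)"

lemma jet_nth: "fps_nth (jet \<alpha> x q) s = eval2 ((poly_dir \<alpha> ^^ s) q) x / fact s"
  by (simp add: jet_def)

lemma jet_deriv: "fps_deriv (jet \<alpha> x q) = jet \<alpha> x (poly_dir \<alpha> q)"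
  by (rule fps_ext) (simp add: jet_nth funpow_swap1 field_simps del: of_nat_Suc)

lemma jet_add: "jet \<alpha> x (p + q) = jet \<alpha> x p + jet \<alpha> x q"
  by (rule fps_ext) (simp add: jet_nth poly_dir_funpow_add add_divide_distrib)

lemma jet_const2: "jet \<alpha> x (const2 c) = fps_const c"
proof (rule fps_ext)
  fix s
  show "fps_nth (jet \<alpha> x (const2 c)) s = fps_nth (fps_const c) s"
    using poly_dir_funpow_const2[where \<alpha>=\<alpha> and s="s - 1" and c=c] eval2_simps(3)[of 0 x]
    by (cases s) (simp_all add: jet_nth const2_hom)
qed

text \<open>Both sides obey the product rule, so coefficient s + 1 for p and q follows from
  coefficient s for the pairs obtained by differentiating one factor.\<close>

lemma jet_mult: "jet \<alpha> x (p * q) = jet \<alpha> x p * jet \<alpha> x q"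
proof (rule fps_ext)
  fix s
  show "fps_nth (jet \<alpha> x (p * q)) s = fps_nth (jet \<alpha> x p * jet \<alpha> x q) s"
  proof (induction s arbitrary: p q)
    case (Suc s)
    have "of_nat (s + 1) * fps_nth (jet \<alpha> x (p * q)) (s + 1) = fps_nth (fps_deriv (jet
        \<alpha> x (p * q))) s"
      by (simp only: fps_deriv_nth)
    also have "\<dots> = fps_nth (jet \<alpha> x (p * poly_dir \<alpha> q)) s + fps_nth (jet
        \<alpha> x (q * poly_dir \<alpha> p)) s"
      by (simp add: jet_deriv poly_dir_mult jet_add)
    also have "\<dots> = fps_nth (fps_deriv (jet \<alpha> x p * jet \<alpha> x q)) s"
      by (simp add: Suc.IH jet_deriv[symmetric] mult.commute)
    also have "\<dots> = of_nat (s + 1) * fps_nth (jet \<alpha> x p * jet \<alpha> x q) (s + 1)"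
      by (simp only: fps_deriv_nth)
    finally show ?case
      by (simp del: of_nat_add of_nat_Suc)
  qed (simp add: jet_nth)
qed

lemma jet_power: "jet \<alpha> x (p ^ n) = jet \<alpha> x p ^ n"
  using jet_const2[of \<alpha> x 1] by (induction n) (simp_all add: jet_mult const2_hom)

lemma jet_sum: "jet \<alpha> x (sum f A) = (\<Sum>a\<in>A. jet \<alpha> x (f a))"
  using jet_const2[of \<alpha> x 0]
  by (induction A rule: infinite_finite_induct) (simp_all add: jet_add const2_hom)

lemma jet_linear:
  assumes "poly_dir \<alpha> p = const2 c"
  shows "jet \<alpha> x p = fps_const (eval2 p x) + fps_const c * fps_X"
proof (rule fps_ext)
  fix s
  consider "s = 0" | "s = 1" | k where "s = Suc (Suc k)"
    by (metis One_nat_def not0_implies_Suc)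
  then show "fps_nth (jet \<alpha> x p) s = fps_nth (fps_const (eval2 p x) + fps_const c * fps_X) s"
  proof cases
    case 3
    have "(poly_dir \<alpha> ^^ s) p = (poly_dir \<alpha> ^^ Suc k) (poly_dir \<alpha> p)"
      unfolding 3 by (simp only: funpow_Suc_right o_def)
    then have "(poly_dir \<alpha> ^^ s) p = 0"
      using assms poly_dir_funpow_const2 by simp
    then show ?thesis
      using 3 eval2_simps(3)[of 0 x] by (simp add: jet_nth const2_hom)
  qed (use assms in \<open>simp_all add: jet_nth\<close>)
qed

lemma quasiinvariants_jet:
  "q \<in> quasiinvariants N m \<longleftrightarrow> (\<forall>\<alpha>\<in>dihedral_roots N.
      \<forall>x. fst \<alpha> * fst x + snd \<alpha> * snd x = 0 \<longrightarrow>
     (\<forall>s. odd s \<and> s < 2 * m \<longrightarrow> fps_nth (jet \<alpha> x q) s = 0))"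
  unfolding quasiinvariants_def jet_nth by auto

text \<open>If two indices add up to an odd s < 2m, one of them is odd and below 2m.\<close>

lemma quasiinvariants_mult:
  assumes "p \<in> quasiinvariants N m" "q \<in> quasiinvariants N m"
  shows "p * q \<in> quasiinvariants N m"
  unfolding quasiinvariants_jet
proof (intro ballI allI impI)
  fix \<alpha> x s assume h: "\<alpha> \<in> dihedral_roots N" "fst \<alpha> * fst x + snd \<alpha>
      * snd x = 0" "odd s \<and> s < 2 * m"
  have "fps_nth (jet \<alpha> x p) i * fps_nth (jet \<alpha> x q) (s - i) = 0" if "i \<le> s" for i
  proof (cases "odd i")
    case True
    moreover have "i < 2 * m" using h that by simp
    ultimately have "fps_nth (jet \<alpha> x p) i = 0"
      using assms(1) h unfolding quasiinvariants_jet by blast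
    then show ?thesis by simp
  next
    case False
    then have "odd (s - i)" "s - i < 2 * m" using h that by auto
    then have "fps_nth (jet \<alpha> x q) (s - i) = 0"
      using assms(2) h unfolding quasiinvariants_jet by blast
    then show ?thesis by simp
  qed
  then show "fps_nth (jet \<alpha> x (p * q)) s = 0"
    unfolding jet_mult fps_mult_nth by (intro sum.neutral) auto
qed

lemma quasiinvariants_add:
  "p \<in> quasiinvariants N m \<Longrightarrow> q \<in> quasiinvariants N m \<Longrightarrow> p + q
      \<in> quasiinvariants N m"
  unfolding quasiinvariants_jet by (auto simp: jet_add)

lemma quasiinvariants_const2: "const2 c \<in> quasiinvariants N m"
  unfolding quasiinvariants_jet by (auto simp: jet_const2)

subsection \<open>Homogeneous polynomials and the moment conditions\<close>

text \<open>\<open>form n u\<close> is \<open>w\<^sup>n u(z/w)\<close>; coefficients of \<open>u\<close> beyond \<open>n\<close> are dropped.\<close>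

definition form :: "nat \<Rightarrow> complex poly \<Rightarrow> poly2" where
  "form n u = (\<Sum>a\<le>n. const2 (coeff u a) * Z ^ a * Zbar ^ (n - a))"

lemma form_0 [simp]: "form n 0 = 0"
  by (simp add: form_def const2_hom)

lemma form_add: "form n (u + v) = form n u + form n v"
  by (simp add: form_def const2_hom ring_distribs sum.distrib)

lemma form_diff: "form n (u - v) = form n u - form n v"
  by (simp add: form_def const2_hom left_diff_distrib sum_subtractf)

lemma form_smult: "form n (smult c u) = const2 c * form n u"
  by (simp add: form_def const2_hom sum_distrib_left mult.assoc)

lemma form_sum: "form n (sum f A) = (\<Sum>a\<in>A. form n (f a))"
  by (induction A rule: infinite_finite_induct) (simp_all add: form_add)

lemma form_monom:
  assumes "a \<le> n"
  shows "form n (monom c a) = const2 c * Z ^ a * Zbar ^ (n - a)"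
proof -
  have "form n (monom c a) = (\<Sum>b\<le>n. if b = a then const2 c * Z ^ a * Zbar ^ (n - a) else 0)"
    unfolding form_def by (rule sum.cong) (auto simp: const2_hom)
  then show ?thesis using assms by simp
qed

lemma form_1: "form 0 1 = 1"
  by (simp add: form_def const2_hom)

lemma form_mult:
  assumes "degree u \<le> n" "degree v \<le> k"
  shows "form (n + k) (u * v) = form n u * form k v"
proof -
  have "(\<Sum>a\<le>n. monom (coeff u a) a) * (\<Sum>b\<le>k. monom (coeff v b) b) =
      (\<Sum>a\<le>n. \<Sum>b\<le>k. monom (coeff u a * coeff v b) (a + b))"
    by (simp add: sum_product mult_monom)
  then have "u * v = (\<Sum>a\<le>n. \<Sum>b\<le>k. monom (coeff u a * coeff v b) (a + b))"
    unfolding poly_as_sum_of_monoms'[OF assms(1)] poly_as_sum_of_monoms'[OF assms(2)] .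
  then have "form (n + k) (u * v) = (\<Sum>a\<le>n. \<Sum>b\<le>k. form (n + k) (monom (coeff u a *
      coeff v b) (a + b)))"
    by (simp only: form_sum)
  also have "\<dots> = (\<Sum>a\<le>n. \<Sum>b\<le>k. (const2 (coeff u a) * Z ^ a * Zbar ^ (n - a))
      * (const2 (coeff v b) * Z ^ b * Zbar ^ (k - b)))"
  proof (intro sum.cong refl)
    fix a b assume "a \<in> {..n}" "b \<in> {..k}"
    then have e: "n + k - (a + b) = (n - a) + (k - b)" "a + b \<le> n + k" by auto
    show "form (n + k) (monom (coeff u a * coeff v b) (a + b)) =
       (const2 (coeff u a) * Z ^ a * Zbar ^ (n - a)) * (const2 (coeff v b) * Z ^ b * Zbar ^ (k - b))"
      unfolding form_monom[OF e(2)] e(1) const2_hom power_add by (simp only: mult_ac)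
  qed
  also have "\<dots> = form n u * form k v"
    unfolding form_def sum_product ..
  finally show ?thesis .
qed

lemma form_power: "degree u \<le> n \<Longrightarrow> form (k * n) (u ^ k) = form n u ^ k"
proof (induction k)
  case (Suc k)
  have "degree (u ^ k) \<le> k * n"
    using degree_power_le[of u k] Suc.prems by (metis mult.commute mult_le_mono2 order_trans)
  then show ?case
    using Suc form_mult[of u n "u ^ k" "k * n"] by simp
qed (simp add: form_1)

lemma sigma1_form: "sigma1 = form 2 (monom 1 1)"
  by (simp add: form_monom sigma1_def const2_hom)

lemma form_pCons: "degree u \<le> n \<Longrightarrow> form (n + 2) (pCons 0 u) = sigma1 * form n u"
  using form_mult[of "monom 1 1" 2 u n] degree_monom_le[of "1::complex" 1]
  by (simp add: sigma1_form monom_altdef add.commute)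

lemma sigma2_form: "sigma2 N = form N (monom 1 N + 1)"
proof -
  have "form N 1 = Zbar ^ N"
    using form_monom[of 0 N 1] by (simp add: const2_hom)
  then show ?thesis
    by (simp add: sigma2_def form_add form_monom const2_hom)
qed

text \<open>
  The Taylor coefficients of \<open>z\<^sup>a w\<^sup>b\<close> normal to a mirror. For \<open>a + b = n\<close> they are polynomials in
  \<open>a - b\<close> of exact degree and parity \<open>s\<close> (Krawtchouk polynomials), so on each mirror they may be
  replaced by the powers of \<open>a - b\<close>.
\<close>

definition krawt :: "nat \<Rightarrow> nat \<Rightarrow> nat \<Rightarrow> complex" where
  "krawt a b s = fps_nth ((1 + fps_X) ^ a * (1 - fps_X) ^ b) s"

lemma fps_mult_linear_nth:
  fixes f :: "complex fps"
  shows "fps_nth ((fps_const c + fps_const d * fps_X) * f) s = c * fps_nth f s + (if s = 0 then 0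
      else d * fps_nth f (s - 1))"
  by (cases s) (auto simp: ring_distribs mult.assoc)

lemma krawt_rec_left: "krawt (Suc a) b s = krawt a b s + (if s = 0 then 0 else krawt a b (s - 1))"
  using fps_mult_linear_nth[of 1 1 "(1 + fps_X) ^ a * (1 - fps_X) ^ b" s]
  by (simp add: krawt_def mult.assoc)

lemma krawt_rec_right: "krawt 0 (Suc b) s = krawt 0 b s - (if s = 0 then 0 else krawt 0 b (s - 1))"
  using fps_mult_linear_nth[of 1 "-1" "(1 - fps_X) ^ b" s]
  by (simp add: krawt_def flip: fps_const_neg)

lemma krawt_0: "krawt 0 0 s = (if s = 0 then 1 else 0)"
  by (simp add: krawt_def)

lemma krawt_at_0: "krawt a b 0 = 1"
proof (induction a)
  case 0
  show ?case by (induction b) (simp_all add: krawt_0 krawt_rec_right)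
qed (simp add: krawt_rec_left)

lemma krawt_zero: "s > a + b \<Longrightarrow> krawt a b s = 0"
proof (induction a arbitrary: s)
  case 0
  then show ?case
    by (induction b arbitrary: s) (auto simp: krawt_0 krawt_rec_right)
qed (auto simp: krawt_rec_left)

text \<open>A recursion instead of a rescaling of the variable by r, so that the point r = 0 of the
  mirror is included. For s > a + b the exponent is truncated, but both sides are 0 by
  \<open>krawt_zero\<close>.\<close>

lemma jet_line_nth:
  fixes r :: complex
  shows "fps_nth ((fps_const r + fps_const \<i> * fps_X) ^ a * (fps_const r - fps_const \<i> * fps_X) ^ b) s =
     r ^ (a + b - s) * \<i> ^ s * krawt a b s"
proof (induction a arbitrary: s)
  case 0
  show ?case
  proof (induction b arbitrary: s)
    case 0
    then show ?case by (simp add: krawt_0)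
  next
    case (Suc b)
    have "fps_nth ((fps_const r - fps_const \<i> * fps_X) ^ Suc b) s =
       r * fps_nth ((fps_const r - fps_const \<i> * fps_X) ^ b) s
       + (if s = 0 then 0 else - \<i> * fps_nth ((fps_const r - fps_const \<i> * fps_X) ^ b) (s - 1))"
      using fps_mult_linear_nth[of r "- \<i>" "(fps_const r - fps_const \<i> * fps_X) ^ b" s]
      by (simp flip: fps_const_neg)
    also have "\<dots> = r ^ (Suc b - s) * \<i> ^ s * krawt 0 (Suc b) s"
    proof (cases s)
      case 0
      then show ?thesis using Suc by (simp add: krawt_rec_right)
    next
      case (Suc k)
      have IH: "fps_nth ((fps_const r - fps_const \<i> * fps_X) ^ b) s = r ^ (b - s) * \<i> ^ s *
          krawt 0 b s" for s
        using Suc.IH[of s] by simp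
      show ?thesis
      proof (cases "Suc k \<le> b")
        case True
        then have "b - k = Suc (b - Suc k)" by simp
        then show ?thesis
          unfolding IH using Suc by (simp add: krawt_rec_right algebra_simps)
      next
        case False
        then show ?thesis
          unfolding IH using Suc by (simp add: krawt_rec_right krawt_zero)
      qed
    qed
    finally show ?case by simp
  qed
next
  case (Suc a)
  define f where "f = (fps_const r + fps_const \<i> * fps_X) ^ a * (fps_const r - fps_const \<i> * fps_X) ^ b"
  have "fps_nth ((fps_const r + fps_const \<i> * fps_X) ^ Suc a * (fps_const r - fps_const \<i> *
      fps_X) ^ b) s =
     r * fps_nth f s + (if s = 0 then 0 else \<i> * fps_nth f (s - 1))"
    using fps_mult_linear_nth[of r "\<i>" f s]
    by (simp add: f_def mult.assoc)
  also have "\<dots> = r ^ (Suc a + b - s) * \<i> ^ s * krawt (Suc a) b s"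
  proof (cases s)
    case 0
    have "fps_nth f 0 = r ^ (a + b)"
      using Suc.IH[of 0] by (simp only: f_def krawt_at_0) simp
    then show ?thesis using 0 by (simp add: krawt_at_0)
  next
    case (Suc k)
    have IH: "fps_nth f s = r ^ (a + b - s) * \<i> ^ s * krawt a b s" for s
      using Suc.IH[of s] by (simp add: f_def)
    show ?thesis
    proof (cases "Suc k \<le> a + b")
      case True
      then have "a + b - k = Suc (a + b - Suc k)" by simp
      then show ?thesis
        unfolding IH using Suc by (simp add: krawt_rec_left algebra_simps)
    next
      case False
      then show ?thesis
        unfolding IH using Suc by (simp add: krawt_rec_left krawt_zero)
    qed
  qed
  finally show ?case .
qed

text \<open>The generating function f = (1 + X)^a (1 - X)^b satisfies (1 - X^2) f' = (a - b - (a +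
  b) X) f; compare coefficients.\<close>

lemma krawt_three_term:
  "of_nat (Suc s) * krawt a b (Suc s) = (of_nat a - of_nat b) * krawt a b s
     - (if s = 0 then 0 else (of_nat (a + b) - of_nat (s - 1)) * krawt a b (s - 1))"
proof -
  define f where "f = (1 + fps_X :: complex fps) ^ a * (1 - fps_X) ^ b"
  have 1: "(1 + fps_X) * fps_deriv ((1 + fps_X) ^ a) = of_nat a * (1 + fps_X :: complex fps) ^ a"
    by (cases a) (simp_all add: fps_deriv_power'[of "1 + fps_X"] mult_ac del: of_nat_Suc
        fps_deriv_mult power_Suc,
      simp add: mult_ac)
  have 2: "(1 - fps_X) * fps_deriv ((1 - fps_X) ^ b) = - of_nat b * (1 - fps_X :: complex fps) ^ b"
    by (cases b) (simp_all add: fps_deriv_power'[of "1 - fps_X"] mult_ac del: of_nat_Suc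
        fps_deriv_mult power_Suc,
      simp add: mult_ac)
  have "(1 - fps_X * fps_X) * fps_deriv f =
     (1 - fps_X) * (1 - fps_X) ^ b * ((1 + fps_X) * fps_deriv ((1 + fps_X) ^ a))
     + (1 + fps_X) * (1 + fps_X) ^ a * ((1 - fps_X) * fps_deriv ((1 - fps_X) ^ b))"
    unfolding f_def fps_deriv_mult by (simp only: algebra_simps mult_1_left mult_1_right)
  also have "\<dots> = of_nat a * f - of_nat b * f - of_nat (a + b) * (fps_X * f)"
    unfolding 1 2 f_def of_nat_add by (simp only: algebra_simps) simp
  finally have "fps_nth (fps_deriv f - fps_X * (fps_X * fps_deriv f)) s =
     fps_nth (fps_const (of_nat a) * f - fps_const (of_nat b) * f - fps_const (of_nat (a + b)) *
         (fps_X * f)) s"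
    by (simp only: left_diff_distrib mult_1_left mult.assoc fps_of_nat)
  then show ?thesis
    unfolding krawt_def f_def[symmetric]
    by (cases s; cases "s - 1") (auto simp: algebra_simps)
qed

lemma krawt_poly:
  "\<exists>P. (\<forall>a\<le>n. krawt a (n - a) s = poly P (wt n a)) \<and> coeff P s \<noteq> 0 \<and>
     (\<forall>i. coeff P i \<noteq> 0 \<longrightarrow> i \<le> s \<and> even (s + i))"
proof (induction s rule: less_induct)
  case (less s)
  consider "s = 0" | "s = 1" | k where "s = Suc (Suc k)"
    by (metis One_nat_def not0_implies_Suc)
  then show ?case
  proof cases
    case 1
    then show ?thesis
      by (intro exI[of _ 1]) (auto simp: krawt_at_0 coeff_1)
  next
    case 2
    have "krawt a (n - a) 1 = poly [:0, 1:] (wt n a)" if "a \<le> n" for a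
      using krawt_three_term[of 0 a "n - a"] that by (simp add: wt_def krawt_at_0 of_nat_diff)
    then show ?thesis
      using 2 by (intro exI[of _ "[:0, 1:]"]) (auto simp: coeff_pCons split: nat.splits)
  next
    case (3 k)
    obtain P where P: "\<forall>a\<le>n. krawt a (n - a) k = poly P (wt n a)"
      "\<forall>i. coeff P i \<noteq> 0 \<longrightarrow> i \<le> k \<and> even (k + i)"
      using less[of k] 3 by auto
    obtain Q where Q: "\<forall>a\<le>n. krawt a (n - a) (Suc k) = poly Q (wt n a)" "coeff Q (Suc k)
        \<noteq> 0"
      "\<forall>i. coeff Q i \<noteq> 0 \<longrightarrow> i \<le> Suc k \<and> even (Suc k + i)"
      using less[of "Suc k"] 3 by auto
    define R where "R = smult (inverse (of_nat s)) (pCons 0 Q - smult (of_nat n - of_nat k) P)"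
    have s0: "(of_nat s :: complex) \<noteq> 0" using 3 by (simp del: of_nat_Suc)
    have "krawt a (n - a) s = poly R (wt n a)" if "a \<le> n" for a
    proof -
      have "of_nat s * krawt a (n - a) s = wt n a * poly Q (wt n a) - (of_nat n - of_nat k) * poly P (wt n a)"
        using krawt_three_term[of "Suc k" a "n - a"] that P(1) Q(1) 3
        by (simp add: wt_def of_nat_diff algebra_simps)
      then have "krawt a (n - a) s = inverse (of_nat s) * (wt n a * poly Q (wt n a) - (of_nat n -
          of_nat k) * poly P (wt n a))"
        using s0 by (simp add: field_simps)
      then show ?thesis by (simp add: R_def)
    qed
    moreover have "coeff P s = 0" using P(2) 3 by fastforce
    then have "coeff R s \<noteq> 0"
      using Q(2) s0 3 by (simp add: R_def)
    moreover have "i \<le> s \<and> even (s + i)" if "coeff R i \<noteq> 0" for i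
    proof -
      have "coeff (pCons 0 Q) i \<noteq> 0 \<or> coeff P i \<noteq> 0"
        using that unfolding R_def coeff_smult coeff_diff by auto
      then show ?thesis
        using P(2) Q(3) 3 by (cases i) auto
    qed
    ultimately show ?thesis by blast
  qed
qed

text \<open>The passage between Krawtchouk values and powers is triangular with nonzero diagonal and
  respects parity. The weight \<open>y\<close> will be the root of unity attached to a
  mirror.\<close>

lemma krawt_odd_iff:
  assumes "degree u \<le> n"
  shows "(\<forall>s. odd s \<and> s < 2 * m \<longrightarrow> wsum (\<lambda>a. y a * krawt a (n -
      a) s) u = 0) \<longleftrightarrow>
     (\<forall>r<m. wsum (\<lambda>a. y a * wt n a ^ (2 * r + 1)) u = 0)"
proof -
  have exp: "\<exists>P. wsum (\<lambda>a. y a * krawt a (n - a) s) u = (\<Sum>i\<le>s. coeff P i *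
      wsum (\<lambda>a. y a * wt n a ^ i) u) \<and>
     coeff P s \<noteq> 0 \<and> (\<forall>i. coeff P i \<noteq> 0 \<longrightarrow> i \<le> s
         \<and> even (s + i))" for s
  proof -
    obtain P where P: "\<forall>a\<le>n. krawt a (n - a) s = poly P (wt n a)" "coeff P s \<noteq> 0"
      "\<forall>i. coeff P i \<noteq> 0 \<longrightarrow> i \<le> s \<and> even (s + i)"
      using krawt_poly[of n s] by blast
    have "degree P \<le> s"
      using P(3) by (auto simp: degree_le_iff_coeff not_le[symmetric])
    then have poly: "poly P x = (\<Sum>i\<le>s. coeff P i * x ^ i)" for x
      unfolding poly_altdef by (intro sum.mono_neutral_left) (auto simp: coeff_eq_0)
    have "wsum (\<lambda>a. y a * krawt a (n - a) s) u = wsum (\<lambda>a. \<Sum>i\<le>s. coeff P i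
        * (y a * wt n a ^ i)) u"
    proof (intro wsum_cong)
      fix a assume "coeff u a \<noteq> 0"
      then have "a \<le> n" using assms le_degree order_trans by blast
      then show "y a * krawt a (n - a) s = (\<Sum>i\<le>s. coeff P i * (y a * wt n a ^ i))"
        using P(1) poly[of "wt n a"] by (simp add: sum_distrib_left mult.left_commute)
    qed
    then show ?thesis
      unfolding wsum_sum_fun wsum_mult_fun using P by blast
  qed
  show ?thesis
  proof (intro iffI allI impI)
    fix r assume h: "\<forall>s. odd s \<and> s < 2 * m \<longrightarrow> wsum (\<lambda>a. y a *
        krawt a (n - a) s) u = 0" and r: "r < m"
    from r show "wsum (\<lambda>a. y a * wt n a ^ (2 * r + 1)) u = 0"
    proof (induction r rule: less_induct)
      case (less r)
      obtain P where P: "wsum (\<lambda>a. y a * krawt a (n - a) (2 * r + 1)) u = (\<Sum>i\<le>2 * r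
          + 1. coeff P i * wsum (\<lambda>a. y a * wt n a ^ i) u)"
        "coeff P (2 * r + 1) \<noteq> 0" "\<forall>i. coeff P i \<noteq> 0 \<longrightarrow> i \<le>
            2 * r + 1 \<and> even (2 * r + 1 + i)"
        using exp[of "2 * r + 1"] by blast
      have "(\<Sum>i<2 * r + 1. coeff P i * wsum (\<lambda>a. y a * wt n a ^ i) u) = 0"
      proof (rule sum.neutral, rule ballI)
        fix i assume i: "i \<in> {..<2 * r + 1}"
        show "coeff P i * wsum (\<lambda>a. y a * wt n a ^ i) u = 0"
        proof (cases "coeff P i = 0")
          case False
          then have "odd i" using P(3) by fastforce
          then obtain k where "i = 2 * k + 1" by (auto elim: oddE)
          then show ?thesis using less.IH[of k] less.prems i by auto
        qed simp
      qed
      moreover have "(\<Sum>i\<le>2 * r + 1. coeff P i * wsum (\<lambda>a. y a * wt n a ^ i) u) =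
          (\<Sum>i<2 * r + 1. coeff P i * wsum (\<lambda>a. y a * wt n a ^ i) u) + coeff P (2 * r +
              1) * wsum (\<lambda>a. y a * wt n a ^ (2 * r + 1)) u"
        by (simp only: lessThan_Suc_atMost[symmetric] sum.lessThan_Suc)
      moreover have "wsum (\<lambda>a. y a * krawt a (n - a) (2 * r + 1)) u = 0"
        using h less.prems by simp
      ultimately show ?case
        using P(1,2) by simp
    qed
  next
    fix s assume h: "\<forall>r<m. wsum (\<lambda>a. y a * wt n a ^ (2 * r + 1)) u = 0" and s: "odd
        s \<and> s < 2 * m"
    obtain P where P: "wsum (\<lambda>a. y a * krawt a (n - a) s) u = (\<Sum>i\<le>s. coeff P i *
        wsum (\<lambda>a. y a * wt n a ^ i) u)"
      "\<forall>i. coeff P i \<noteq> 0 \<longrightarrow> i \<le> s \<and> even (s + i)"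
      using exp[of s] by blast
    have "(\<Sum>i\<le>s. coeff P i * wsum (\<lambda>a. y a * wt n a ^ i) u) = 0"
    proof (rule sum.neutral, rule ballI)
      fix i assume i: "i \<in> {..s}"
      show "coeff P i * wsum (\<lambda>a. y a * wt n a ^ i) u = 0"
      proof (cases "coeff P i = 0")
        case False
        then have "odd i" using P(2) s by fastforce
        then obtain k where k: "i = 2 * k + 1" by (auto elim: oddE)
        then have "k < m" using i s by auto
        then show ?thesis using h k by auto
      qed simp
    qed
    then show "wsum (\<lambda>a. y a * krawt a (n - a) s) u = 0" using P by simp
  qed
qed

section \<open>Roots of unity and the mirrors\<close>

definition zeta :: "nat \<Rightarrow> complex" where
  "zeta N = cis (2 * pi / real N)"

text \<open>The mirror with normal \<open>alpha N j\<close> consists of the real multiples of this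
  number, see \<open>line_pt_complex\<close>.\<close>

definition rho :: "nat \<Rightarrow> nat \<Rightarrow> complex" where
  "rho N j = cis (pi * real j / real N)"

lemma zeta_power: "zeta N ^ t = cis (2 * pi * real t / real N)"
  by (simp add: zeta_def DeMoivre mult_ac)

lemma rho_square: "rho N j ^ 2 = zeta N ^ j"
  by (simp add: zeta_power rho_def DeMoivre mult_ac)

lemma rho_cnj: "rho N j * cnj (rho N j) = 1"
  by (simp add: rho_def cis_cnj cis_mult)

lemma rho_neq_0 [simp]: "rho N j \<noteq> 0"
  by (simp add: rho_def)

lemma zeta_power_N: "N > 0 \<Longrightarrow> zeta N ^ N = 1"
  by (simp add: zeta_power)

lemma zeta_inj:
  assumes "N > 0"
  shows "inj_on (\<lambda>j. zeta N ^ j) {..<N}"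
  using bij_betw_roots_unity[OF assms] unfolding bij_betw_def zeta_power by simp

lemma zeta_power_mod:
  assumes "N > 0"
  shows "zeta N ^ t = zeta N ^ (t mod N)"
proof -
  have "zeta N ^ t = zeta N ^ (N * (t div N) + t mod N)"
    by simp
  then show ?thesis
    using zeta_power_N[OF assms] by (simp only: power_add power_mult) simp
qed

lemma zeta_power_eq_1_iff:
  assumes "N > 0"
  shows "zeta N ^ t = 1 \<longleftrightarrow> N dvd t"
proof -
  have "zeta N ^ t = 1 \<longleftrightarrow> zeta N ^ (t mod N) = zeta N ^ 0"
    using zeta_power_mod[OF assms, of t] by simp
  also have "\<dots> \<longleftrightarrow> t mod N = 0"
    using assms inj_onD[OF zeta_inj[OF assms], of "t mod N" 0] by auto
  finally show ?thesis by (simp add: dvd_eq_mod_eq_0)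
qed

lemma sum_zeta:
  assumes "N > 0"
  shows "(\<Sum>j<N. zeta N ^ (j * t)) = (if N dvd t then of_nat N else 0)"
proof (cases "N dvd t")
  case True
  then have "zeta N ^ (j * t) = 1" for j
    using assms by (simp add: zeta_power_eq_1_iff)
  then show ?thesis using True by simp
next
  case False
  then have "zeta N ^ t \<noteq> 1" using assms by (simp add: zeta_power_eq_1_iff)
  moreover have "(zeta N ^ t) ^ N = 1"
    using assms by (simp add: zeta_power_eq_1_iff flip: power_mult)
  ultimately have "(\<Sum>j<N. (zeta N ^ t) ^ j) = 0"
    by (simp add: geometric_sum)
  then show ?thesis
    using False by (simp add: mult.commute flip: power_mult)
qed

text \<open>A discrete Fourier transform on Z/N: it trades conditions indexed by the N mirrors for
  conditions indexed by the residue classes of exponents.\<close>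

lemma residue_class_sums:
  assumes "N > 0"
  shows "(\<forall>j<N. wsum (\<lambda>a. zeta N ^ (j * a) * h a) u = 0) \<longleftrightarrow>
    (\<forall>e. wsum (\<lambda>a. if int N dvd int a - e then h a else 0) u = 0)"
proof (intro iffI allI impI)
  fix e :: int assume h: "\<forall>j<N. wsum (\<lambda>a. zeta N ^ (j * a) * h a) u = 0"
  \<comment> \<open>A nonnegative representative of -e, so that Fourier inversion uses natural
    powers of \<open>zeta N\<close> only.\<close>
  define k where "k = nat ((- e) mod int N)"
  have k: "int k = (- e) mod int N" using assms by (simp add: k_def)
  have "int N dvd int a - e \<longleftrightarrow> N dvd a + k" for a
  proof -
    have "N dvd a + k \<longleftrightarrow> (int a + (- e) mod int N) mod int N = 0"
      using k by (metis dvd_eq_mod_eq_0 of_nat_add of_nat_dvd_iff)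
    also have "\<dots> \<longleftrightarrow> (int a - e) mod int N = 0"
      by (simp add: mod_add_right_eq)
    finally show ?thesis by (simp add: dvd_eq_mod_eq_0)
  qed
  then have "wsum (\<lambda>a. of_nat N * (if int N dvd int a - e then h a else 0)) u =
      wsum (\<lambda>a. \<Sum>j<N. zeta N ^ (j * k) * (zeta N ^ (j * a) * h a)) u"
  proof (intro wsum_cong)
    fix a assume *: "\<And>a. int N dvd int a - e \<longleftrightarrow> N dvd a + k"
    have "(\<Sum>j<N. zeta N ^ (j * k) * (zeta N ^ (j * a) * h a)) = (\<Sum>j<N. zeta N ^ (j * (a +
        k))) * h a"
      unfolding sum_distrib_right by (intro sum.cong refl) (simp add: power_add ring_distribs mult_ac)
    then show "of_nat N * (if int N dvd int a - e then h a else 0) = (\<Sum>j<N. zeta N ^ (j * k) *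
        (zeta N ^ (j * a) * h a))"
      using * by (simp add: sum_zeta[OF assms])
  qed
  also have "\<dots> = 0"
    using h by (simp add: wsum_sum_fun wsum_mult_fun)
  finally show "wsum (\<lambda>a. if int N dvd int a - e then h a else 0) u = 0"
    using assms by (simp add: wsum_mult_fun)
next
  fix j assume h: "\<forall>e. wsum (\<lambda>a. if int N dvd int a - e then h a else 0) u = 0" and "j < N"
  have "wsum (\<lambda>a. zeta N ^ (j * a) * h a) u =
    wsum (\<lambda>a. \<Sum>e<N. zeta N ^ (j * e) * (if int N dvd int a - int e then h a else 0)) u"
  proof (rule wsum_cong)
    fix a
    have 1: "int N dvd int a - int e \<longleftrightarrow> e = a mod N" if "e < N" for e
      using that by (metis mod_eq_dvd_iff mod_less of_nat_eq_iff of_nat_mod)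
    have "zeta N ^ (j * a) = zeta N ^ (j * (a mod N))"
      using zeta_power_mod[OF assms, of "j * a"] zeta_power_mod[OF assms, of "j * (a mod N)"]
      by (simp add: mod_mult_right_eq)
    moreover have "(\<Sum>e<N. zeta N ^ (j * e) * (if int N dvd int a - int e then h a else 0)) =
       (\<Sum>e<N. if e = a mod N then zeta N ^ (j * (a mod N)) * h a else 0)"
      using 1 by (intro sum.cong) auto
    ultimately show "zeta N ^ (j * a) * h a = (\<Sum>e<N. zeta N ^ (j * e) * (if int N dvd int a -
        int e then h a else 0))"
      using assms by simp
  qed
  also have "\<dots> = 0"
    using h by (simp add: wsum_sum_fun wsum_mult_fun)
  finally show "wsum (\<lambda>a. zeta N ^ (j * a) * h a) u = 0" .
qed

definition alpha :: "nat \<Rightarrow> nat \<Rightarrow> real \<times> real" where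
  "alpha N j = (- sin (pi * real j / real N), cos (pi * real j / real N))"

lemma dihedral_roots_alpha: "dihedral_roots N = alpha N ` {..<N}"
  by (simp add: dihedral_roots_def alpha_def)

lemma alpha_inj: "inj_on (alpha N) {..<N}"
proof (rule inj_onI)
  fix i j assume ij: "i \<in> {..<N}" "j \<in> {..<N}" "alpha N i = alpha N j"
  define f where "f k = pi * real k / real N" for k
  have f: "0 \<le> f k" "f k \<le> pi" if "k < N" for k
  proof -
    have "pi * real k \<le> pi * real N" using that by simp
    then show "f k \<le> pi"
      using that by (simp only: f_def pos_divide_le_eq of_nat_0_less_iff)
  qed (simp add: f_def)
  have "cos (f i) = cos (f j)"
    using ij(3) unfolding alpha_def f_def prod.inject by (rule conjunct2)
  then have "f i = f j"
    using f ij(1,2) unfolding lessThan_iff by (metis cos_inj_pi)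
  then have "real i = real j"
    using ij(1) by (auto simp: f_def)
  then show "i = j" by simp
qed

definition line_pt :: "nat \<Rightarrow> nat \<Rightarrow> real \<Rightarrow> real \<times> real" where
  "line_pt N j r = (r * cos (pi * real j / real N), r * sin (pi * real j / real N))"

lemma line_pt_iff: "fst (alpha N j) * fst x + snd (alpha N j) * snd x = 0 \<longleftrightarrow>
    (\<exists>r. x = line_pt N j r)"
proof
  define c s where "c = cos (pi * real j / real N)" and "s = sin (pi * real j / real N)"
  have cs: "c * c + s * s = 1"
    unfolding c_def s_def using sin_cos_squared_add2 by (simp add: power2_eq_square)
  assume "fst (alpha N j) * fst x + snd (alpha N j) * snd x = 0"
  then have h: "c * snd x = s * fst x"
    by (simp add: alpha_def c_def s_def)
  define r where "r = c * fst x + s * snd x"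
  have "r * c = fst x"
    using cs h unfolding r_def by algebra
  moreover have "r * s = snd x"
    using cs h unfolding r_def by algebra
  ultimately show "\<exists>r. x = line_pt N j r"
    unfolding line_pt_def c_def s_def by (metis prod.collapse)
qed (auto simp: line_pt_def alpha_def)

lemma quasiinvariants_line:
  "q \<in> quasiinvariants N m \<longleftrightarrow> (\<forall>j<N. \<forall>r s. odd s \<and> s < 2
      * m \<longrightarrow>
     fps_nth (jet (alpha N j) (line_pt N j r) q) s = 0)"
  by (simp only: quasiinvariants_jet dihedral_roots_alpha ball_simps line_pt_iff) blast

lemma eval2_Z: "eval2 Z x = Complex (fst x) (snd x)" "eval2 Zbar x = cnj (Complex (fst x) (snd x))"
proof -
  have Zb: "Zbar = X1 + const2 (- \<i>) * X2"
    by (simp add: Zbar_def const2_hom)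
  show "eval2 Z x = Complex (fst x) (snd x)" "eval2 Zbar x = cnj (Complex (fst x) (snd x))"
    unfolding Zb Z_def by (simp_all add: complex_eq_iff)
qed

lemma line_pt_complex: "Complex (fst (line_pt N j r)) (snd (line_pt N j r)) = of_real r * rho N j"
  by (simp add: line_pt_def rho_def complex_eq_iff)

lemma jet_Z_line:
  "jet (alpha N j) (line_pt N j r) Z =
     fps_const (rho N j) * (fps_const (of_real r) + fps_const \<i> * fps_X)" (is ?A)
  "jet (alpha N j) (line_pt N j r) Zbar =
     fps_const (cnj (rho N j)) * (fps_const (of_real r) - fps_const \<i> * fps_X)" (is ?B)
proof -
  have "poly_dir (alpha N j) Z = const2 (\<i> * rho N j)"
  proof -
    have "poly_dir (alpha N j) Z = const2 (of_real (fst (alpha N j)) + of_real (snd (alpha N j)) * \<i>)"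
      by (simp add: poly_dir_def poly_dx_Z const2_hom)
    also have "of_real (fst (alpha N j)) + of_real (snd (alpha N j)) * \<i> = \<i> * rho N j"
      by (simp add: alpha_def rho_def complex_eq_iff)
    finally show ?thesis .
  qed
  from jet_linear[OF this] show ?A
    by (simp add: eval2_Z line_pt_complex algebra_simps flip: fps_const_mult)
  have "poly_dir (alpha N j) Zbar = const2 (- \<i> * cnj (rho N j))"
  proof -
    have "poly_dir (alpha N j) Zbar = const2 (of_real (fst (alpha N j)) - of_real (snd (alpha N j)) * \<i>)"
      by (simp add: poly_dir_def poly_dx_Z const2_hom)
    also have "of_real (fst (alpha N j)) - of_real (snd (alpha N j)) * \<i> = - \<i> * cnj (rho N j)"
      by (simp add: alpha_def rho_def complex_eq_iff)
    finally show ?thesis .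
  qed
  from jet_linear[OF this] show ?B
    by (simp add: eval2_Z line_pt_complex algebra_simps flip: fps_const_mult fps_const_neg)
qed

text \<open>On mirror j one has z = rho (r + iX) and w = cnj rho (r - iX). Since rho^2 = zeta^j and
  cnj rho is inverse to rho, the unit factors depend on a only through zeta^(ja).\<close>

lemma jet_form_nth:
  assumes "degree u \<le> n"
  shows "fps_nth (jet (alpha N j) (line_pt N j r) (form n u)) s =
    \<i> ^ s * cnj (rho N j) ^ n * of_real r ^ (n - s) * wsum (\<lambda>a. zeta N ^ (j * a) * krawt
        a (n - a) s) u"
proof -
  define F where "F = (fps_const (of_real r) + fps_const \<i> * fps_X :: complex fps)"
  define G where "G = (fps_const (of_real r) - fps_const \<i> * fps_X :: complex fps)"
  have jZ: "jet (alpha N j) (line_pt N j r) Z = fps_const (rho N j) * F"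
    "jet (alpha N j) (line_pt N j r) Zbar = fps_const (cnj (rho N j)) * G"
    by (simp_all only: jet_Z_line F_def G_def)
  have "jet (alpha N j) (line_pt N j r) (form n u) =
    (\<Sum>a\<le>n. fps_const (coeff u a * rho N j ^ a * cnj (rho N j) ^ (n - a)) * (F ^ a * G ^ (n - a)))"
    unfolding form_def jet_sum
    by (intro sum.cong refl)
      (simp only: jet_mult jet_power jet_const2 jZ power_mult_distrib fps_const_power
        fps_const_mult[symmetric] mult_ac)
  then have "fps_nth (jet (alpha N j) (line_pt N j r) (form n u)) s =
    (\<Sum>a\<le>n. coeff u a * rho N j ^ a * cnj (rho N j) ^ (n - a) * fps_nth (F ^ a * G ^ (n - a)) s)"
    by (simp add: fps_sum_nth)
  also have "\<dots> = (\<Sum>a\<le>n. \<i> ^ s * cnj (rho N j) ^ n * of_real r ^ (n - s) *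
      (coeff u a * (zeta N ^ (j * a) * krawt a (n - a) s)))"
  proof (intro sum.cong refl)
    fix a assume "a \<in> {..n}"
    then have a: "a \<le> n" by simp
    have "rho N j ^ a = rho N j ^ (2 * a) * cnj (rho N j) ^ a"
      using rho_cnj[of N j] by (simp add: mult_2 power_add mult.assoc flip: power_mult_distrib)
    also have "rho N j ^ (2 * a) = zeta N ^ (j * a)"
      by (simp add: power_mult rho_square)
    finally have "rho N j ^ a * cnj (rho N j) ^ (n - a) = zeta N ^ (j * a) * cnj (rho N j) ^ n"
      using a by (simp add: mult.assoc flip: power_add)
    moreover have "fps_nth (F ^ a * G ^ (n - a)) s = of_real r ^ (n - s) * \<i> ^ s * krawt a (n - a) s"
      using a jet_line_nth[of "of_real r" a "n - a" s] by (simp add: F_def G_def)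
    ultimately show "coeff u a * rho N j ^ a * cnj (rho N j) ^ (n - a) * fps_nth (F ^ a * G ^ (n - a)) s =
      \<i> ^ s * cnj (rho N j) ^ n * of_real r ^ (n - s) * (coeff u a * (zeta N ^ (j * a) * krawt a
          (n - a) s))"
      by (simp add: mult.assoc)
  qed
  also have "\<dots> = \<i> ^ s * cnj (rho N j) ^ n * of_real r ^ (n - s) * wsum (\<lambda>a. zeta N
      ^ (j * a) * krawt a (n - a) s) u"
    by (simp add: wsum_bound[OF assms] sum_distrib_left)
  finally show ?thesis .
qed

lemma power_sum_coeffs_zero:
  fixes c :: "nat \<Rightarrow> complex"
  assumes "finite A" "\<And>r::real. r > 0 \<Longrightarrow> (\<Sum>d\<in>A. c d * of_real r ^ d) =
      0" "d \<in> A"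
  shows "c d = 0"
proof -
  define p where "p = (\<Sum>d\<in>A. monom (c d) d)"
  have "poly p (of_real r) = 0" if "r > 0" for r :: real
    using assms(2)[OF that] by (simp add: p_def poly_sum poly_monom)
  then have sub: "complex_of_real ` {0<..} \<subseteq> {x. poly p x = 0}"
    by auto
  have "p = 0"
  proof (rule ccontr)
    assume "p \<noteq> 0"
    then have "finite (complex_of_real ` {0<..})"
      using sub poly_roots_finite finite_subset by blast
    then have "finite ({0<..} :: real set)"
      by (rule finite_imageD) (simp add: inj_on_def)
    then show False using infinite_Ioi by blast
  qed
  moreover have "coeff p d = (\<Sum>b\<in>A. if b = d then c d else 0)"
    unfolding p_def coeff_sum by (intro sum.cong) auto
  then have "coeff p d = c d"
    using assms by (simp add: sum.delta)
  ultimately show ?thesis by simp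
qed

text \<open>The arrangement is a free choice here: restriction to \<open>Suc (degree (u d))\<close>
  mirrors evaluates \<open>u d\<close> at more roots of unity than its degree. Different degrees
  separate as different powers of r.\<close>

lemma form_sum_eq_0:
  assumes A: "finite A" "\<And>d. d \<in> A \<Longrightarrow> degree (u d) \<le> d" and 0:
      "(\<Sum>d\<in>A. form d (u d)) = 0" and "d \<in> A"
  shows "u d = 0"
proof (rule ccontr)
  assume nz: "u d \<noteq> 0"
  define n where "n = Suc (degree (u d))"
  have "poly (u d) (zeta n ^ j) = 0" for j
  proof -
    have "cnj (rho n j) ^ d * wsum (\<lambda>a. zeta n ^ (j * a)) (u d) = 0"
    proof (rule power_sum_coeffs_zero[OF A(1) _ \<open>d \<in> A\<close>])
      fix r :: real
      have "0 = fps_nth (jet (alpha n j) (line_pt n j r) (\<Sum>d\<in>A. form d (u d))) 0"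
        using 0 jet_const2[of "alpha n j" "line_pt n j r" 0] by (simp add: const2_hom)
      also have "\<dots> = (\<Sum>d\<in>A. cnj (rho n j) ^ d * wsum (\<lambda>a. zeta n ^ (j * a))
          (u d) * of_real r ^ d)"
        unfolding jet_sum fps_sum_nth by (intro sum.cong refl) (simp add: jet_form_nth A krawt_at_0)
      finally show "(\<Sum>d\<in>A. cnj (rho n j) ^ d * wsum (\<lambda>a. zeta n ^ (j * a)) (u d) *
          of_real r ^ d) = 0"
        by simp
    qed
    then have "wsum (\<lambda>a. zeta n ^ (j * a)) (u d) = 0" by simp
    then show ?thesis
      by (simp add: wsum_def poly_altdef power_mult)
  qed
  then have "(\<lambda>j. zeta n ^ j) ` {..<n} \<subseteq> {x. poly (u d) x = 0}"
    by auto
  then have "card ((\<lambda>j. zeta n ^ j) ` {..<n}) \<le> card {x. poly (u d) x = 0}"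
    by (intro card_mono poly_roots_finite nz)
  also have "\<dots> \<le> degree (u d)"
    by (rule card_poly_roots_bound[OF nz])
  finally show False
    using card_image[OF zeta_inj[of n]] by (simp add: n_def)
qed

lemma form_eq_0_iff: "degree u \<le> n \<Longrightarrow> form n u = 0 \<longleftrightarrow> u = 0"
  using form_sum_eq_0[of "{n}" "\<lambda>_. u" n] by auto

lemma hcomp_ex_form: "\<exists>u. degree u \<le> d \<and> hcomp d q = form d u"
proof -
  \<comment> \<open>The coordinates x1 = (z + w)/2 and x2 = (z - w)/(2i) as forms of degree
    1.\<close>
  define A B where "A = [:1 / 2, 1 / 2 :: complex:]" and "B = [:\<i> / 2, - \<i> / 2:]"
  have dA: "degree A \<le> 1" "degree B \<le> 1"
    by (simp_all add: A_def B_def)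
  have Am: "A = monom (1/2) 0 + monom (1/2) 1" "B = monom (\<i>/2) 0 + monom (- \<i>/2) 1"
    by (simp_all add: A_def B_def monom_altdef)
  have m: "form 1 (monom c 0) = const2 c * Zbar" "form 1 (monom c 1) = const2 c * Z" for c
    using form_monom[of 0 1 c] form_monom[of 1 1 c] by simp_all
  have "form 1 A = (const2 (1/2) + const2 (1/2)) * X1"
    unfolding Am form_add m Z_def Zbar_def by (simp only: algebra_simps)
  also have "\<dots> = X1"
    by (simp only: const2_hom(3)[symmetric]) (simp add: const2_hom(2))
  finally have X1: "X1 = form 1 A" by simp
  have "form 1 B = (const2 (\<i>/2) + const2 (- \<i>/2)) * X1 + (const2 (- \<i>/2) - const2
      (\<i>/2)) * const2 \<i> * X2"
    unfolding Am form_add m Z_def Zbar_def by (simp only: algebra_simps)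
  also have "\<dots> = X2"
    by (simp only: const2_hom(3,4,6)[symmetric]) (simp add: const2_hom(1,2))
  finally have X2: "X2 = form 1 B" by simp
  define u where "u = (\<Sum>i\<le>d. smult (coeff (coeff q i) (d - i)) (A ^ (d - i) * B ^ i))"
  have deg: "degree (A ^ (d - i)) \<le> d - i" "degree (B ^ i) \<le> i" for i
    using degree_power_le[of A "d - i"] degree_power_le[of B i] dA by (auto intro: order_trans)
  have AB: "form d (A ^ (d - i) * B ^ i) = X1 ^ (d - i) * X2 ^ i" if "i \<le> d" for i
    using form_mult[OF deg(1)[of i] deg(2)[of i]] form_power[OF dA(1), of "d - i"] form_power[OF
        dA(2), of i] that
    by (simp add: X1 X2)
  have "hcomp d q = form d u"
    unfolding hcomp_def u_def form_sum by (intro sum.cong) (auto simp: form_smult AB mult.assoc)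
  moreover have "degree u \<le> d"
    unfolding u_def
  proof (intro degree_sum_le)
    fix i assume "i \<in> {..d}"
    have "degree (smult (coeff (coeff q i) (d - i)) (A ^ (d - i) * B ^ i)) \<le> degree (A ^ (d - i) * B ^ i)"
      by (rule degree_smult_le)
    also have "\<dots> \<le> degree (A ^ (d - i)) + degree (B ^ i)"
      by (rule degree_mult_le)
    also have "\<dots> \<le> (d - i) + i"
      by (intro add_mono deg)
    finally show "degree (smult (coeff (coeff q i) (d - i)) (A ^ (d - i) * B ^ i)) \<le> d"
      using \<open>i \<in> {..d}\<close> by simp
  qed simp
  ultimately show ?thesis by blast
qed

definition form_part :: "nat \<Rightarrow> poly2 \<Rightarrow> complex poly" where
  "form_part d q = (SOME u. degree u \<le> d \<and> hcomp d q = form d u)"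

lemma form_part: "degree (form_part d q) \<le> d" "hcomp d q = form d (form_part d q)"
  using someI_ex[OF hcomp_ex_form[of d q]] unfolding form_part_def by auto

lemma form_part_sum_form:
  assumes "finite A" "\<And>d. d \<in> A \<Longrightarrow> degree (u d) \<le> d"
  shows "form_part d (\<Sum>d\<in>A. form d (u d)) = (if d \<in> A then u d else 0)"
proof -
  define q where "q = (\<Sum>d\<in>A. form d (u d))"
  define B where "B = {d. hcomp d q \<noteq> 0}"
  define C where "C = insert d (A \<union> B)"
  define v where "v d = form_part d q - (if d \<in> A then u d else 0)" for d
  have C: "finite C" using assms finite_hcomp[of q] by (simp add: C_def B_def)
  have "v d = 0"
  proof (rule form_sum_eq_0[OF C])
    show "degree (v d) \<le> d" for d
      unfolding v_def using assms form_part(1) by (intro degree_diff_le) auto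
    have "(\<Sum>d\<in>C. form d (v d)) = (\<Sum>d\<in>C. hcomp d q) - (\<Sum>d\<in>C. form d (if d
        \<in> A then u d else 0))"
      by (simp add: v_def form_diff form_part(2) sum_subtractf)
    also have "(\<Sum>d\<in>C. hcomp d q) = (\<Sum>d\<in>B. hcomp d q)"
      using C by (intro sum.mono_neutral_right) (auto simp: B_def C_def)
    also have "\<dots> = q" unfolding B_def by (rule sum_hcomp)
    also have "(\<Sum>d\<in>C. form d (if d \<in> A then u d else 0)) = (\<Sum>d\<in>A. form d (if d
        \<in> A then u d else 0))"
      using C by (intro sum.mono_neutral_right) (auto simp: C_def)
    also have "\<dots> = q" unfolding q_def by (intro sum.cong) auto
    finally show "(\<Sum>d\<in>C. form d (v d)) = 0" by simp
  qed (simp add: C_def)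
  then show ?thesis by (simp add: v_def q_def)
qed

lemma hcomp_sum_form:
  assumes "finite A" "\<And>d. d \<in> A \<Longrightarrow> degree (u d) \<le> d"
  shows "hcomp d (\<Sum>d\<in>A. form d (u d)) = (if d \<in> A then form d (u d) else 0)"
  using form_part(2)[of d "\<Sum>d\<in>A. form d (u d)"] form_part_sum_form[OF assms, of d] by simp

lemma hcomp_form: "degree u \<le> n \<Longrightarrow> hcomp d (form n u) = (if d = n then form n u else 0)"
  using hcomp_sum_form[of "{n}" "\<lambda>_. u" d] by simp

lemma sum_form_part: "(\<Sum>d | hcomp d q \<noteq> 0. form d (form_part d q)) = q"
  using sum_hcomp[of q] by (simp add: form_part(2))

section \<open>Quasiinvariants as sums of quasiinvariant forms, and the polynomial w_m\<close>

context dihedral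
begin

lemma qform_iff_zeta:
  assumes "degree u \<le> n"
  shows "qform n u \<longleftrightarrow> (\<forall>j<N. \<forall>s. odd s \<and> s < 2 * m
      \<longrightarrow> wsum (\<lambda>a. zeta N ^ (j * a) * krawt a (n - a) s) u = 0)"
proof -
  have "qform n u \<longleftrightarrow> (\<forall>r<m. \<forall>e. moment n e r u = 0)"
    using assms by (auto simp: qform_def)
  also have "\<dots> \<longleftrightarrow> (\<forall>r<m. \<forall>j<N. wsum (\<lambda>a. zeta N ^
      (j * a) * wt n a ^ (2 * r + 1)) u = 0)"
    using residue_class_sums[OF N_pos(1), of "\<lambda>a. wt n a ^ (2 * _ + 1)" u] by simp
  also have "\<dots> \<longleftrightarrow> (\<forall>j<N. \<forall>r<m. wsum (\<lambda>a. zeta N ^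
      (j * a) * wt n a ^ (2 * r + 1)) u = 0)"
    by blast
  also have "\<dots> \<longleftrightarrow> (\<forall>j<N. \<forall>s. odd s \<and> s < 2 * m
      \<longrightarrow> wsum (\<lambda>a. zeta N ^ (j * a) * krawt a (n - a) s) u = 0)"
    using krawt_odd_iff[OF assms, of m "\<lambda>a. zeta N ^ (_ * a)"] by simp
  finally show ?thesis .
qed

text \<open>On a mirror, the form of degree d contributes a multiple of r^(d - s) to the normal
  derivative of order s, so the degrees separate as r varies.\<close>

lemma quasi_sum_form_iff:
  assumes "finite A" "\<And>d. d \<in> A \<Longrightarrow> degree (u d) \<le> d"
  shows "(\<Sum>d\<in>A. form d (u d)) \<in> quasiinvariants N m \<longleftrightarrow>
      (\<forall>d\<in>A. qform d (u d))"
proof -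
  define c where "c j d s = \<i> ^ s * cnj (rho N j) ^ d * wsum (\<lambda>a. zeta N ^ (j * a) *
      krawt a (d - a) s) (u d)" for j d s
  have jet: "fps_nth (jet (alpha N j) (line_pt N j r) (\<Sum>d\<in>A. form d (u d))) s =
      (\<Sum>d\<in>A. c j d s * of_real r ^ (d - s))" for j r s
    unfolding jet_sum fps_sum_nth by (intro sum.cong refl) (simp add: jet_form_nth assms c_def)
  \<comment> \<open>For d < s the truncated exponent would collide with that of d = s. These terms
    vanish because a form of degree d has no Taylor coefficient of higher order.\<close>
  have c0: "c j d s = 0" if "d < s" "d \<in> A" for j d s
  proof -
    have "wsum (\<lambda>a. zeta N ^ (j * a) * krawt a (d - a) s) (u d) = 0"
    proof (rule wsum_zero)
      fix a assume "coeff (u d) a \<noteq> 0"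
      then have "a \<le> d" using assms(2)[OF that(2)] le_degree order_trans by blast
      then show "zeta N ^ (j * a) * krawt a (d - a) s = 0"
        using \<open>d < s\<close> by (simp add: krawt_zero)
    qed
    then show ?thesis by (simp add: c_def)
  qed
  have "(\<Sum>d\<in>A. form d (u d)) \<in> quasiinvariants N m \<longleftrightarrow>
      (\<forall>j<N. \<forall>s. odd s \<and> s < 2 * m \<longrightarrow> (\<forall>r.
          (\<Sum>d\<in>A. c j d s * of_real r ^ (d - s)) = 0))"
    unfolding quasiinvariants_line jet by blast
  also have "\<dots> \<longleftrightarrow> (\<forall>j<N. \<forall>s. odd s \<and> s < 2 * m
      \<longrightarrow> (\<forall>d\<in>A. c j d s = 0))"
  proof (intro all_cong iffI)
    fix j s assume h: "\<forall>r. (\<Sum>d\<in>A. c j d s * of_real r ^ (d - s)) = 0"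
    show "\<forall>d\<in>A. c j d s = 0"
    proof
      fix d assume "d \<in> A"
      show "c j d s = 0"
      proof (rule power_sum_coeffs_zero[OF assms(1) _ \<open>d \<in> A\<close>])
        fix r :: real
        have "(\<Sum>d\<in>A. c j d s * of_real r ^ d) = of_real r ^ s * (\<Sum>d\<in>A. c j d s *
            of_real r ^ (d - s))"
          unfolding sum_distrib_left
        proof (intro sum.cong refl)
          fix d assume "d \<in> A"
          show "c j d s * of_real r ^ d = of_real r ^ s * (c j d s * of_real r ^ (d - s))"
          proof (cases "d < s")
            case True
            then show ?thesis using c0 \<open>d \<in> A\<close> by simp
          next
            case False
            then have "(of_real r :: complex) ^ d = of_real r ^ s * of_real r ^ (d - s)"
              by (simp flip: power_add)
            then show ?thesis by simp
          qed
        qed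
        then show "(\<Sum>d\<in>A. c j d s * of_real r ^ d) = 0"
          using h by simp
      qed
    qed
  qed auto
  also have "\<dots> \<longleftrightarrow> (\<forall>d\<in>A. qform d (u d))"
    using qform_iff_zeta[OF assms(2)] by (auto simp: c_def)
  finally show ?thesis .
qed

lemma quasi_form_iff: "degree u \<le> n \<Longrightarrow> form n u \<in> quasiinvariants N m
    \<longleftrightarrow> qform n u"
  using quasi_sum_form_iff[of "{n}" "\<lambda>_. u"] by simp

lemma quasi_form_part: "q \<in> quasiinvariants N m \<Longrightarrow> qform d (form_part d q)"
proof -
  assume q: "q \<in> quasiinvariants N m"
  define A where "A = {d. hcomp d q \<noteq> 0}"
  have A: "finite A" using finite_hcomp[of q] by (simp add: A_def)
  have "\<forall>d\<in>A. qform d (form_part d q)"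
    using quasi_sum_form_iff[of A "\<lambda>d. form_part d q"] A form_part(1) q sum_form_part[of q]
        by (simp add: A_def)
  moreover have "form_part d q = 0" if "d \<notin> A"
    using that form_part[of d q] form_eq_0_iff[of "form_part d q" d] by (simp add: A_def)
  ultimately show ?thesis by (cases "d \<in> A") auto
qed

text \<open>Products are handled on the side of forms, where jets are multiplicative.\<close>

lemma qform_mult: "qform n u \<Longrightarrow> qform k v \<Longrightarrow> qform (n + k) (u * v)"
  using quasi_form_iff[of u n] quasi_form_iff[of v k] quasi_form_iff[of "u * v" "n + k"]
    quasiinvariants_mult[of "form n u" N m "form k v"] form_mult[of u n v k] qform_degree[of n u]
        qform_degree[of k v]
    degree_mult_le[of u v] by simp

lemma qform_1: "qform 0 1"
  using quasi_form_iff[of 1 0] quasiinvariants_const2[of 1 N m] by (simp add: form_1 const2_hom)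

lemma qform_power: "qform n u \<Longrightarrow> qform (k * n) (u ^ k)"
  by (induction k) (auto simp: qform_1 qform_mult)

lemma qform_s1: "qform 2 (monom 1 1)"
  using qform_t[of 1 0] qform_1 by (simp add: monom_altdef numeral_2_eq_2 one_pCons)

definition sig2 :: "complex poly" where "sig2 = monom 1 N + 1"

lemma degree_sig2: "degree sig2 \<le> N"
  unfolding sig2_def by (intro degree_add_le degree_monom_le) simp

lemma qform_sig2: "qform N sig2"
  unfolding qform_def
proof (intro conjI allI impI degree_sig2)
  fix e r
  define F where "F = (\<lambda>a. if int N dvd int a - e then wt N a ^ (2 * r + 1) else 0)"
  have "wsum F sig2 = wsum F (monom 1 N * 1) + wsum F 1"
    by (simp add: sig2_def wsum_add)
  also have "\<dots> = F N + F 0"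
    unfolding wsum_monom_mult by (simp add: wsum_def)
  also have "\<dots> = 0"
  proof -
    have "int N dvd int N - e \<longleftrightarrow> int N dvd int 0 - e"
      using dvd_add_triv_left_iff[of "int N" "- e"] by simp
    then show ?thesis by (simp add: F_def wt_def)
  qed
  finally show "wsum F sig2 = 0" .
qed

definition wpoly :: "complex poly" where "wpoly = disc ^ (2 * m + 1)"

definition M :: nat where "M = (2 * m + 1) * N"

lemma degree_wpoly: "degree wpoly \<le> M"
proof -
  have "degree wpoly \<le> degree disc * (2 * m + 1)"
    unfolding wpoly_def by (rule degree_power_le)
  also have "\<dots> \<le> N * (2 * m + 1)"
    by (rule mult_le_mono1[OF degree_disc])
  finally show ?thesis by (simp add: M_def mult.commute)
qed

text \<open>z^N - w^N vanishes on every mirror, so the jet of its power 2m + 1 starts beyond all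
  orders s < 2m.\<close>

lemma qform_wpoly: "qform M wpoly"
proof -
  have "form M wpoly \<in> quasiinvariants N m"
    unfolding quasiinvariants_line
  proof (intro allI impI)
    fix j r s assume "j < N" and s: "odd s \<and> s < 2 * m"
    define J where "J = jet (alpha N j) (line_pt N j r) (form N disc)"
    have "wsum (\<lambda>a. zeta N ^ (j * a)) disc = poly disc (zeta N ^ j)"
      by (simp add: wsum_def poly_altdef power_mult)
    also have "\<dots> = 0"
      using zeta_power_eq_1_iff[OF N_pos(1), of "j * N"] by (simp add: disc_def poly_monom power_mult)
    finally have "fps_nth J 0 = 0"
      by (simp add: J_def jet_form_nth degree_disc krawt_at_0)
    then have "fps_nth (J ^ (2 * m + 1)) s = 0"
      using s startsby_zero_power_prefix[of J "2 * m + 1"] by (simp del: power_Suc)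
    then show "fps_nth (jet (alpha N j) (line_pt N j r) (form M wpoly)) s = 0"
      unfolding M_def wpoly_def form_power[OF degree_disc] jet_power J_def .
  qed
  then show ?thesis by (simp add: quasi_form_iff degree_wpoly)
qed

lemma disc_factor: "disc = (\<Prod>j<N. [:- (zeta N ^ j), 1:])"
proof (rule poly_eqI_degree_lead_coeff[of _ N _ "(\<lambda>j. zeta N ^ j) ` {..<N}"])
  have deg: "degree (\<Prod>j<N. [:- (zeta N ^ j), 1:]) = N"
    by (subst degree_prod_eq_sum_degree) auto
  then have "coeff (\<Prod>j<N. [:- (zeta N ^ j), 1:]) N = lead_coeff (\<Prod>j<N. [:- (zeta N ^ j), 1:])"
    by simp
  also have "\<dots> = 1" by (simp add: lead_coeff_prod)
  finally show "coeff disc N = coeff (\<Prod>j<N. [:- (zeta N ^ j), 1:]) N"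
    using N_pos by (simp add: disc_def coeff_1)
  show "N \<le> card ((\<lambda>j. zeta N ^ j) ` {..<N})"
    using card_image[OF zeta_inj[OF N_pos(1)]] by simp
  show "degree (\<Prod>j<N. [:- (zeta N ^ j), 1:]) \<le> N" using deg by simp
  fix z assume "z \<in> (\<lambda>j. zeta N ^ j) ` {..<N}"
  then obtain j where j: "j < N" "z = zeta N ^ j" by auto
  have "poly disc z = 0"
    using zeta_power_eq_1_iff[OF N_pos(1), of "j * N"] by (simp add: j disc_def poly_monom power_mult)
  moreover have "poly (\<Prod>j<N. [:- (zeta N ^ j), 1:]) z = 0"
    using j by (auto simp: poly_prod)
  ultimately show "poly disc z = poly (\<Prod>j<N. [:- (zeta N ^ j), 1:]) z" by simp
qed (rule degree_disc)

text \<open>(\<alpha>, x) is the imaginary part of cnj rho * z, that is (cnj rho * z - rho *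
  w)/(2i).\<close>

lemma lin_form_alpha: "lin_form (alpha N j) = const2 (- \<i> / 2 * cnj (rho N j)) * (Z - const2
    (zeta N ^ j) * Zbar)"
proof -
  define c where "c = - \<i> / 2 * cnj (rho N j)"
  have rc: "zeta N ^ j * cnj (rho N j) = rho N j"
    using rho_cnj[of N j] by (simp add: power2_eq_square mult.assoc flip: rho_square)
  have 1: "c - c * zeta N ^ j = of_real (fst (alpha N j))"
    using rc by (simp add: c_def mult.assoc mult.commute[of "cnj _"]) (simp add: complex_eq_iff
        rho_def alpha_def)
  have 2: "c * \<i> + c * zeta N ^ j * \<i> = of_real (snd (alpha N j))"
    using rc by (simp add: c_def mult.assoc mult.commute[of "cnj _"] mult.left_commute[of "cnj _"])
      (simp add: complex_eq_iff rho_def alpha_def)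
  have "const2 c * (Z - const2 (zeta N ^ j) * Zbar) =
     const2 (c - c * zeta N ^ j) * X1 + const2 (c * \<i> + c * zeta N ^ j * \<i>) * X2"
    unfolding Z_def Zbar_def const2_hom by (simp only: algebra_simps)
  then show ?thesis
    unfolding 1 2 by (simp add: lin_form_def c_def)
qed

lemma w_poly_form: "\<exists>c. c \<noteq> 0 \<and> w_poly N m = const2 c * form M wpoly"
proof -
  define c where "c j = - \<i> / 2 * cnj (rho N j)" for j
  have lin: "form 1 [:- (zeta N ^ j), 1:] = Z - const2 (zeta N ^ j) * Zbar" for j
    by (simp add: form_def const2_hom)
  have prod: "form k (\<Prod>j<k. [:- (zeta N ^ j), 1:]) = (\<Prod>j<k. Z - const2 (zeta N ^ j) * Zbar)" for k
  proof (induction k)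
    case (Suc k)
    have "degree (\<Prod>j<k. [:- (zeta N ^ j), 1:]) \<le> k"
      by (subst degree_prod_eq_sum_degree) auto
    then have "form (k + 1) ((\<Prod>j<k. [:- (zeta N ^ j), 1:]) * [:- (zeta N ^ k), 1:]) =
        form k (\<Prod>j<k. [:- (zeta N ^ j), 1:]) * form 1 [:- (zeta N ^ k), 1:]"
      by (rule form_mult) simp
    then show ?case unfolding Suc lin by simp
  qed (simp add: form_1)
  have "w_poly N m = (\<Prod>j<N. lin_form (alpha N j)) ^ (2 * m + 1)"
    unfolding w_poly_def dihedral_roots_alpha by (simp only: prod.reindex[OF alpha_inj] o_def
        prod_power_distrib)
  also have "(\<Prod>j<N. lin_form (alpha N j)) = (\<Prod>j<N. const2 (c j)) * form N disc"
    unfolding disc_factor prod lin_form_alpha c_def prod.distrib ..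
  also have "(\<Prod>j<N. const2 (c j)) = const2 (\<Prod>j<N. c j)"
    by (induction N) (simp_all add: const2_hom)
  finally have "w_poly N m = const2 ((\<Prod>j<N. c j) ^ (2 * m + 1)) * form M wpoly"
    unfolding M_def wpoly_def form_power[OF degree_disc] by (simp only: power_mult_distrib const2_hom)
  moreover have "(\<Prod>j<N. c j) ^ (2 * m + 1) \<noteq> 0"
    by (simp add: c_def)
  ultimately show ?thesis by blast
qed

end

section \<open>The operator L in the coordinates z and w\<close>

lemma dx1_to_fract: "dx1 (to_fract p) = to_fract (poly_dx1 p)"
  using dx1_Fract[of 1 p] poly_dx_const2(1)[of 1] by (simp add: to_fract_def const2_hom)

lemma dx2_to_fract: "dx2 (to_fract p) = to_fract (poly_dx2 p)"
  using dx2_Fract[of 1 p] poly_dx_const2(2)[of 1] by (simp add: to_fract_def const2_hom)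

lemma dir_to_fract: "dir \<alpha> (to_fract p) = to_fract (poly_dir \<alpha> p)"
  by (simp add: dir_def poly_dir_def dx1_to_fract dx2_to_fract)

definition laplace :: "poly2 \<Rightarrow> poly2" where
  "laplace p = poly_dx1 (poly_dx1 p) + poly_dx2 (poly_dx2 p)"

lemma CM_op_to_fract:
  "CM_op N m (to_fract p) = to_fract (laplace p) - of_nat (2 * m) *
     (\<Sum>j<N. to_fract (poly_dir (alpha N j) p) / to_fract (lin_form (alpha N j)))"
  by (simp add: CM_op_def dx1_to_fract dx2_to_fract dir_to_fract laplace_def dihedral_roots_alpha
      sum.reindex[OF alpha_inj])

lemma laplace_add: "laplace (p + q) = laplace p + laplace q"
  by (simp add: laplace_def poly_dx1_add poly_dx2_add)

lemma CM_op_add: "CM_op N m (to_fract (p + q)) = CM_op N m (to_fract p) + CM_op N m (to_fract q)"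
proof -
  have "(\<Sum>j<N. to_fract (poly_dir (alpha N j) (p + q)) / to_fract (lin_form (alpha N j))) =
    (\<Sum>j<N. to_fract (poly_dir (alpha N j) p) / to_fract (lin_form (alpha N j))) +
    (\<Sum>j<N. to_fract (poly_dir (alpha N j) q) / to_fract (lin_form (alpha N j)))"
    by (simp add: poly_dir_add add_divide_distrib sum.distrib)
  then show ?thesis
    unfolding CM_op_to_fract laplace_add by (simp only: to_fract_add ring_distribs) simp
qed

lemma CM_op_0: "CM_op N m 0 = 0"
  using CM_op_add[of N m 0 0] by (metis add.right_neutral add_left_cancel to_fract_0)

lemma CM_op_sum: "CM_op N m (to_fract (sum f A)) = (\<Sum>a\<in>A. CM_op N m (to_fract (f a)))"
proof (induction A rule: infinite_finite_induct)
  case (insert x F)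
  then show ?case using CM_op_add[of N m "f x" "sum f F"] by simp
qed (simp_all add: CM_op_0)

definition dz :: "poly2 \<Rightarrow> poly2" where
  "dz p = const2 (1 / 2) * (poly_dx1 p - const2 \<i> * poly_dx2 p)"

definition dzbar :: "poly2 \<Rightarrow> poly2" where
  "dzbar p = const2 (1 / 2) * (poly_dx1 p + const2 \<i> * poly_dx2 p)"

lemma dz_add: "dz (p + q) = dz p + dz q" "dzbar (p + q) = dzbar p + dzbar q"
  by (simp_all add: dz_def dzbar_def poly_dx1_add poly_dx2_add algebra_simps)

lemma dz_mult: "dz (p * q) = p * dz q + q * dz p" "dzbar (p * q) = p * dzbar q + q * dzbar p"
  by (simp_all add: dz_def dzbar_def poly_dx1_mult poly_dx2_mult algebra_simps)

lemma dz_const2: "dz (const2 c) = 0" "dzbar (const2 c) = 0"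
  by (simp_all add: dz_def dzbar_def poly_dx_const2)

lemma dz_sum: "dz (sum f A) = (\<Sum>a\<in>A. dz (f a))" "dzbar (sum f A) = (\<Sum>a\<in>A. dzbar (f a))"
  using dz_const2[of 0]
  by (induction A rule: infinite_finite_induct) (simp_all add: dz_add const2_hom)

lemma dz_Z: "dz Z = 1" "dz Zbar = 0" "dzbar Z = 0" "dzbar Zbar = 1"
proof -
  have i: "const2 \<i> * const2 \<i> = - 1"
    by (simp add: const2_hom flip: const2_hom(6))
  have h: "const2 (1 / 2) + const2 (1 / 2) = 1"
    by (simp add: const2_hom(2) flip: const2_hom(3))
  show "dz Z = 1" "dz Zbar = 0" "dzbar Z = 0" "dzbar Zbar = 1"
    using h by (simp_all add: dz_def dzbar_def poly_dx_Z i algebra_simps)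
qed

lemma laplace_dz: "laplace p = const2 4 * dz (dzbar p)"
proof -
  have comm: "poly_dx1 (poly_dx2 p) = poly_dx2 (poly_dx1 p)"
    by (intro poly_eqI) (simp add: coeff_poly_dx1 poly_dx2_def coeff_pderiv of_nat_poly pderiv_smult
        algebra_simps)
  have "const2 4 * dz (dzbar p) = const2 4 * const2 (1/2) * const2 (1/2) *
     (poly_dx1 (poly_dx1 p) - const2 \<i> * const2 \<i> * poly_dx2 (poly_dx2 p))"
    unfolding dz_def dzbar_def
    by (simp add: poly_dx1_mult poly_dx2_mult poly_dx1_add poly_dx2_add poly_dx_const2 comm algebra_simps)
  also have "const2 4 * const2 (1/2) * const2 (1/2) = 1"
    by (simp add: const2_hom(2) flip: const2_hom(6))
  also have "const2 \<i> * const2 \<i> = - 1"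
    by (simp add: const2_hom flip: const2_hom(6))
  finally show ?thesis by (simp add: laplace_def)
qed

lemma poly_dir_alpha:
  "poly_dir (alpha N j) p = const2 (\<i> * rho N j) * dz p - const2 (\<i> * cnj (rho N j)) * dzbar p"
proof -
  have 1: "of_real (fst (alpha N j)) = (\<i> * rho N j - \<i> * cnj (rho N j)) * (1 / 2)"
    by (simp add: alpha_def rho_def complex_eq_iff)
  have 2: "of_real (snd (alpha N j)) = (- (\<i> * rho N j) - \<i> * cnj (rho N j)) * (1 / 2) * \<i>"
    by (simp add: alpha_def rho_def complex_eq_iff)
  show ?thesis
    unfolding poly_dir_def 1 2 dz_def dzbar_def const2_hom by (simp add: algebra_simps)
qed

context dihedral
begin

text \<open>Root j contributes -2 (zeta^j dz p - dzbar p)/(z - zeta^j w). Multiplication by z^N -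
  w^N turns the denominators into the polynomials \<open>S j\<close>, and the sum over j is a
  Fourier sum in which one monomial survives.\<close>

lemma CM_op_D:
  "to_fract (form N disc) * CM_op N m (to_fract p) =
     to_fract (form N disc * laplace p + const2 (4 * mn) * (Zbar ^ (N - 1) * dz p - Z ^ (N - 1) * dzbar p))"
proof -
  define S where "S j = (\<Sum>k<N. const2 (zeta N ^ (j * k)) * (Z ^ (N - Suc k) * Zbar ^ k))" for j
  have D: "form N disc = Z ^ N - Zbar ^ N"
  proof -
    have "form N 1 = Zbar ^ N"
      using form_monom[of 0 N 1] by (simp add: const2_hom)
    then show ?thesis
      by (simp add: disc_def form_diff form_monom const2_hom)
  qed
  have DS: "form N disc = (Z - const2 (zeta N ^ j) * Zbar) * S j" for j
  proof -
    have "Z ^ N - (const2 (zeta N ^ j) * Zbar) ^ N = (Z - const2 (zeta N ^ j) * Zbar) *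
        (\<Sum>k<N. (const2 (zeta N ^ j) * Zbar) ^ k * Z ^ (N - Suc k))"
      using power_diff_sumr2[of Z N "const2 (zeta N ^ j) * Zbar"]
        sum.nat_diff_reindex[of "\<lambda>k. (const2 (zeta N ^ j) * Zbar) ^ k * Z ^ (N - Suc k)" N]
      by (simp add: mult.commute)
    moreover have "(const2 (zeta N ^ j) * Zbar) ^ N = Zbar ^ N"
      using zeta_power_eq_1_iff[OF N_pos(1), of "j * N"]
      by (simp add: power_mult_distrib power_mult const2_hom flip: const2_hom(7))
    moreover have "(\<Sum>k<N. (const2 (zeta N ^ j) * Zbar) ^ k * Z ^ (N - Suc k)) = S j"
      unfolding S_def by (intro sum.cong refl) (simp only: power_mult_distrib power_mult
          const2_hom(7), simp only: mult_ac)
    ultimately show ?thesis using D by simp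
  qed
  have Dnz: "form N disc \<noteq> 0"
    using form_eq_0_iff[OF degree_disc] disc_nz by simp
  have tm: "to_fract (form N disc) * (to_fract (poly_dir (alpha N j) p) / to_fract (lin_form (alpha N j))) =
     to_fract (const2 (- 2) * (const2 (zeta N ^ j) * dz p - dzbar p) * S j)" for j
  proof -
    define c where "c = - \<i> / 2 * cnj (rho N j)"
    define l where "l = Z - const2 (zeta N ^ j) * Zbar"
    have c: "c \<noteq> 0" by (simp add: c_def)
    have l: "l \<noteq> 0" using Dnz DS[of j] by (auto simp: l_def)
    have "zeta N ^ j * cnj (rho N j) = rho N j"
      using rho_cnj[of N j] by (simp add: power2_eq_square mult.assoc flip: rho_square)
    then have e: "\<i> * rho N j = c * (- 2 * zeta N ^ j)" "\<i> * cnj (rho N j) = c * (- 2)"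
      by (simp_all add: c_def mult.assoc mult.commute[of "cnj _"])
    define E where "E = const2 (- 2) * (const2 (zeta N ^ j) * dz p - dzbar p)"
    have dir: "poly_dir (alpha N j) p = const2 c * E"
      unfolding E_def poly_dir_alpha e const2_hom(6) by (simp add: algebra_simps const2_hom)
    have lin: "lin_form (alpha N j) = const2 c * l"
      by (simp add: lin_form_alpha c_def l_def)
    have nz: "to_fract (const2 c) \<noteq> 0" "to_fract l \<noteq> 0"
      using c l by simp_all
    show ?thesis
      unfolding dir lin DS[of j] E_def[symmetric] l_def[symmetric] to_fract_mult
      using nz by simp
  qed
  \<comment> \<open>Only the monomial whose index completes \<open>t\<close> to a multiple of N
    survives: t = 0 selects z^(N-1) and t = 1 selects w^(N-1).\<close>
  have sums: "(\<Sum>j<N. const2 (zeta N ^ (j * t)) * S j) = of_nat N * (Z ^ (N - Suc k) * Zbar ^ k)"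
    if "k < N" "\<And>i. i < N \<Longrightarrow> N dvd t + i \<longleftrightarrow> i = k" for t k
  proof -
    have "(\<Sum>j<N. const2 (zeta N ^ (j * t)) * S j) =
      (\<Sum>i<N. \<Sum>j<N. const2 (zeta N ^ (j * (t + i))) * (Z ^ (N - Suc i) * Zbar ^ i))"
      unfolding S_def sum_distrib_left
      by (subst sum.swap) (simp add: power_add ring_distribs const2_hom mult.assoc)
    also have "\<dots> = (\<Sum>i<N. if i = k then of_nat N * (Z ^ (N - Suc k) * Zbar ^ k) else 0)"
    proof (intro sum.cong refl)
      fix i assume i: "i \<in> {..<N}"
      have "(\<Sum>j<N. const2 (zeta N ^ (j * (t + i))) * (Z ^ (N - Suc i) * Zbar ^ i)) =
         const2 (if N dvd t + i then of_nat N else 0) * (Z ^ (N - Suc i) * Zbar ^ i)"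
        using sum_zeta[OF N_pos(1), of "t + i"] by (simp only: const2_sum[symmetric]
            sum_distrib_right[symmetric])
      then show "(\<Sum>j<N. const2 (zeta N ^ (j * (t + i))) * (Z ^ (N - Suc i) * Zbar ^ i)) =
         (if i = k then of_nat N * (Z ^ (N - Suc k) * Zbar ^ k) else 0)"
        using that i by (simp add: const2_hom const2_of_nat)
    qed
    also have "\<dots> = of_nat N * (Z ^ (N - Suc k) * Zbar ^ k)"
      using that by simp
    finally show ?thesis .
  qed
  have s0: "(\<Sum>j<N. S j) = of_nat N * Z ^ (N - 1)"
  proof -
    have "N dvd 0 + i \<longleftrightarrow> i = 0" if "i < N" for i
      using that by (auto dest: dvd_imp_le)
    then show ?thesis using sums[of 0 0] N_pos(1) by (simp add: const2_hom)
  qed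
  have s1: "(\<Sum>j<N. const2 (zeta N ^ j) * S j) = of_nat N * Zbar ^ (N - 1)"
  proof -
    have "N dvd 1 + i \<longleftrightarrow> i = N - 1" if "i < N" for i
      using that N_pos(1) by (auto dest: dvd_imp_le)
    then show ?thesis using sums[of "N - 1" 1] N_pos(1) by simp
  qed
  have "to_fract (form N disc) * (\<Sum>j<N. to_fract (poly_dir (alpha N j) p) / to_fract (lin_form
      (alpha N j))) =
     to_fract (\<Sum>j<N. const2 (- 2) * (const2 (zeta N ^ j) * dz p - dzbar p) * S j)"
    by (simp only: sum_distrib_left tm to_fract_sum)
  also have "(\<Sum>j<N. const2 (- 2) * (const2 (zeta N ^ j) * dz p - dzbar p) * S j) =
     const2 (- 2) * ((\<Sum>j<N. const2 (zeta N ^ j) * S j) * dz p - (\<Sum>j<N. S j) * dzbar p)"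
    by (simp add: sum_distrib_left sum_distrib_right sum_subtractf algebra_simps)
  also have "\<dots> = const2 (- 2 * of_nat N) * (Zbar ^ (N - 1) * dz p - Z ^ (N - 1) * dzbar p)"
    unfolding s0 s1 by (simp add: const2_hom const2_of_nat algebra_simps)
  finally have sum: "to_fract (form N disc) * (\<Sum>j<N. to_fract (poly_dir (alpha N j) p) /
      to_fract (lin_form (alpha N j))) =
     to_fract (const2 (- 2 * of_nat N) * (Zbar ^ (N - 1) * dz p - Z ^ (N - 1) * dzbar p))" .
  have "to_fract (form N disc) * CM_op N m (to_fract p) = to_fract (form N disc * laplace p) -
      of_nat (2 * m) *
     to_fract (const2 (- 2 * of_nat N) * (Zbar ^ (N - 1) * dz p - Z ^ (N - 1) * dzbar p))"
    unfolding CM_op_to_fract sum[symmetric] by (simp only: right_diff_distrib to_fract_mult mult.left_commute)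
  also have "of_nat (2 * m) = to_fract (const2 (of_nat (2 * m)))"
  proof -
    have "to_fract (of_nat k :: poly2) = of_nat k" for k
      by (induction k) simp_all
    then show ?thesis by (simp only: const2_of_nat)
  qed
  also have "to_fract (form N disc * laplace p) - to_fract (const2 (of_nat (2 * m))) *
     to_fract (const2 (- 2 * of_nat N) * (Zbar ^ (N - 1) * dz p - Z ^ (N - 1) * dzbar p)) =
     to_fract (form N disc * laplace p - const2 (of_nat (2 * m) * (- 2 * of_nat N)) * (Zbar ^ (N -
         1) * dz p - Z ^ (N - 1) * dzbar p))"
    by (simp only: to_fract_diff to_fract_mult const2_hom(6) mult.assoc)
  also have "of_nat (2 * m) * (- 2 * of_nat N) = - (4 * mn)"
    by (simp add: mn_def)
  finally show ?thesis by (simp add: const2_hom(5))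
qed

lemma Z_dz_form:
  "Z * dz (form n u) = form n (\<Sum>a\<le>n. monom (of_nat a * coeff u a) a)"
  "Zbar * dzbar (form n u) = form n (\<Sum>a\<le>n. monom ((of_nat n - of_nat a) * coeff u a) a)"
  "sigma1 * laplace (form n u) = form n (\<Sum>a\<le>n. monom (4 * of_nat a * (of_nat n - of_nat a)
      * coeff u a) a)"
proof -
  have p: "Z * dz (Z ^ a) = of_nat a * Z ^ a" "dzbar (Z ^ a) = 0"
    "Zbar * dzbar (Zbar ^ a) = of_nat a * Zbar ^ a" "dz (Zbar ^ a) = 0" for a
    using dz_const2[of 1]
    by (induction a) (simp_all add: dz_mult dz_Z const2_hom algebra_simps)
  have 1: "Z * dz (const2 c * Z ^ a * Zbar ^ b) = const2 (of_nat a * c) * Z ^ a * Zbar ^ b" for c a b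
  proof -
    have "Z * dz (const2 c * Z ^ a * Zbar ^ b) = const2 c * Zbar ^ b * (Z * dz (Z ^ a))"
      by (simp add: dz_mult dz_const2 p algebra_simps)
    then show ?thesis by (simp add: p const2_hom const2_of_nat mult_ac)
  qed
  have 2: "Zbar * dzbar (const2 c * Z ^ a * Zbar ^ b) = const2 (of_nat b * c) * Z ^ a * Zbar ^ b" for c a b
  proof -
    have "Zbar * dzbar (const2 c * Z ^ a * Zbar ^ b) = const2 c * Z ^ a * (Zbar * dzbar (Zbar ^ b))"
      by (simp add: dz_mult dz_const2 p algebra_simps)
    then show ?thesis by (simp add: p const2_hom const2_of_nat mult_ac)
  qed
  show "Z * dz (form n u) = form n (\<Sum>a\<le>n. monom (of_nat a * coeff u a) a)" for u
    unfolding form_sum by (simp add: form_monom, simp add: form_def dz_sum sum_distrib_left 1)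
  then have dz: "Z * dz (form n u) = form n (\<Sum>a\<le>n. monom (of_nat a * coeff u a) a)" for u .
  show dzbar: "Zbar * dzbar (form n u) = form n (\<Sum>a\<le>n. monom ((of_nat n - of_nat a) * coeff u a) a)"
    unfolding form_sum by (simp add: form_monom, simp add: form_def dz_sum sum_distrib_left 2 of_nat_diff)
  have "sigma1 * laplace (form n u) = const2 4 * (Z * dz (Zbar * dzbar (form n u)))"
    by (simp add: sigma1_def laplace_dz dz_mult dz_Z mult_ac)
  also have "\<dots> = form n (smult 4 (\<Sum>a\<le>n. monom (of_nat a * coeff (\<Sum>a\<le>n. monom
      ((of_nat n - of_nat a) * coeff u a) a) a) a))"
    unfolding dzbar dz form_smult ..
  also have "smult 4 (\<Sum>a\<le>n. monom (of_nat a * coeff (\<Sum>a\<le>n. monom ((of_nat n -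
      of_nat a) * coeff u a) a) a) a)
     = (\<Sum>a\<le>n. monom (4 * of_nat a * (of_nat n - of_nat a) * coeff u a) a)"
    by (rule poly_eqI) (simp add: coeff_sum sum.delta if_distrib[of "\<lambda>x. _ * x"] cong: if_cong)
  finally show "sigma1 * laplace (form n u) = form n (\<Sum>a\<le>n. monom (4 * of_nat a * (of_nat n
      - of_nat a) * coeff u a) a)" .
qed

text \<open>The bridge from rational functions to \<open>CMf\<close>. Both sides are compared after
  multiplication by sigma_1 (z^N - w^N), which clears the poles. For n < 2 both are 0, so the
  truncated n - 2 does no harm.\<close>

lemma CM_op_form:
  assumes "qform n u"
  shows "CM_op N m (to_fract (form n u)) = to_fract (form (n - 2) (smult 4 (CMf n u)))"
proof -
  define A where "A = (\<Sum>a\<le>n. monom (of_nat a * coeff u a) a)"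
  define B where "B = (\<Sum>a\<le>n. monom ((of_nat n - of_nat a) * coeff u a) a)"
  define C where "C = (\<Sum>a\<le>n. monom (4 * of_nat a * (of_nat n - of_nat a) * coeff u a) a)"
  have cf: "coeff A a = of_nat a * coeff u a" "coeff B a = (of_nat n - of_nat a) * coeff u a"
    "coeff C a = 4 * of_nat a * (of_nat n - of_nat a) * coeff u a" for a
    using qform_coeff[OF assms, of a] by (auto simp: A_def B_def C_def coeff_sum sum.delta)
  have deg: "degree A \<le> n" "degree B \<le> n" "degree C \<le> n"
    using qform_coeff[OF assms] by (auto simp: degree_le_iff_coeff cf)
  have Zb: "Zbar ^ N = form N 1" and Zp: "Z ^ N = form N (monom 1 N)"
    using form_monom[of 0 N 1] form_monom[of N N 1] by (simp_all add: const2_hom)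
  have N1: "x ^ N = x * x ^ (N - 1)" for x :: poly2
    using N_pos(1) by (cases N) auto
  have "to_fract (sigma1 * form N disc) * CM_op N m (to_fract (form n u)) =
     to_fract (form N disc * (sigma1 * laplace (form n u)) + const2 (4 * mn) *
       (Zbar ^ N * (Z * dz (form n u)) - Z ^ N * (Zbar * dzbar (form n u))))"
    unfolding to_fract_mult mult.assoc CM_op_D
    unfolding to_fract_mult[symmetric] sigma1_def N1[of Z] N1[of Zbar]
    by (simp only: algebra_simps)
  also have "form N disc * (sigma1 * laplace (form n u)) + const2 (4 * mn) *
       (Zbar ^ N * (Z * dz (form n u)) - Z ^ N * (Zbar * dzbar (form n u))) =
     form (N + n) (disc * C + smult (4 * mn) (1 * A - monom 1 N * B))"
    unfolding Z_dz_form A_def[symmetric] B_def[symmetric] C_def[symmetric] Zb Zp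
    using form_mult[of 1 N A n] form_mult[of "monom 1 N" N B n] form_mult[of disc N C n] deg degree_disc
    by (simp add: form_add form_diff form_smult degree_monom_le)
  also have "disc * C + smult (4 * mn) (1 * A - monom 1 N * B) = smult 4 (monom 1 N * up_part n u -
      down_part n u)"
  proof -
    have "C - smult (4 * mn) B = smult 4 (up_part n u)" "C - smult (4 * mn) A = smult 4 (down_part n u)"
      by (auto intro!: poly_eqI simp: cf coeff_up_part coeff_down_part algebra_simps)
    moreover have "disc * C + smult (4 * mn) (1 * A - monom 1 N * B) =
       monom 1 N * (C - smult (4 * mn) B) - (C - smult (4 * mn) A)"
      by (simp add: disc_def algebra_simps smult_diff_right)
    ultimately show ?thesis by (simp add: smult_diff_right)
  qed
  also have "smult 4 (monom 1 N * up_part n u - down_part n u) = disc * smult 4 (pCons 0 (CMf n u))"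
    unfolding CMf_eqn[OF assms, symmetric] by (simp only: mult_smult_right)
  also have "form (N + n) (disc * smult 4 (pCons 0 (CMf n u))) = form N disc * form n (smult 4
      (pCons 0 (CMf n u)))"
  proof (rule form_mult[OF degree_disc])
    show "degree (smult 4 (pCons 0 (CMf n u))) \<le> n"
      using CMcoeff_ge[OF assms] coeff_t_CMf[OF assms] unfolding degree_le_iff_coeff coeff_smult by simp
  qed
  also have "form n (smult 4 (pCons 0 (CMf n u))) = sigma1 * form (n - 2) (smult 4 (CMf n u))"
  proof (cases "n < 2")
    case True
    then show ?thesis by (simp add: CMf_small)
  next
    case False
    then have "n - 2 + 2 = n" by simp
    moreover have "degree (smult 4 (CMf n u)) \<le> n - 2"
      using degree_CMf degree_smult_le order_trans by blast
    ultimately show ?thesis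
      using form_pCons[of "smult 4 (CMf n u)" "n - 2"] by simp
  qed
  finally have "to_fract (sigma1 * form N disc) * CM_op N m (to_fract (form n u)) =
     to_fract (sigma1 * form N disc) * to_fract (form (n - 2) (smult 4 (CMf n u)))"
    by (simp add: mult_ac)
  moreover have "sigma1 * form N disc \<noteq> 0"
    using form_eq_0_iff[OF degree_disc] disc_nz form_eq_0_iff[of "monom 1 1" 2] degree_monom_le[of
        "1::complex" 1]
    by (simp add: sigma1_form)
  ultimately show ?thesis
    by (simp only: mult_cancel_left to_fract_eq_0_iff) simp
qed

end

lemma coeff_mult_nonzero:
  assumes "coeff (u * v) a \<noteq> 0"
  shows "\<exists>i\<le>a. coeff u i \<noteq> 0 \<and> coeff v (a - i) \<noteq> 0"
proof (rule ccontr)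
  assume "\<not> ?thesis"
  then have "coeff (u * v) a = 0"
    unfolding coeff_mult by (intro sum.neutral) auto
  then show False using assms by simp
qed

context dihedral
begin

subsection \<open>Vanishing for reasons of degree\<close>

text \<open>(L/4)^k on quasiinvariant forms of degree n. The degree is passed along because
  \<open>CMf\<close> depends on it; its truncation is harmless as \<open>CMf\<close> is 0 below
  degree 2.\<close>

primrec CMiter :: "nat \<Rightarrow> nat \<Rightarrow> complex poly \<Rightarrow> complex poly" where
  "CMiter 0 n u = u"
| "CMiter (Suc k) n u = CMf (n - 2 * k) (CMiter k n u)"

lemma CMiter_add: "CMiter k n (u + v) = CMiter k n u + CMiter k n v"
  by (induction k) (simp_all add: CMf_add)

lemma CMiter_smult: "CMiter k n (smult c u) = smult c (CMiter k n u)"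
  by (induction k) (simp_all add: CMf_smult)

lemma CMiter_0 [simp]: "CMiter k n 0 = 0"
  by (induction k) simp_all

lemma qform_CMiter: "qform n u \<Longrightarrow> qform (n - 2 * k) (CMiter k n u)"
proof (induction k)
  case (Suc k)
  then have "qform (n - 2 * k - 2) (CMf (n - 2 * k) (CMiter k n u))"
    by (intro qform_CMf) simp
  then show ?case by simp
qed simp

lemma CMiter_large: "n < 2 * k \<Longrightarrow> CMiter k n u = 0"
proof (induction k)
  case (Suc k)
  then show ?case
    by (cases "n < 2 * k") (simp_all add: CMf_small)
qed simp

text \<open>The degrees \<open>n i\<close> may coincide, as the truncated degrees M - d do when
  several d exceed M.\<close>

lemma CM_op_iter:
  assumes "\<And>i. i \<in> I \<Longrightarrow> qform (n i) (u i)"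
  shows "(CM_op N m ^^ k) (to_fract (\<Sum>i\<in>I. form (n i) (u i))) =
    to_fract (\<Sum>i\<in>I. form (n i - 2 * k) (smult (4 ^ k) (CMiter k (n i) (u i))))"
proof (induction k)
  case (Suc k)
  have "(CM_op N m ^^ Suc k) (to_fract (\<Sum>i\<in>I. form (n i) (u i))) =
    (\<Sum>i\<in>I. CM_op N m (to_fract (form (n i - 2 * k) (smult (4 ^ k) (CMiter k (n i) (u i))))))"
    using Suc by (simp add: CM_op_sum del: to_fract_sum)
  also have "\<dots> = (\<Sum>i\<in>I. to_fract (form (n i - 2 * Suc k) (smult (4 ^ Suc k) (CMiter
      (Suc k) (n i) (u i)))))"
  proof (intro sum.cong refl)
    fix i assume "i \<in> I"
    then have "qform (n i - 2 * k) (smult (4 ^ k) (CMiter k (n i) (u i)))"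
      using assms by (intro qform_smult qform_CMiter)
    then show "CM_op N m (to_fract (form (n i - 2 * k) (smult (4 ^ k) (CMiter k (n i) (u i))))) =
      to_fract (form (n i - 2 * Suc k) (smult (4 ^ Suc k) (CMiter (Suc k) (n i) (u i))))"
      by (simp add: CM_op_form CMf_smult mult.commute)
  qed
  finally show ?case by simp
qed simp

definition res_part :: "int \<Rightarrow> complex poly \<Rightarrow> complex poly" where
  "res_part e u = (\<Sum>a\<le>degree u. monom (if int N dvd int a - e then coeff u a else 0) a)"

lemma coeff_res_part: "coeff (res_part e u) a = (if int N dvd int a - e then coeff u a else 0)"
  by (cases "a \<le> degree u") (auto simp: res_part_def coeff_sum sum.delta coeff_eq_0)

lemma degree_res_part: "degree (res_part e u) \<le> degree u"
  by (auto simp: degree_le_iff_coeff coeff_res_part coeff_eq_0)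

lemma res_part_0 [simp]: "res_part e 0 = 0"
  by (rule poly_eqI) (simp add: coeff_res_part)

lemma qform_res_part:
  assumes "qform n u"
  shows "qform n (res_part e u)"
  unfolding qform_def
proof (intro conjI allI impI)
  show "degree (res_part e u) \<le> n"
    using degree_res_part qform_degree[OF assms] order_trans by blast
  fix e' r assume r: "r < m"
  define f where "f a = wt n a ^ (2 * r + 1)" for a
  show "moment n e' r (res_part e u) = 0"
  proof (cases "int N dvd e - e'")
    case True
    have "wsum (\<lambda>a. if int N dvd int a - e' then f a else 0) (res_part e u) =
      (\<Sum>a\<le>degree u. coeff u a * (if int N dvd int a - e then f a else 0))"
      unfolding wsum_bound[OF degree_res_part]
    proof (intro sum.cong refl)
      fix a
      have "int a - e' = (int a - e) + (e - e')" by simp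
      then have "int N dvd int a - e' \<longleftrightarrow> int N dvd int a - e"
        using True by (metis dvd_add_left_iff)
      then show "coeff (res_part e u) a * (if int N dvd int a - e' then f a else 0) =
          coeff u a * (if int N dvd int a - e then f a else 0)"
        by (simp add: coeff_res_part)
    qed
    also have "\<dots> = 0"
      using assms r unfolding qform_def wsum_def f_def by blast
    finally show ?thesis unfolding f_def .
  next
    case False
    show ?thesis
    proof (rule wsum_zero)
      fix a assume "coeff (res_part e u) a \<noteq> 0"
      then have "int N dvd int a - e" by (auto simp: coeff_res_part split: if_splits)
      moreover have "e - e' = (int a - e') - (int a - e)" by simp
      ultimately have "\<not> int N dvd int a - e'"
        using False by (metis dvd_diff)
      then show "(if int N dvd int a - e' then wt n a ^ (2 * r + 1) else 0) = 0" by simp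
    qed
  qed
qed

lemma sum_res_part: "(\<Sum>e<N. res_part (int e) u) = u"
proof (rule poly_eqI)
  fix a
  have "int N dvd int a - int e \<longleftrightarrow> e = a mod N" if "e < N" for e
    using that by (metis mod_eq_dvd_iff mod_less of_nat_eq_iff of_nat_mod)
  then have "coeff (\<Sum>e<N. res_part (int e) u) a = (\<Sum>e<N. if e = a mod N then coeff u a else 0)"
    unfolding coeff_sum coeff_res_part by (intro sum.cong) auto
  then show "coeff (\<Sum>e<N. res_part (int e) u) a = coeff u a"
    using N_pos by simp
qed

lemma isotyp_res_part: "qform n u \<Longrightarrow> isotyp n e 0 (res_part e u)"
  by (auto simp: isotyp_def qform_res_part coeff_res_part split: if_splits)

lemma isotyp_cong: "isotyp n e \<epsilon> u \<Longrightarrow> int N dvd e - e' \<Longrightarrow>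
    isotyp n e' \<epsilon> u"
  unfolding isotyp_def by (metis add_diff_eq diff_add_cancel dvd_add)

lemma isotyp_qform: "isotyp n e \<epsilon> u \<Longrightarrow> qform n u"
  by (simp add: isotyp_def)

text \<open>The divisibility says that the reflection preserves the class, so symmetrising stays
  inside it.\<close>

lemma isotyp_halves:
  assumes u: "isotyp n e \<epsilon> u" and e: "int N dvd 2 * e - int n" and \<delta>: "\<delta> = 1
      \<or> \<delta> = -1"
  shows "isotyp n e \<delta> (smult (1/2) (u + smult \<delta> (swap n u)))"
  unfolding isotyp_def
proof (intro conjI allI impI)
  have qform: "qform n u" by (rule isotyp_qform[OF u])
  show "qform n (smult (1/2) (u + smult \<delta> (swap n u)))"
    by (intro qform_smult qform_add qform qform_swap)
  show "swap n (smult (1/2) (u + smult \<delta> (swap n u))) = smult \<delta> (smult (1/2) (u +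
      smult \<delta> (swap n u)))"
    using \<delta> by (auto simp: swap_smult swap_add swap_swap[OF qform_degree[OF qform]] smult_add_right)
  fix a assume "coeff (smult (1/2) (u + smult \<delta> (swap n u))) a \<noteq> 0"
  then have "coeff u a \<noteq> 0 \<or> (coeff u (n - a) \<noteq> 0 \<and> a \<le> n)"
    by (auto simp: coeff_swap split: if_splits)
  then show "int N dvd int a - e"
  proof
    assume "coeff u a \<noteq> 0"
    then show ?thesis using u by (auto simp: isotyp_def)
  next
    assume 2: "coeff u (n - a) \<noteq> 0 \<and> a \<le> n"
    then have "int N dvd int (n - a) - e" using u by (auto simp: isotyp_def)
    then have "int N dvd - (int (n - a) - e)" by (simp only: dvd_minus_iff)
    then have "int N dvd - (int (n - a) - e) - (2 * e - int n)"
      using e by (rule dvd_diff)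
    moreover have "- (int (n - a) - e) - (2 * e - int n) = int a - e"
      using 2 by simp
    ultimately show ?thesis by metis
  qed
qed

text \<open>Reflection-stable classes split into a symmetric and an antisymmetric part; the others
  are kept whole, because the reflection moves them.\<close>

lemma qform_isotyp_induct [consumes 1, case_names isotyp add]:
  assumes "qform n u"
    and isotyp: "\<And>e \<epsilon> u. isotyp n e \<epsilon> u \<Longrightarrow>
      (\<not> int N dvd 2 * e - int n) \<or> (int N dvd 2 * e - int n \<and> (\<epsilon> = 1 \<or>
          \<epsilon> = -1)) \<Longrightarrow> P u"
    and add: "\<And>u v. P u \<Longrightarrow> P v \<Longrightarrow> P (u + v)"
  shows "P u"
proof -
  have res_part: "P (res_part e u)" for e
  proof (cases "int N dvd 2 * e - int n")
    case True
    define v where "v = res_part e u"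
    have v: "isotyp n e 0 v"
      unfolding v_def by (rule isotyp_res_part[OF assms(1)])
    have "P (smult (1/2) (v + smult 1 (swap n v)))"
      by (rule isotyp[OF isotyp_halves[OF v True disjI1[OF refl]]]) (simp add: True)
    moreover have "P (smult (1/2) (v + smult (- 1) (swap n v)))"
      by (rule isotyp[OF isotyp_halves[OF v True disjI2[OF refl]]]) (simp add: True)
    ultimately have "P (smult (1/2) (v + smult 1 (swap n v)) + smult (1/2) (v + smult (- 1) (swap n v)))"
      by (rule add)
    moreover have "smult (1/2) (v + smult 1 (swap n v)) + smult (1/2) (v + smult (- 1) (swap n v)) = v"
      by (rule poly_eqI) (simp add: field_simps)
    ultimately show ?thesis by (simp add: v_def)
  next
    case False
    then show ?thesis
      using isotyp[OF isotyp_res_part[OF assms(1)]] by blast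
  qed
  \<comment> \<open>Nothing is assumed about \<open>P 0\<close>, so the induction runs over nonempty
    ranges.\<close>
  have "P (\<Sum>e<Suc k. res_part (int e) u)" for k
    by (induction k) (auto simp: res_part intro: add)
  from this[of "N - 1"] have "P (\<Sum>e<N. res_part (int e) u)"
    using N_pos(1) by simp
  then show ?thesis by (simp only: sum_res_part)
qed

lemma isotyp_mult:
  assumes u: "isotyp n e \<epsilon> u" and v: "isotyp k 0 \<delta> v" "\<delta> \<noteq> 0"
  shows "isotyp (n + k) e (\<epsilon> * \<delta>) (u * v)"
  unfolding isotyp_def
proof (intro conjI allI impI)
  show "qform (n + k) (u * v)"
    using u v by (intro qform_mult) (auto simp: isotyp_def)
  show "swap (n + k) (u * v) = smult (\<epsilon> * \<delta>) (u * v)" if "\<epsilon> * \<delta> \<noteq> 0"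
    using u v that swap_mult[of u n v k] qform_degree[of n u] qform_degree[of k v]
    by (auto simp: isotyp_def mult.commute)
  fix a assume "coeff (u * v) a \<noteq> 0"
  then obtain i where i: "i \<le> a" "coeff u i \<noteq> 0" "coeff v (a - i) \<noteq> 0"
    using coeff_mult_nonzero by blast
  have "N dvd a - i"
    using v(1) i(3) by (auto simp: isotyp_def)
  then have "int N dvd int (a - i) - 0"
    by (simp only: of_nat_dvd_iff diff_zero)
  moreover have "int N dvd int i - e"
    using u i(2) by (auto simp: isotyp_def)
  ultimately have "int N dvd (int i - e) + (int (a - i) - 0)"
    by (intro dvd_add)
  then show "int N dvd int a - e"
    using i(1) by (simp add: of_nat_diff)
qed

lemma isotyp_sig2: "isotyp N 0 1 sig2"
proof -
  have "swap N sig2 = sig2"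
    by (simp add: sig2_def swap_add swap_monom swap_1 add.commute)
  then show ?thesis
    using qform_sig2 by (auto simp: isotyp_def sig2_def coeff_1 split: if_splits)
qed

lemma isotyp_wpoly: "isotyp M 0 (- 1) wpoly"
proof -
  have sw: "swap (k * N) (disc ^ k) = (- disc) ^ k \<and> (\<forall>a. coeff (disc ^ k) a \<noteq> 0
      \<longrightarrow> N dvd a)" for k
  proof (induction k)
    case (Suc k)
    have deg: "degree (disc ^ k) \<le> k * N"
      using le_trans[OF degree_power_le[of disc k] mult_le_mono1[OF degree_disc, of k]] by (simp
          only: mult.commute)
    have "swap (N + k * N) (disc * disc ^ k) = - disc * (- disc) ^ k"
      using swap_mult[OF degree_disc deg] Suc by (simp add: swap_disc)
    moreover have "N dvd a" if "coeff (disc * disc ^ k) a \<noteq> 0" for a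
    proof -
      from coeff_mult_nonzero[OF that]
      obtain i where i: "i \<le> a" "coeff disc i \<noteq> 0" "coeff (disc ^ k) (a - i) \<noteq> 0"
        by blast
      then have "N dvd i"
        by (auto simp: disc_def coeff_1 split: if_splits)
      moreover have "N dvd a - i" using i Suc by auto
      ultimately show ?thesis using i(1) by (metis dvd_add le_add_diff_inverse)
    qed
    ultimately show ?case by simp
  qed (auto simp: swap_1 coeff_1 split: if_splits)
  have "(- disc) ^ (2 * m + 1) = - (disc ^ (2 * m + 1))"
    by (rule power_minus_odd) simp
  then have "swap M wpoly = - wpoly"
    using sw[of "2 * m + 1"] by (simp only: M_def wpoly_def)
  moreover have "\<forall>a. coeff wpoly a \<noteq> 0 \<longrightarrow> N dvd a"
    using sw[of "2 * m + 1"] unfolding wpoly_def by blast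
  ultimately show ?thesis
    using qform_wpoly by (simp add: isotyp_def)
qed

lemma isotyp_mult_wpoly: "isotyp n e \<epsilon> u \<Longrightarrow> isotyp (n + M) e (- \<epsilon>)
    (u * wpoly)"
  using isotyp_mult[OF _ isotyp_wpoly] by fastforce

lemma isotyp_mult_sig2: "isotyp n e \<epsilon> u \<Longrightarrow> isotyp (n + N) e \<epsilon> (u * sig2)"
  using isotyp_mult[OF _ isotyp_sig2] by fastforce

lemma isotyp_CMiter:
  assumes "isotyp n e \<epsilon> u" "2 * k \<le> n"
  shows "isotyp (n - 2 * k) (e - int k) \<epsilon> (CMiter k n u)"
  using assms(2)
proof (induction k)
  case (Suc k)
  then have "isotyp (n - 2 * k - 2) (e - int k - 1) \<epsilon> (CMf (n - 2 * k) (CMiter k n u))"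
    by (intro isotyp_CMf) auto
  then show ?case by (simp add: algebra_simps)
qed (use assms in simp)

lemma CMiter_nz: "CMiter k n u \<noteq> 0 \<Longrightarrow> 2 * k \<le> n"
  using CMiter_large[of n k u] by (meson not_le)

lemma mod_add_le: "(x + y) mod int N \<le> x mod int N + y mod int N"
proof -
  have "(x + y) mod int N = (x mod int N + y mod int N) mod int N"
    by (simp add: mod_add_eq)
  also have "\<dots> \<le> x mod int N + y mod int N"
    using N_pos by (intro zmod_le_nonneg_dividend add_nonneg_nonneg) auto
  finally show ?thesis .
qed

text \<open>
  The degree bounds of two classes exchanged by such a map add up to \<open>M\<close>, so there is no room
  for a nonzero value.
\<close>

lemma degree_gap_kills:
  assumes st: "\<sigma> = 1 \<and> \<tau> = 2 \<or> \<sigma> = 0 \<and> \<tau> = N"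
    and add: "\<And>u v. f (u + v) = f u + f v"
    and f: "\<And>e \<epsilon> u. isotyp d e \<epsilon> u \<Longrightarrow> f u \<noteq> 0 \<Longrightarrow>
      \<exists>n. n + d + \<tau> = M \<and> isotyp n (e - int d - \<sigma>) (- \<epsilon>) (f u)"
    and u: "qform d u"
  shows "f u = 0"
  using u
proof (induction u rule: qform_isotyp_induct)
  case (isotyp e \<epsilon> u)
  show ?case
  proof (rule ccontr)
    assume nz: "f u \<noteq> 0"
    have "f 0 + f 0 = f 0" using add[of 0 0] by simp
    then have "u \<noteq> 0" using nz by auto
    obtain n where n: "n + d + \<tau> = M" and t: "isotyp n (e - int d - \<sigma>) (- \<epsilon>) (f u)"
      using f[OF isotyp(1) nz] by blast
    define e' where "e' = e - int d - \<sigma>"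
    have tau: "\<tau> > 0" using st N_pos by auto
    have N: "0 \<le> x mod int N" for x using N_pos by simp
    have nd: "int n + int d = int M - int \<tau>" using n by simp
    have shift: "2 * e' - int n = (2 * e - int d) + (int \<tau> - 2 * \<sigma> - int M)"
      using nd by (simp add: e'_def)
    have "int N dvd int \<tau> - 2 * \<sigma> - int M"
      using st by (auto simp: M_def)
    then have gen: "int N dvd 2 * e' - int n \<longleftrightarrow> int N dvd 2 * e - int d"
      unfolding shift by (simp add: dvd_add_left_iff)
    show False
    \<comment> \<open>\<open>f\<close> reverses the parity. In a reflection-stable class either the
      value or the argument is antisymmetric and needs degree at least M, while n + d is less than
      M.\<close>
    proof (cases "int N dvd 2 * e - int d")
      case True
      then have "\<epsilon> = 1 \<or> \<epsilon> = -1" using isotyp(2) by blast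
      then show False
      proof
        assume "\<epsilon> = 1"
        then have "int M + 2 * (e' mod int N) \<le> int n"
          using antisym_gap[of n e' "f u"] t gen True nz unfolding M_def e'_def by simp
        then show False using n tau N[of e'] by linarith
      next
        assume "\<epsilon> = -1"
        then have "int M + 2 * (e mod int N) \<le> int d"
          using antisym_gap[of d e u] isotyp(1) True \<open>u \<noteq> 0\<close> unfolding M_def by simp
        then show False using n tau N[of e] by linarith
      qed
    next
      case False
      have 1: "int (m * N) + e mod int N + (int d - e) mod int N \<le> int d"
        by (rule generic_gap[OF isotyp(1) False \<open>u \<noteq> 0\<close>])
      have 2: "int (m * N) + e' mod int N + (int n - e') mod int N \<le> int n"
        using generic_gap[of n e' "- \<epsilon>" "f u"] t gen False nz unfolding e'_def by simp
      have MN: "int M = 2 * int (m * N) + int N" by (simp add: M_def)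
      have s1: "e' + (int d - e) = - \<sigma>" "int n - e' + e = int M - int \<tau> + \<sigma>"
        using nd by (simp_all add: e'_def)
      from st show False
      proof
        \<comment> \<open>The classes combine to -1 modulo N in two ways, so the four residues sum
          to at least 2N - 2. But n + d exceeds 2mN by only N - 2.\<close>
        assume st: "\<sigma> = 1 \<and> \<tau> = 2"
        have m1: "(- 1) mod int N = int N - 1"
          using N2 by (simp add: zmod_minus1)
        have "int M - int \<tau> + \<sigma> = - 1 + int N * (2 * int m + 1)"
          using st by (simp add: M_def algebra_simps)
        then have m2: "(int M - int \<tau> + \<sigma>) mod int N = int N - 1"
          using m1 by (metis mod_mult_self2)
        have "int N - 1 \<le> e' mod int N + (int d - e) mod int N"
          using mod_add_le[of e' "int d - e"] s1(1) m1 st by simp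
        moreover have "int N - 1 \<le> (int n - e') mod int N + e mod int N"
          using mod_add_le[of "int n - e'" e] s1(2) m2 by simp
        ultimately show False
          using 1 2 nd MN st N2 by linarith
      next
        \<comment> \<open>Now n + d = 2mN, so all four residues are 0. Then N divides e and d - e,
          against the assumption on 2e - d.\<close>
        assume st: "\<sigma> = 0 \<and> \<tau> = N"
        then have "e mod int N + (int d - e) mod int N = 0"
          using 1 2 nd MN N[of e] N[of e'] N[of "int d - e"] N[of "int n - e'"] by linarith
        then have "e mod int N = 0" "(int d - e) mod int N = 0"
          using add_nonneg_eq_0_iff[OF N[of e] N[of "int d - e"]] by auto
        then have "int N dvd e" "int N dvd int d - e"
          by (simp_all only: dvd_eq_mod_eq_0)
        then have "int N dvd e - (int d - e)"
          by (rule dvd_diff)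
        then show False using False by (simp add: algebra_simps)
      qed
    qed
  qed
next
  case (add u v)
  then show ?case using assms(2) by simp
qed

lemma kill_Suc: "qform d u \<Longrightarrow> CMiter (d + 1) (d + M) (u * wpoly) = 0"
proof (rule degree_gap_kills[where f = "\<lambda>u. CMiter (d + 1) (d + M) (u * wpoly)" and \<sigma>
    = 1 and \<tau> = 2 and d = d])
  fix e \<epsilon> u assume u: "isotyp d e \<epsilon> u" and "CMiter (d + 1) (d + M) (u * wpoly) \<noteq> 0"
  then have "2 * (d + 1) \<le> d + M" using CMiter_nz by blast
  then show "\<exists>n. n + d + 2 = M \<and> isotyp n (e - int d - 1) (- \<epsilon>) (CMiter (d +
      1) (d + M) (u * wpoly))"
    using isotyp_CMiter[OF isotyp_mult_wpoly[OF u], of "d + 1"]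
    by (intro exI[of _ "d + M - 2 * (d + 1)"]) (simp add: algebra_simps)
qed (simp_all add: distrib_right CMiter_add del: CMiter.simps)

lemma kill_t: "qform d u \<Longrightarrow> CMiter (d + 2) (d + 2 + M) (pCons 0 u * wpoly) = 0"
proof (rule degree_gap_kills[where f = "\<lambda>u. CMiter (d + 2) (d + 2 + M) (pCons 0 u * wpoly)"
    and \<sigma> = 1 and \<tau> = 2 and d = d])
  fix e \<epsilon> u assume u: "isotyp d e \<epsilon> u" and "CMiter (d + 2) (d + 2 + M) (pCons 0 u
      * wpoly) \<noteq> 0"
  then have "2 * (d + 2) \<le> d + 2 + M" using CMiter_nz by blast
  then show "\<exists>n. n + d + 2 = M \<and> isotyp n (e - int d - 1) (- \<epsilon>) (CMiter (d +
      2) (d + 2 + M) (pCons 0 u * wpoly))"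
    using isotyp_CMiter[OF isotyp_mult_wpoly[OF isotyp_t[OF u]], of "d + 2"]
    by (intro exI[of _ "d + 2 + M - 2 * (d + 2)"]) (simp add: algebra_simps)
next
  fix u v :: "complex poly"
  have "pCons 0 (u + v) = pCons 0 u + pCons 0 v" by simp
  then show "CMiter (d + 2) (d + 2 + M) (pCons 0 (u + v) * wpoly) =
      CMiter (d + 2) (d + 2 + M) (pCons 0 u * wpoly) + CMiter (d + 2) (d + 2 + M) (pCons 0 v * wpoly)"
    by (simp only: distrib_right CMiter_add)
qed simp

lemma kill_sig2: "qform d u \<Longrightarrow> CMiter (d + N) (d + N + M) (u * sig2 * wpoly) = 0"
proof (rule degree_gap_kills[where f = "\<lambda>u. CMiter (d + N) (d + N + M) (u * sig2 * wpoly)"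
    and \<sigma> = 0 and \<tau> = N and d = d])
  fix e \<epsilon> u assume u: "isotyp d e \<epsilon> u" and "CMiter (d + N) (d + N + M) (u * sig2 *
      wpoly) \<noteq> 0"
  then have le: "2 * (d + N) \<le> d + N + M" using CMiter_nz by blast
  then have "isotyp (d + N + M - 2 * (d + N)) (e - int d - 0) (- \<epsilon>) (CMiter (d + N) (d + N
      + M) (u * sig2 * wpoly))"
    using isotyp_cong[OF isotyp_CMiter[OF isotyp_mult_wpoly[OF isotyp_mult_sig2[OF u]] le], of "e -
        int d - 0"] by simp
  then show "\<exists>n. n + d + N = M \<and> isotyp n (e - int d - 0) (- \<epsilon>) (CMiter (d +
      N) (d + N + M) (u * sig2 * wpoly))"
    using le by (intro exI[of _ "d + N + M - 2 * (d + N)"]) simp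
qed (simp_all add: distrib_right CMiter_add)

text \<open>On quasiinvariant forms of degree d this is pi_m up to a nonzero factor, see
  \<open>pi_map_pif\<close>.\<close>

definition pif :: "nat \<Rightarrow> complex poly \<Rightarrow> complex poly" where
  "pif d u = CMiter d (d + M) (u * wpoly)"

lemma pif_add: "pif d (u + v) = pif d u + pif d v"
  by (simp add: pif_def distrib_right CMiter_add)

lemma pif_smult: "pif d (smult c u) = smult c (pif d u)"
  by (simp add: pif_def CMiter_smult)

lemma pif_large: "M < d \<Longrightarrow> pif d u = 0"
  unfolding pif_def by (rule CMiter_large) simp

lemma isotyp_pif: "isotyp d e \<epsilon> u \<Longrightarrow> d \<le> M \<Longrightarrow> isotyp (M -
    d) (e - int d) (- \<epsilon>) (pif d u)"
  using isotyp_CMiter[OF isotyp_mult_wpoly, of d e \<epsilon> u d] unfolding pif_def by simp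

lemma qform_pif: "qform d u \<Longrightarrow> qform (M - d) (pif d u)"
  using qform_CMiter[OF qform_mult[OF _ qform_wpoly], of d u d] unfolding pif_def by simp

text \<open>On functions killed by L the operators chi(sigma_1) and chi(sigma_2) are multiples of
  L^2 sigma_1 and L^N sigma_2. With \<open>CMf_pif\<close>, this lemma and the next one give
  harmonicity of the image.\<close>

lemma kill_pif_t: "qform d u \<Longrightarrow> CMiter 2 (M - d + 2) (pCons 0 (pif d u)) = 0"
proof (rule degree_gap_kills[where f = "\<lambda>u. CMiter 2 (M - d + 2) (pCons 0 (pif d u))" and
    \<sigma> = 1 and \<tau> = 2 and d = d])
  fix e \<epsilon> u assume u: "isotyp d e \<epsilon> u" and nz: "CMiter 2 (M - d + 2) (pCons 0 (pif
      d u)) \<noteq> 0"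
  then have d: "d \<le> M" using pif_large[of d u] by (metis CMiter_0 not_le pCons_0_0)
  have le: "2 * 2 \<le> M - d + 2" using nz CMiter_nz by blast
  then show "\<exists>n. n + d + 2 = M \<and> isotyp n (e - int d - 1) (- \<epsilon>) (CMiter 2 (M -
      d + 2) (pCons 0 (pif d u)))"
    using isotyp_CMiter[OF isotyp_t[OF isotyp_pif[OF u d]] le] d
    by (intro exI[of _ "M - d + 2 - 2 * 2"]) (simp add: algebra_simps)
next
  fix u v :: "complex poly"
  have "pCons 0 (pif d (u + v)) = pCons 0 (pif d u) + pCons 0 (pif d v)"
    by (simp add: pif_add)
  then show "CMiter 2 (M - d + 2) (pCons 0 (pif d (u + v))) =
      CMiter 2 (M - d + 2) (pCons 0 (pif d u)) + CMiter 2 (M - d + 2) (pCons 0 (pif d v))"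
    by (simp only: CMiter_add)
qed simp

lemma kill_pif_sig2: "qform d u \<Longrightarrow> CMiter N (M - d + N) (pif d u * sig2) = 0"
proof (rule degree_gap_kills[where f = "\<lambda>u. CMiter N (M - d + N) (pif d u * sig2)" and
    \<sigma> = 0 and \<tau> = N and d = d])
  fix e \<epsilon> u assume u: "isotyp d e \<epsilon> u" and nz: "CMiter N (M - d + N) (pif d u *
      sig2) \<noteq> 0"
  then have d: "d \<le> M" using pif_large[of d u] by (metis CMiter_0 not_le mult_zero_left)
  have le: "2 * N \<le> M - d + N" using nz CMiter_nz by blast
  then have "isotyp (M - d + N - 2 * N) (e - int d - 0) (- \<epsilon>) (CMiter N (M - d + N) (pif d
      u * sig2))"
    using isotyp_cong[OF isotyp_CMiter[OF isotyp_mult_sig2[OF isotyp_pif[OF u d]] le], of "e - int d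
        - 0"] by simp
  then show "\<exists>n. n + d + N = M \<and> isotyp n (e - int d - 0) (- \<epsilon>) (CMiter N (M -
      d + N) (pif d u * sig2))"
    using le d by (intro exI[of _ "M - d + N - 2 * N"]) simp
qed (simp_all add: pif_add distrib_right CMiter_add)

lemma CMf_pif: "qform d u \<Longrightarrow> CMf (M - d) (pif d u) = 0"
proof -
  assume "qform d u"
  have "CMf (d + M - 2 * d) (pif d u) = 0"
    using kill_Suc[OF \<open>qform d u\<close>] by (simp add: pif_def)
  moreover have "d + M - 2 * d = M - d" by simp
  ultimately show ?thesis by metis
qed

end

subsection \<open>Self-adjointness of the angular part\<close>

text \<open>z d/dz - w d/dw on w^c U(z/w). The degree c is complex because the weight has the
  negative degree -2mN.\<close>

definition ang_fps :: "complex \<Rightarrow> complex fps \<Rightarrow> complex fps" where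
  "ang_fps c U = fps_const 2 * (fps_X * fps_deriv U) - fps_const c * U"

lemma ang_fps_nth: "fps_nth (ang_fps c U) a = (2 * of_nat a - c) * fps_nth U a"
  by (cases a) (simp_all add: ang_fps_def algebra_simps)

lemma ang_fps_add: "ang_fps c (U + V) = ang_fps c U + ang_fps c V"
  by (rule fps_ext) (simp add: ang_fps_nth algebra_simps)

lemma ang_fps_const: "ang_fps c (fps_const k * U) = fps_const k * ang_fps c U"
  by (rule fps_ext) (simp add: ang_fps_nth)

lemma ang_fps_mult: "ang_fps (c + d) (U * V) = ang_fps c U * V + U * ang_fps d V"
  unfolding ang_fps_def fps_deriv_mult fps_const_add[symmetric] by (simp only: algebra_simps)

lemma ang_fps_X_power: "ang_fps (of_nat (2 * k)) (fps_X ^ k) = 0"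
  by (rule fps_ext) (simp add: ang_fps_nth)

lemma ang_fps_1: "ang_fps 0 1 = 0"
  using ang_fps_X_power[of 0] by simp

context dihedral
begin

definition disc_fps :: "complex fps" where "disc_fps = fps_X ^ N - 1"
definition sig2_fps :: "complex fps" where "sig2_fps = fps_X ^ N + 1"

lemma fps_of_poly_disc: "fps_of_poly disc = disc_fps"
  by (simp add: disc_fps_def disc_def fps_of_poly_diff fps_of_poly_monom)

lemma disc_fps_inv: "disc_fps * inverse disc_fps = 1"
  using N_pos(1) inverse_mult_eq_1'[of disc_fps] by (simp add: disc_fps_def)

lemma disc_fps_nz: "disc_fps \<noteq> 0"
  using disc_fps_inv by auto

lemma ang_fps_disc_fps: "ang_fps (of_nat N) disc_fps = fps_const (of_nat N) * sig2_fps"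
  by (rule fps_ext) (auto simp: ang_fps_nth disc_fps_def sig2_fps_def algebra_simps)

lemma ang_fps_sig2_fps: "ang_fps (of_nat N) sig2_fps = fps_const (of_nat N) * disc_fps"
  by (rule fps_ext) (auto simp: ang_fps_nth disc_fps_def sig2_fps_def algebra_simps)

lemma sig2_fps_square: "sig2_fps * sig2_fps = disc_fps * disc_fps + fps_const 4 * fps_X ^ N"
  by (simp add: sig2_fps_def disc_fps_def algebra_simps numeral_fps_const)

lemma ang_fps_disc_fps_power: "ang_fps (of_nat (k * N)) (disc_fps ^ k) * disc_fps = fps_const
    (of_nat (k * N)) * (sig2_fps * disc_fps ^ k)"
proof (induction k)
  case 0
  show ?case using ang_fps_1 by simp
next
  case (Suc k)
  have "ang_fps (of_nat (Suc k * N)) (disc_fps ^ Suc k) * disc_fps =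
     ang_fps (of_nat N + of_nat (k * N)) (disc_fps * disc_fps ^ k) * disc_fps"
    by simp
  also have "\<dots> = fps_const (of_nat N) * (sig2_fps * disc_fps ^ Suc k) + disc_fps * (ang_fps
      (of_nat (k * N)) (disc_fps ^ k) * disc_fps)"
    unfolding ang_fps_mult ang_fps_disc_fps by (simp add: algebra_simps)
  also have "\<dots> = fps_const (of_nat N + of_nat (k * N)) * (sig2_fps * disc_fps ^ Suc k)"
    unfolding Suc fps_const_add[symmetric] by (simp only: algebra_simps power_Suc)
  finally show ?case by simp
qed

definition wgt_fps :: "complex fps" where "wgt_fps = inverse disc_fps ^ (2 * m)"

lemma wgt_fps_disc_fps: "wgt_fps * disc_fps ^ (2 * m) = 1"
  unfolding wgt_fps_def using disc_fps_inv by (simp add: mult.commute flip: power_mult_distrib)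

text \<open>The logarithmic derivative of the weight, obtained by differentiating
  \<open>wgt_fps_disc_fps\<close>.\<close>

lemma ang_fps_wgt_fps: "ang_fps (- (2 * mn)) wgt_fps = - (fps_const (2 * mn) * (sig2_fps * inverse
    disc_fps * wgt_fps))"
proof -
  have mn: "of_nat (2 * m * N) = 2 * mn" by (simp add: mn_def)
  have "0 = ang_fps (- (2 * mn) + 2 * mn) (wgt_fps * disc_fps ^ (2 * m))"
    using ang_fps_1 by (simp add: wgt_fps_disc_fps)
  also have "\<dots> = ang_fps (- (2 * mn)) wgt_fps * disc_fps ^ (2 * m) + wgt_fps * ang_fps (2 *
      mn) (disc_fps ^ (2 * m))"
    by (rule ang_fps_mult)
  finally have "0 = (ang_fps (- (2 * mn)) wgt_fps * disc_fps ^ (2 * m) + wgt_fps * ang_fps (2 * mn)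
      (disc_fps ^ (2 * m))) * (wgt_fps * disc_fps)"
    by simp
  also have "\<dots> = ang_fps (- (2 * mn)) wgt_fps * disc_fps * (wgt_fps * disc_fps ^ (2 * m)) +
      wgt_fps * wgt_fps * (ang_fps (2 * mn) (disc_fps ^ (2 * m)) * disc_fps)"
    by (simp only: algebra_simps)
  also have "ang_fps (2 * mn) (disc_fps ^ (2 * m)) * disc_fps = fps_const (2 * mn) * (sig2_fps *
      disc_fps ^ (2 * m))"
    using ang_fps_disc_fps_power[of "2 * m"] unfolding mn .
  also have "ang_fps (- (2 * mn)) wgt_fps * disc_fps * (wgt_fps * disc_fps ^ (2 * m)) + wgt_fps *
      wgt_fps * (fps_const (2 * mn) * (sig2_fps * disc_fps ^ (2 * m))) =
     ang_fps (- (2 * mn)) wgt_fps * disc_fps * (wgt_fps * disc_fps ^ (2 * m)) + wgt_fps * fps_const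
         (2 * mn) * sig2_fps * (wgt_fps * disc_fps ^ (2 * m))"
    by (simp only: mult_ac)
  finally have "(ang_fps (- (2 * mn)) wgt_fps * disc_fps + wgt_fps * fps_const (2 * mn) * sig2_fps)
      * inverse disc_fps = 0"
    by (simp add: wgt_fps_disc_fps)
  then have "ang_fps (- (2 * mn)) wgt_fps * (disc_fps * inverse disc_fps) + fps_const (2 * mn) *
      (sig2_fps * inverse disc_fps * wgt_fps) = 0"
    by (simp only: algebra_simps)
  then show ?thesis
    by (simp add: disc_fps_inv eq_neg_iff_add_eq_0)
qed

text \<open>
  The angular part of \<open>\<L>\<close>, in divergence form with respect to the weight \<open>wgt_fps\<close>
  (see \<open>wgt_fps_ang_op\<close>).
\<close>

definition ang_op :: "complex \<Rightarrow> complex fps \<Rightarrow> complex fps" where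
  "ang_op n U = - ang_fps n (ang_fps n U) + fps_const (2 * mn) * (sig2_fps * inverse disc_fps * ang_fps n U)"

lemma ang_op_add: "ang_op n (U + V) = ang_op n U + ang_op n V"
  by (simp add: ang_op_def ang_fps_add algebra_simps)

lemma ang_op_const: "ang_op n (fps_const k * U) = fps_const k * ang_op n U"
  unfolding ang_op_def ang_fps_const by (simp only: algebra_simps mult_minus_right)

lemma ang_op_0 [simp]: "ang_op n 0 = 0"
  using ang_op_const[of n 0 0] by simp

lemma wgt_fps_ang_op: "wgt_fps * ang_op n U = - ang_fps (n - 2 * mn) (wgt_fps * ang_fps n U)"
proof -
  have "ang_fps (n - 2 * mn) (wgt_fps * ang_fps n U) = ang_fps (- (2 * mn) + n) (wgt_fps * ang_fps n U)"
    by simp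
  also have "\<dots> = ang_fps (- (2 * mn)) wgt_fps * ang_fps n U + wgt_fps * ang_fps n (ang_fps n U)"
    by (rule ang_fps_mult)
  finally show ?thesis
    unfolding ang_fps_wgt_fps ang_op_def by (simp add: algebra_simps)
qed

text \<open>For degrees with n + n' - 2mN = 2k, coefficient k is the Fourier mode of the product
  that is constant in the angle. It replaces the integral over the circle.\<close>

definition pairing :: "nat \<Rightarrow> complex fps \<Rightarrow> complex fps \<Rightarrow> complex" where
  "pairing k U V = fps_nth (wgt_fps * U * V) k"

lemma pairing_linear:
  "pairing k (U + U') V = pairing k U V + pairing k U' V" "pairing k U (V + V') = pairing k U V +
      pairing k U V'"
  "pairing k (fps_const c * U) V = c * pairing k U V" "pairing k U (fps_const c * V) = c * pairing k U V"
proof -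
  show "pairing k (fps_const c * U) V = c * pairing k U V" "pairing k U (fps_const c * V) = c * pairing k U V"
    using fps_mult_left_const_nth[of c "wgt_fps * U * V" k]
    by (simp_all add: pairing_def mult_ac)
qed (simp_all add: pairing_def algebra_simps)

text \<open>Integration by parts: coefficient k of \<open>ang_fps (of_nat (2 * k))\<close> of any
  series is 0. The divergence form \<open>wgt_fps_ang_op\<close> leaves an intermediate expression
  that is symmetric in the two arguments.\<close>

lemma pairing_selfadjoint:
  assumes "n + n' = of_nat (2 * k) + 2 * mn"
  shows "pairing k (ang_op n U) V = pairing k U (ang_op n' V)"
proof -
  have key: "fps_nth (wgt_fps * ang_op n U * V) k = fps_nth (wgt_fps * ang_fps n U * ang_fps n' V) k"
    if h: "n + n' = of_nat (2 * k) + 2 * mn" for n n' U V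
  proof -
    have "0 = fps_nth (ang_fps (of_nat (2 * k)) (wgt_fps * ang_fps n U * V)) k"
      by (simp add: ang_fps_nth)
    also have "of_nat (2 * k) = (n - 2 * mn) + n'"
      using h by (simp add: algebra_simps)
    also have "ang_fps ((n - 2 * mn) + n') (wgt_fps * ang_fps n U * V) = - (wgt_fps * ang_op n U *
        V) + wgt_fps * ang_fps n U * ang_fps n' V"
      unfolding ang_fps_mult wgt_fps_ang_op by simp
    finally show ?thesis by simp
  qed
  have "fps_nth (wgt_fps * ang_fps n U * ang_fps n' V) k = fps_nth (wgt_fps * ang_op n' V * U) k"
    using key[of n' n V U] assms by (simp add: add.commute mult_ac)
  then show ?thesis
    unfolding pairing_def using key[OF assms, of U V] by (simp add: mult_ac)
qed

lemma ang_op_X_power: "ang_op (of_nat (2 * k) + n) (fps_X ^ k * U) = fps_X ^ k * ang_op n U"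
proof -
  have X: "ang_fps (of_nat (2 * k) + n) (fps_X ^ k * U) = fps_X ^ k * ang_fps n U" for U
    unfolding ang_fps_mult ang_fps_X_power by simp
  show ?thesis unfolding ang_op_def X by (simp add: algebra_simps)
qed

definition radial :: "complex \<Rightarrow> complex" where "radial y = y * (y - 2 * mn)"

text \<open>Separation in polar coordinates: sigma_1 L acts by the scalar \<open>radial\<close> on
  the degree and by \<open>ang_op\<close> on the angle.\<close>

lemma CMf_ang_op:
  assumes "qform n u"
  shows "fps_const 4 * (fps_X * fps_of_poly (CMf n u)) =
    fps_const (radial (of_nat n)) * fps_of_poly u + ang_op (of_nat n) (fps_of_poly u)"
proof -
  define U where "U = fps_of_poly u"
  define c where "c = fps_const (radial (of_nat n))"
  have up: "fps_const 4 * fps_of_poly (up_part n u) = c * U - ang_fps (of_nat n) (ang_fps (of_nat n)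
      U) + fps_const (2 * mn) * ang_fps (of_nat n) U"
    by (rule fps_ext) (simp add: coeff_up_part ang_fps_nth c_def radial_def U_def, simp add: algebra_simps)
  have dn: "fps_const 4 * fps_of_poly (down_part n u) = c * U - ang_fps (of_nat n) (ang_fps (of_nat
      n) U) - fps_const (2 * mn) * ang_fps (of_nat n) U"
    by (rule fps_ext) (simp add: coeff_down_part ang_fps_nth c_def radial_def U_def, simp add: algebra_simps)
  have "disc_fps * (fps_X * fps_of_poly (CMf n u)) = fps_X ^ N * fps_of_poly (up_part n u) -
      fps_of_poly (down_part n u)"
    using arg_cong[OF CMf_eqn[OF assms], of fps_of_poly]
    by (simp only: fps_of_poly_mult fps_of_poly_diff fps_of_poly_pCons fps_of_poly_monom
        fps_of_poly_disc) (simp add: mult.commute)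
  then have "fps_const 4 * (disc_fps * (fps_X * fps_of_poly (CMf n u))) =
     fps_const 4 * (fps_X ^ N * fps_of_poly (up_part n u) - fps_of_poly (down_part n u))"
    by simp
  then have "disc_fps * (fps_const 4 * (fps_X * fps_of_poly (CMf n u))) =
     fps_X ^ N * (fps_const 4 * fps_of_poly (up_part n u)) - fps_const 4 * fps_of_poly (down_part n u)"
    by (simp only: right_diff_distrib mult.left_commute)
  also have "\<dots> = disc_fps * (c * U - ang_fps (of_nat n) (ang_fps (of_nat n) U)) + fps_const (2
      * mn) * (sig2_fps * ang_fps (of_nat n) U)"
    unfolding up dn disc_fps_def sig2_fps_def by (simp only: algebra_simps) simp
  also have "\<dots> = disc_fps * (c * U + ang_op (of_nat n) U) + fps_const (2 * mn) * (sig2_fps *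
      ang_fps (of_nat n) U) * (1 - disc_fps * inverse disc_fps)"
    unfolding ang_op_def by (simp add: algebra_simps)
  finally have "disc_fps * (fps_const 4 * (fps_X * fps_of_poly (CMf n u))) = disc_fps * (c * U +
      ang_op (of_nat n) U)"
    by (simp add: disc_fps_inv)
  then show ?thesis
    using disc_fps_nz by (simp add: U_def c_def)
qed

text \<open>This is sigma_1^k L^k u. Multiplying back by sigma_1^k keeps the degree n, so the one
  operator \<open>ang_op n\<close> governs all iterates.\<close>

definition CMfps :: "nat \<Rightarrow> nat \<Rightarrow> complex poly \<Rightarrow> complex fps" where
  "CMfps k n u = fps_const (4 ^ k) * (fps_X ^ k * fps_of_poly (CMiter k n u))"

lemma CMfps_Suc:
  assumes "qform n u" "2 * k \<le> n"
  shows "CMfps (Suc k) n u = fps_const (radial (of_nat (n - 2 * k))) * CMfps k n u + ang_op (of_nat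
      n) (CMfps k n u)"
proof -
  define v where "v = CMiter k n u"
  have "qform (n - 2 * k) v"
    unfolding v_def by (rule qform_CMiter[OF assms(1)])
  note L = CMf_ang_op[OF this]
  have "CMfps (Suc k) n u = fps_const (4 ^ k) * (fps_X ^ k * (fps_const 4 * (fps_X * fps_of_poly
      (CMf (n - 2 * k) v))))"
    by (simp add: CMfps_def v_def mult_ac flip: fps_const_mult)
  also have "\<dots> = fps_const (radial (of_nat (n - 2 * k))) * CMfps k n u +
      fps_const (4 ^ k) * (fps_X ^ k * ang_op (of_nat (n - 2 * k)) (fps_of_poly v))"
    unfolding L by (simp add: CMfps_def v_def algebra_simps)
  also have "fps_X ^ k * ang_op (of_nat (n - 2 * k)) (fps_of_poly v) = ang_op (of_nat n) (fps_X ^ k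
      * fps_of_poly v)"
    using ang_op_X_power[of k "of_nat (n - 2 * k)" "fps_of_poly v"] assms(2) by (simp flip: of_nat_add)
  finally show ?thesis by (simp add: CMfps_def v_def ang_op_const)
qed

text \<open>Self-adjointness moves \<open>ang_op\<close> onto the eigenvector \<open>h\<close>, so
  each application of L only multiplies the pairing by a scalar.\<close>

lemma pairing_CMfps_eigen:
  assumes "qform n u" "of_nat n + n' = of_nat (2 * \<kappa>) + 2 * mn" "ang_op n' h = fps_const (-
      c) * h" "2 * k \<le> n + 2"
  shows "pairing \<kappa> (CMfps k n u) h = (\<Prod>i<k. radial (of_nat (n - 2 * i)) - c) * pairing
      \<kappa> (fps_of_poly u) h"
  using assms(4)
proof (induction k)
  case (Suc k)
  have "2 * k \<le> n" using Suc.prems by simp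
  then have "pairing \<kappa> (CMfps (Suc k) n u) h = radial (of_nat (n - 2 * k)) * pairing \<kappa>
      (CMfps k n u) h + - c * pairing \<kappa> (CMfps k n u) h"
    by (simp only: CMfps_Suc[OF assms(1)] pairing_linear pairing_selfadjoint[OF assms(2)] assms(3))
  then have "pairing \<kappa> (CMfps (Suc k) n u) h = (radial (of_nat (n - 2 * k)) - c) * pairing
      \<kappa> (CMfps k n u) h"
    by (simp add: algebra_simps)
  then show ?case using Suc by simp
qed (simp add: CMfps_def)

section \<open>Nonvanishing on quasiinvariants of lowest degree\<close>

lemma coeff_disc_power: "coeff (disc ^ k) (j * N) = of_nat (k choose j) * (- 1) ^ (k - j)"
proof -
  have "disc ^ k = (monom 1 N + (- 1)) ^ k" by (simp add: disc_def)
  also have "\<dots> = (\<Sum>i\<le>k. monom (of_nat (k choose i) * (- 1) ^ (k - i)) (i * N))"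
    unfolding binomial_ring
  proof (intro sum.cong refl)
    fix i
    have "monom (1 :: complex) N ^ i = monom 1 (i * N)"
      by (simp add: monom_power mult.commute)
    moreover have "(- 1 :: complex poly) ^ j = [:(- 1) ^ j:]" for j
      by (induction j) (simp_all add: one_pCons)
    ultimately show "of_nat (k choose i) * monom 1 N ^ i * (- 1) ^ (k - i) =
        monom (of_nat (k choose i) * (- 1 :: complex) ^ (k - i)) (i * N)"
      by (simp add: of_nat_poly smult_monom mult.commute)
  qed
  finally have "coeff (disc ^ k) (j * N) = (\<Sum>i\<le>k. if i = j then of_nat (k choose j) * (- 1)
      ^ (k - j) else 0)"
    using N_pos(1) by (simp only: coeff_sum) (auto intro!: sum.cong)
  then show ?thesis by (cases "j \<le> k") (auto simp: sum.delta binomial_eq_0)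
qed

lemma coeff_wpoly_ends: "coeff wpoly M = 1" "coeff wpoly 0 = - 1"
  using coeff_disc_power[of "2 * m + 1" "2 * m + 1"] coeff_disc_power[of "2 * m + 1" 0]
  by (simp_all add: wpoly_def M_def del: power_Suc) 

lemma middle_disc_nz: "coeff (disc ^ (2 * m + 2)) ((m + 1) * N) \<noteq> 0"
proof -
  have "(2 * m + 2 choose (m + 1)) \<noteq> 0"
    by (simp only: binomial_eq_0_iff)
  then show ?thesis
    unfolding coeff_disc_power by (simp only: mult_eq_0_iff of_nat_eq_0_iff power_eq_0_iff) simp
qed

lemma fps_of_poly_wpoly: "fps_of_poly wpoly = disc_fps ^ (2 * m + 1)"
  by (simp only: wpoly_def fps_of_poly_power fps_of_poly_disc)


lemma isotyp_smult: "isotyp n e \<epsilon> u \<Longrightarrow> isotyp n e \<epsilon> (smult c u)"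
  by (auto simp: isotyp_def qform_smult swap_smult mult.commute)

lemma isotyp_add:
  assumes "isotyp n e \<epsilon> u" "isotyp n e \<epsilon> v"
  shows "isotyp n e \<epsilon> (u + v)"
proof -
  have "int N dvd int a - e" if "coeff (u + v) a \<noteq> 0" for a
    using that assms by (cases "coeff u a = 0") (auto simp: isotyp_def)
  then show ?thesis
    using assms by (auto simp: isotyp_def qform_add swap_add smult_add_right)
qed

lemma isotyp_diff: "isotyp n e \<epsilon> u \<Longrightarrow> isotyp n e \<epsilon> v
    \<Longrightarrow> isotyp n e \<epsilon> (u - v)"
  using isotyp_add[of n e \<epsilon> u "smult (- 1) v"] isotyp_smult[of n e \<epsilon> v "- 1"] by simp

text \<open>If both end coefficients vanish, z and w divide the form, hence so does sigma_1, and
  \<open>qform_t\<close> keeps the quotient quasiinvariant.\<close>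

lemma qform_pCons_cancel:
  assumes qform: "qform d u" and "coeff u 0 = 0" "coeff u d = 0"
  shows "\<exists>p. u = pCons 0 p \<and> (2 \<le> d \<or> p = 0) \<and> qform (d - 2) p"
proof -
  obtain p where p: "u = pCons 0 p" using assms(2) by (cases u) auto
  have cp: "coeff p a = coeff u (a + 1)" for a by (simp add: p)
  have z: "coeff p a = 0" if "d \<le> a + 1" for a
    using that assms(3) qform_coeff[OF qform, of "a + 1"] by (cases "a + 1 = d") (auto simp: cp)
  have deg: "degree p \<le> d - 2"
    unfolding degree_le_iff_coeff using z by auto
  have "qform (d - 2) p \<and> (2 \<le> d \<or> p = 0)"
  proof (cases "2 \<le> d")
    case True
    then show ?thesis using qform_t[OF deg] qform p by (metis le_add_diff_inverse2)
  next
    case False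
    then have "p = 0" using z by (intro poly_eqI) simp
    then show ?thesis by simp
  qed
  then show ?thesis using p by blast
qed

text \<open>Otherwise sigma_1 would divide u, with a quotient in class l - 1 and of degree mN + l -
  2, below the bound mN + l - 1.\<close>

lemma minimal_top_coeff:
  assumes u: "isotyp (m * N + l) (int l) \<epsilon> u" and l: "0 < l" "l < N" and nz: "u \<noteq> 0"
  shows "coeff u (m * N + l) \<noteq> 0" "coeff u 0 = 0"
proof -
  have nl: "\<not> int N dvd int l" using l by (auto dest: zdvd_imp_le)
  show c0: "coeff u 0 = 0"
  proof (rule ccontr)
    assume "coeff u 0 \<noteq> 0"
    then have "int N dvd int 0 - int l" using u unfolding isotyp_def by blast
    then show False using nl by simp
  qed
  show "coeff u (m * N + l) \<noteq> 0"
  proof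
    assume cd: "coeff u (m * N + l) = 0"
    obtain p where p: "u = pCons 0 p" "2 \<le> m * N + l \<or> p = 0" and q: "qform (m * N + l - 2) p"
      using qform_pCons_cancel[OF isotyp_qform[OF u] c0 cd] by blast
    have "int N dvd int a - (int l - 1)" if "coeff p a \<noteq> 0" for a
    proof -
      have "int N dvd int (Suc a) - int l"
        using u that unfolding isotyp_def p(1) by (metis coeff_pCons_Suc)
      then show ?thesis by (simp add: algebra_simps)
    qed
    then have t: "isotyp (m * N + l - 2) (int l - 1) 0 p"
      using q by (simp add: isotyp_def)
    have "p \<noteq> 0" using p nz by auto
    then have n: "int (m * N + l - 2) = int (m * N) + int l - 2" using p by auto
    have "2 * (int l - 1) - int (m * N + l - 2) = int l - int N * int m"
      unfolding n by (simp add: algebra_simps)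
    then have gen: "\<not> int N dvd 2 * (int l - 1) - int (m * N + l - 2)"
      using nl by (metis diff_add_cancel dvd_add dvd_triv_left)
    have "int (m * N + l - 2) \<ge> int (m * N) + (int l - 1) mod int N + (int (m * N + l - 2) -
        (int l - 1)) mod int N"
      by (rule generic_gap[OF t gen \<open>p \<noteq> 0\<close>])
    moreover have "(int l - 1) mod int N = int l - 1" using l by simp
    moreover have "0 \<le> (int (m * N + l - 2) - (int l - 1)) mod int N" using N_pos by simp
    ultimately show False unfolding n by linarith
  qed
qed

text \<open>The m + 1 topmost exponents of the class suffice: the m moment conditions on them have a
  solution with nonzero top coefficient.\<close>

lemma generic_exists:
  assumes l: "0 < l" "l < N" and k: "m \<le> k"
  shows "\<exists>p. isotyp (l + k * N) (int l) 0 p \<and> coeff p (l + k * N) \<noteq> 0"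
proof -
  define d where "d = l + k * N"
  define A where "A = (\<lambda>j. d - j * N) ` {..m}"
  have le: "j * N \<le> k * N" if "j \<le> m" for j using that k by simp
  have gen: "\<not> int N dvd 2 * int l - int d"
  proof
    assume "int N dvd 2 * int l - int d"
    moreover have "2 * int l - int d = int l - int N * int k" by (simp add: d_def algebra_simps)
    ultimately have "int N dvd int l" by (metis diff_add_cancel dvd_add dvd_triv_left)
    then show False using l by (auto dest: zdvd_imp_le)
  qed
  have inj: "inj_on (\<lambda>j. d - j * N) {..m}"
  proof (rule inj_onI)
    fix i j assume ij: "i \<in> {..m}" "j \<in> {..m}" "d - i * N = d - j * N"
    have li: "i * N \<le> k * N" "j * N \<le> k * N" using le ij(1,2) by auto
    have "i * N = j * N" using ij(3) li unfolding d_def by linarith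
    then show "i = j" using N_pos by simp
  qed
  have A: "finite A" "card A = Suc m" "d \<in> A"
    unfolding A_def by (auto simp: card_image[OF inj] intro!: image_eqI[of _ _ 0])
  have Acl: "int N dvd int a - int l" "a \<le> d" if "a \<in> A" for a
  proof -
    from that obtain j where "j \<in> {..m}" and ja: "a = d - j * N" unfolding A_def by (rule imageE)
    then have j: "j \<le> m" "a = d - j * N" by simp_all
    have "j * N \<le> d" using le[OF j(1)] unfolding d_def by linarith
    then have "int a = int d - int (j * N)" unfolding j(2) by (rule of_nat_diff)
    then have "int a - int l = int N * (int k - int j)" by (simp add: d_def algebra_simps)
    then show "int N dvd int a - int l" by simp
    show "a \<le> d" using j by simp
  qed
  have wnz: "wt d a \<noteq> 0" if "a \<in> A" for a
    using generic_wt(1)[OF gen Acl(1)[OF that]] .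
  have "inj_on (\<lambda>a. (wt d a)\<^sup>2) A"
    using generic_wt(2)[OF gen] Acl by (intro inj_onI) blast
  then obtain c where c: "c d \<noteq> 0" "\<And>r. r < m \<Longrightarrow> (\<Sum>a\<in>A. c a *
      ((wt d a)\<^sup>2) ^ r) = 0"
    using moment_weights_exist[OF A(1) _ A(3,2)] by blast
  \<comment> \<open>Dividing by wt turns the odd moments wt^(2r+1) of \<open>p\<close> into the
    powers (wt^2)^r that \<open>c\<close> annihilates.\<close>
  define p where "p = (\<Sum>a\<in>A. monom (c a / wt d a) a)"
  have cp: "coeff p a = (if a \<in> A then c a / wt d a else 0)" for a
  proof -
    have "coeff p a = (\<Sum>b\<in>A. if b = a then c a / wt d a else 0)"
      unfolding p_def coeff_sum by (intro sum.cong) auto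
    then show ?thesis using A(1) by simp
  qed
  have deg: "degree p \<le> d"
    using Acl(2) by (force simp: degree_le_iff_coeff cp)
  have lamp: "wsum F p = (\<Sum>a\<in>A. c a / wt d a * F a)" for F
  proof -
    have "wsum F p = (\<Sum>a\<le>d. if a \<in> A then c a / wt d a * F a else 0)"
      unfolding wsum_bound[OF deg] by (intro sum.cong) (auto simp: cp)
    also have "\<dots> = (\<Sum>a\<in>{..d} \<inter> A. c a / wt d a * F a)"
      by (simp only: sum.inter_restrict[OF finite_atMost])
    also have "{..d} \<inter> A = A" using Acl(2) by auto
    finally show ?thesis .
  qed
  have "qform d p"
    unfolding qform_def
  proof (intro conjI allI impI deg)
    fix e r assume r: "r < m"
    have e: "int N dvd int a - e \<longleftrightarrow> int N dvd int l - e" if "a \<in> A" for a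
    proof -
      have "int a - e = (int a - int l) + (int l - e)" by simp
      then show ?thesis using Acl(1)[OF that] by (metis dvd_add_right_iff)
    qed
    have "moment d e r p =
       (\<Sum>a\<in>A. (if int N dvd int l - e then 1 else 0) * (c a * ((wt d a)\<^sup>2) ^ r))"
      unfolding lamp using e wnz by (intro sum.cong) (auto simp: power_mult)
    also have "\<dots> = (if int N dvd int l - e then 1 else 0) * (\<Sum>a\<in>A. c a * ((wt d
        a)\<^sup>2) ^ r)"
      by (simp only: sum_distrib_left)
    also have "\<dots> = 0" using c(2)[OF r] by simp
    finally show "moment d e r p = 0" .
  qed
  then have "isotyp d (int l) 0 p"
    using Acl(1) by (auto simp: isotyp_def cp split: if_splits)
  moreover have "coeff p d \<noteq> 0" using A(3) c(1) wnz by (simp add: cp)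
  ultimately show ?thesis unfolding d_def by blast
qed

text \<open>Below the top, the upper half contains only the m exponents jN with m < j \<le> 2m, so
  \<open>antisym_upper_half\<close> applies once the top coefficient is subtracted.\<close>

lemma isotyp_antisym_M:
  assumes "isotyp M 0 (- 1) v"
  shows "v = smult (coeff v M) wpoly"
proof -
  define a where "a = v - smult (coeff v M) wpoly"
  have sw: "swap M v = - v" "swap M wpoly = - wpoly"
    using assms isotyp_wpoly by (simp_all add: isotyp_def)
  have v0: "coeff v 0 = - coeff v M"
    using arg_cong[OF sw(1), of "\<lambda>p. coeff p 0"] by (simp add: coeff_swap)
  have a: "isotyp M 0 (- 1) a"
    unfolding a_def by (intro isotyp_diff isotyp_smult assms isotyp_wpoly)
  define A where "A = {b. M < 2 * b \<and> b < M \<and> N dvd b}"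
  have "A \<subseteq> (\<lambda>j. j * N) ` {m + 1..2 * m}"
  proof
    fix b assume b: "b \<in> A"
    then have "N dvd b" by (simp add: A_def)
    then obtain j where "b = N * j" by (rule dvdE)
    then have j: "b = j * N" by (simp add: mult.commute)
    have "(2 * m + 1) * N < (2 * j) * N" "j * N < (2 * m + 1) * N"
      using b by (simp_all add: A_def j M_def)
    then have "2 * m + 1 < 2 * j" "j < 2 * m + 1"
      using N_pos(1) by (simp_all only: mult_less_cancel2)
    then show "b \<in> (\<lambda>j. j * N) ` {m + 1..2 * m}" using j by auto
  qed
  then have "card A \<le> card ((\<lambda>j. j * N) ` {m + 1..2 * m})"
    by (intro card_mono) auto
  also have "\<dots> \<le> m" using card_image_le[of "{m + 1..2 * m}" "\<lambda>j. j * N"] by simp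
  finally have cA: "card A \<le> m" .
  have "a = 0"
  proof (rule antisym_upper_half[OF a _ _ cA])
    show "b \<in> A" if "coeff a b \<noteq> 0" "M < 2 * b" for b
    proof -
      have "b \<noteq> M" using that coeff_wpoly_ends by (auto simp: a_def)
      moreover have "b \<le> M" using that qform_coeff[OF isotyp_qform[OF a]] by (meson not_le)
      moreover have "N dvd b" using that(1) a by (auto simp: isotyp_def)
      ultimately show ?thesis using that by (simp add: A_def)
    qed
  qed (auto simp: A_def)
  then show ?thesis by (simp add: a_def)
qed

text \<open>\<open>disc\<close> is antisymmetric and (m + 1)N is the middle exponent in degree N +
  M, so only the antisymmetric part of \<open>v\<close> contributes. That part is a multiple of
  \<open>wpoly\<close>, and the product becomes a multiple of
  \<open>disc ^ (2 * m + 2)\<close>.\<close>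

lemma coeff_middle:
  assumes v: "isotyp M 0 0 v" and "coeff v M \<noteq> coeff v 0"
  shows "coeff (disc * v) ((m + 1) * N) \<noteq> 0"
proof -
  have qform: "qform M v" using v by (rule isotyp_qform)
  define \<tau> where "\<tau> = coeff v M - coeff v 0"
  have MN: "int N dvd 2 * 0 - int M" by (simp add: M_def)
  have half: "smult 2 (smult (1/2) (v + smult (- 1) (swap M v))) = v - swap M v"
    by (rule poly_eqI) simp
  have "isotyp M 0 (- 1) (smult 2 (smult (1/2) (v + smult (- 1) (swap M v))))"
    by (rule isotyp_smult[OF isotyp_halves[OF v MN]]) simp
  from this[unfolded half] have "isotyp M 0 (- 1) (v - swap M v)" .
  from isotyp_antisym_M[OF this] have eq: "v - swap M v = smult \<tau> wpoly"
    by (simp add: \<tau>_def coeff_swap)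
  have NM: "N + M = 2 * ((m + 1) * N)" by (simp add: M_def algebra_simps)
  have "coeff (disc * v) ((m + 1) * N) = coeff (swap (N + M) (disc * v)) ((m + 1) * N)"
    unfolding NM by (simp add: coeff_swap mult_2)
  also have "swap (N + M) (disc * v) = - disc * swap M v"
    using swap_mult[OF degree_disc qform_degree[OF qform]] by (simp add: swap_disc)
  finally have "2 * coeff (disc * v) ((m + 1) * N) = coeff (disc * (v - swap M v)) ((m + 1) * N)"
    by (simp add: right_diff_distrib)
  also have "\<dots> = \<tau> * coeff (disc ^ (2 * m + 2)) ((m + 1) * N)"
    unfolding eq wpoly_def by simp
  finally show ?thesis
    using middle_disc_nz assms(2) by (auto simp: \<tau>_def)
qed

lemma pairing_wpoly: "pairing k (fps_of_poly (u * wpoly)) (fps_of_poly h) = coeff (disc * (u * h)) k"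
proof -
  have "wgt_fps * fps_of_poly (u * wpoly) * fps_of_poly h = (wgt_fps * disc_fps ^ (2 * m)) *
      (disc_fps * (fps_of_poly u * fps_of_poly h))"
    by (simp add: fps_of_poly_mult fps_of_poly_wpoly mult_ac)
  also have "\<dots> = fps_of_poly (disc * (u * h))"
    by (simp add: wgt_fps_disc_fps fps_of_poly_mult fps_of_poly_disc)
  finally show ?thesis by (simp add: pairing_def)
qed

text \<open>The test element \<open>h\<close> has the degree M - d of the image and lies in the dual
  class N - l. It is killed by L for reasons of degree, hence it is an eigenvector of
  \<open>ang_op\<close>.\<close>

lemma pif_generic_nonzero:
  assumes l: "0 < l" "l < N" and u: "isotyp (m * N + l) (int l) \<epsilon> u" and nz: "u \<noteq> 0"
  shows "pif (m * N + l) u \<noteq> 0"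
proof
  define d where "d = m * N + l"
  define \<delta> where "\<delta> = (N - l) + m * N"
  assume "pif (m * N + l) u = 0"
  then have L0: "CMiter d (d + M) (u * wpoly) = 0" by (simp add: pif_def d_def)
  have dM: "d + \<delta> = M" using l by (simp add: d_def \<delta>_def M_def algebra_simps)
  then have Md: "M - d = \<delta>" by simp
  obtain h where h: "isotyp \<delta> (int (N - l)) 0 h" "coeff h \<delta> \<noteq> 0"
    using generic_exists[of "N - l" m] l unfolding \<delta>_def by auto
  have nl: "\<not> int N dvd int l" using l by (auto dest: zdvd_imp_le)
  \<comment> \<open>The class of \<open>CMf \<delta> h\<close> requires degree at least mN + N - l -
    1, one more than \<delta> - 2.\<close>
  have Lh: "CMf \<delta> h = 0"
  proof (rule ccontr)
    assume nz: "CMf \<delta> h \<noteq> 0"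
    then have d2: "2 \<le> \<delta>" using CMf_small by (meson not_le)
    have t: "isotyp (\<delta> - 2) (int (N - l) - 1) 0 (CMf \<delta> h)"
      by (rule isotyp_CMf[OF h(1) d2])
    have n: "int (\<delta> - 2) = int (m * N) + (int N - int l) - 2"
      using d2 l by (simp add: \<delta>_def of_nat_diff)
    have e: "int (N - l) - 1 = int N - int l - 1" using l by simp
    have "int l = int N * (1 - int m) - (2 * (int N - int l - 1) - int (\<delta> - 2))"
      unfolding n by (simp add: algebra_simps)
    then have gen: "\<not> int N dvd 2 * (int (N - l) - 1) - int (\<delta> - 2)"
      using nl unfolding e by (metis dvd_diff dvd_triv_left)
    have "int (\<delta> - 2) \<ge> int (m * N) + (int (N - l) - 1) mod int N + (int (\<delta> - 2) -
        (int (N - l) - 1)) mod int N"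
      by (rule generic_gap[OF t gen nz])
    moreover have "(int (N - l) - 1) mod int N = int N - int l - 1" using l by simp
    moreover have "(int (\<delta> - 2) - (int (N - l) - 1)) mod int N \<ge> 0" using N_pos by simp
    ultimately show False unfolding n by linarith
  qed
  have qh: "qform \<delta> h" using h by (auto dest: isotyp_qform)
  have eig: "ang_op (of_nat \<delta>) (fps_of_poly h) = fps_const (- radial (of_nat \<delta>)) *
      fps_of_poly h"
    using CMf_ang_op[OF qh] unfolding Lh by (simp add: eq_neg_iff_add_eq_0 add.commute flip: fps_const_neg)
  have qu: "qform (d + M) (u * wpoly)"
    using qform_mult[OF isotyp_qform[OF u] qform_wpoly] by (simp add: d_def)
  define \<kappa> where "\<kappa> = (m + 1) * N"
  have deg: "(of_nat (d + M) + of_nat \<delta> :: complex) = of_nat (2 * \<kappa>) + 2 * mn"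
  proof -
    have "d + M + \<delta> = 2 * \<kappa> + 2 * (m * N)" using dM by (simp add: \<kappa>_def M_def
        algebra_simps)
    then have "(of_nat (d + M + \<delta>) :: complex) = of_nat (2 * \<kappa> + 2 * (m * N))" by simp
    then show ?thesis by (simp add: mn_def)
  qed
  have "pairing \<kappa> (CMfps d (d + M) (u * wpoly)) (fps_of_poly h) =
     (\<Prod>i<d. radial (of_nat (d + M - 2 * i)) - radial (of_nat \<delta>)) * pairing \<kappa>
         (fps_of_poly (u * wpoly)) (fps_of_poly h)"
    by (rule pairing_CMfps_eigen[OF qu deg eig]) (use dM in simp)
  moreover have "CMfps d (d + M) (u * wpoly) = 0" by (simp add: CMfps_def L0)
  \<comment> \<open>The difference of the two radial factors is (y - \<delta>)(y + \<delta> - 2mN),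
    and y > \<delta> > mN.\<close>
  moreover have "radial (of_nat (d + M - 2 * i)) - radial (of_nat \<delta>) \<noteq> 0" if "i < d" for i
  proof -
    define y where "y = d + M - 2 * i"
    have y: "\<delta> < y" using that dM by (simp add: y_def)
    have "radial (of_nat y) - radial (of_nat \<delta>) = (of_nat y - of_nat \<delta>) * (of_nat (y +
        \<delta>) - of_nat (2 * m * N))"
      by (simp add: radial_def mn_def algebra_simps)
    moreover have "y + \<delta> \<noteq> 2 * m * N" using y l by (simp add: \<delta>_def)
    ultimately show ?thesis
      using y unfolding y_def[symmetric] by (simp only: mult_eq_0_iff right_minus_eq of_nat_eq_iff) simp
  qed
  ultimately have "pairing \<kappa> (fps_of_poly (u * wpoly)) (fps_of_poly h) = 0"
    by (auto simp: pairing_def)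
  then have z: "coeff (disc * (u * h)) ((m + 1) * N) = 0"
    unfolding pairing_wpoly \<kappa>_def .
  have "coeff (u * h) M = coeff u d * coeff h \<delta>"
  proof -
    have "coeff (u * h) M = (\<Sum>i\<le>M. if i = d then coeff u d * coeff h \<delta> else 0)"
      unfolding coeff_mult
    proof (intro sum.cong refl)
      fix i assume "i \<in> {..M}"
      then show "coeff u i * coeff h (M - i) = (if i = d then coeff u d * coeff h \<delta> else 0)"
        using qform_coeff[OF isotyp_qform[OF u], of i] qform_coeff[OF qh, of "M - i"] dM
        by (cases i d rule: linorder_cases) (auto simp: d_def[symmetric] Md)
    qed
    then show ?thesis using dM by simp
  qed
  then have "coeff (u * h) M \<noteq> 0"
    using h(2) minimal_top_coeff(1)[OF u l nz] by (simp add: d_def)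
  moreover have "coeff (u * h) 0 = 0"
    using minimal_top_coeff(2)[OF u l nz] by (simp add: coeff_mult)
  moreover have "isotyp M 0 0 (u * h)"
    unfolding isotyp_def
  proof (intro conjI allI impI)
    show "qform M (u * h)"
      using qform_mult[OF isotyp_qform[OF u] qh] dM by (simp add: d_def)
    fix a assume "coeff (u * h) a \<noteq> 0"
    from coeff_mult_nonzero[OF this] obtain i where i: "i \<le> a" "coeff u i \<noteq> 0" "coeff h
        (a - i) \<noteq> 0" by blast
    have "\<forall>a. coeff h a \<noteq> 0 \<longrightarrow> int N dvd int a - int (N - l)"
      using h(1) unfolding isotyp_def by blast
    then have "int N dvd int (a - i) - int (N - l)" using i(3) by blast
    moreover have "int N dvd int i - int l"
      using u i(2) by (auto simp: isotyp_def)
    ultimately have "int N dvd (int i - int l) + (int (a - i) - int (N - l)) + int N"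
      by (intro dvd_add) simp_all
    then show "int N dvd int a - 0" using i(1) l by (simp add: of_nat_diff)
  qed simp
  ultimately show False using coeff_middle z by simp
qed


section \<open>The image of w_m, and the zero of the radial factor in degree 2mN\<close>

definition mix :: "nat \<Rightarrow> complex fps" where
  "mix k = fps_X ^ ((m - k) * N) * disc_fps ^ (2 * k)"

text \<open>As a form of degree 2mN, \<open>mix k\<close> is (zw)^((m - k)N) (z^N - w^N)^(2k). For k
  = 0 it is constant in the angle.\<close>

lemma ang_op_mix_0: "ang_op (2 * mn) (mix 0) = 0"
proof -
  have "ang_op (of_nat (2 * (m * N)) + 0) (fps_X ^ (m * N) * 1) = fps_X ^ (m * N) * ang_op 0 1"
    by (rule ang_op_X_power)
  moreover have "ang_op 0 1 = 0" by (simp add: ang_op_def ang_fps_1) (simp add: ang_fps_def)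
  ultimately show ?thesis by (simp add: mix_def mn_def)
qed

text \<open>By \<open>sig2_fps_square\<close> the span of the \<open>mix k\<close> is closed under
  \<open>ang_op\<close>, which is bidiagonal on it. The diagonal coefficient vanishes exactly when
  Suc k = m, the other one never.\<close>

lemma ang_op_mix_Suc:
  assumes "k < m"
  shows "ang_op (2 * mn) (mix (Suc k)) =
    fps_const (4 * of_nat N ^ 2 * of_nat (Suc k) * (of_nat m - of_nat (Suc k))) * mix (Suc k) +
    fps_const (8 * of_nat N ^ 2 * of_nat (Suc k) * (2 * of_nat m + 1 - 2 * of_nat (Suc k))) * mix k"
proof -
  define j where "j = Suc k"
  define n where "n = (of_nat N :: complex)"
  define J where "J = (of_nat j :: complex)"
  define E where "E = disc_fps ^ (2 * k)"
  have DDp: "disc_fps ^ (2 * k + 1) = disc_fps * E" "disc_fps ^ (2 * k + 2) = disc_fps * disc_fps * E"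
    by (simp_all add: E_def)
  have nm: "of_nat ((2 * k + 1) * N) = (2 * J - 1) * n" "of_nat ((2 * k + 2) * N) = 2 * J * n"
    by (simp_all add: n_def J_def j_def algebra_simps)
  have d1: "ang_fps ((2 * J - 1) * n) (disc_fps * E) = fps_const ((2 * J - 1) * n) * (sig2_fps * E)"
  proof -
    have "ang_fps ((2 * J - 1) * n) (disc_fps * E) * disc_fps = fps_const ((2 * J - 1) * n) *
        (sig2_fps * E) * disc_fps"
      using ang_fps_disc_fps_power[of "2 * k + 1"] unfolding nm DDp by (simp only: mult_ac)
    then show ?thesis using disc_fps_nz by simp
  qed
  have d2: "ang_fps (2 * J * n) (disc_fps * disc_fps * E) = fps_const (2 * J * n) * (sig2_fps *
      (disc_fps * E))"
  proof -
    have "ang_fps (2 * J * n) (disc_fps * disc_fps * E) * disc_fps = fps_const (2 * J * n) *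
        (sig2_fps * (disc_fps * E)) * disc_fps"
      using ang_fps_disc_fps_power[of "2 * k + 2"] unfolding nm DDp by (simp only: mult_ac)
    then show ?thesis using disc_fps_nz by simp
  qed
  have d3: "ang_fps (2 * J * n) (ang_fps (2 * J * n) (disc_fps * disc_fps * E)) =
     fps_const (2 * J * n) * (fps_const n * (disc_fps * disc_fps * E) + fps_const ((2 * J - 1) * n)
         * (sig2_fps * sig2_fps * E))"
  proof -
    have "2 * J * n = n + (2 * J - 1) * n" by (simp add: algebra_simps)
    then have "ang_fps (2 * J * n) (sig2_fps * (disc_fps * E)) = ang_fps n sig2_fps * (disc_fps * E)
        + sig2_fps * ang_fps ((2 * J - 1) * n) (disc_fps * E)"
      by (simp only: ang_fps_mult)
    then have "ang_fps (2 * J * n) (sig2_fps * (disc_fps * E)) = fps_const n * (disc_fps * disc_fps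
        * E) + fps_const ((2 * J - 1) * n) * (sig2_fps * sig2_fps * E)"
      unfolding d1 ang_fps_sig2_fps[folded n_def] by (simp only: mult_ac)
    then show ?thesis unfolding d2 ang_fps_const by (simp only:)
  qed
  define X where "X = (fps_X ^ N :: complex fps)"
  have SSE: "sig2_fps * sig2_fps * E = disc_fps * disc_fps * E + fps_const 4 * (X * E)"
    unfolding sig2_fps_square X_def by (simp only: algebra_simps)
  have "ang_op (2 * J * n) (disc_fps * disc_fps * E) = - (fps_const (2 * J * n) * (fps_const n *
      (disc_fps * disc_fps * E) + fps_const ((2 * J - 1) * n) * (sig2_fps * sig2_fps * E)))
      + fps_const (2 * mn) * (fps_const (2 * J * n) * (sig2_fps * sig2_fps * E) * (disc_fps *
          inverse disc_fps))"
    unfolding ang_op_def d3 unfolding d2 by (simp only: mult_ac)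
  also have "\<dots> = fps_const (- (2 * J * n * n) - 2 * J * n * ((2 * J - 1) * n) + 2 * mn * (2 *
      J * n)) * (disc_fps * disc_fps * E)
      + fps_const (4 * (2 * mn * (2 * J * n) - 2 * J * n * ((2 * J - 1) * n))) * (X * E)"
    unfolding SSE disc_fps_inv
    unfolding fps_const_mult[symmetric] fps_const_add[symmetric] fps_const_sub[symmetric]
        fps_const_neg[symmetric]
      fps_const_1_eq_1
    by algebra
  also have "- (2 * J * n * n) - 2 * J * n * ((2 * J - 1) * n) + 2 * mn * (2 * J * n) = 4 * n ^ 2 *
      J * (of_nat m - J)"
    by (simp add: mn_def n_def power2_eq_square algebra_simps)
  also have "4 * (2 * mn * (2 * J * n) - 2 * J * n * ((2 * J - 1) * n)) = 8 * n ^ 2 * J * (2 *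
      of_nat m + 1 - 2 * J)"
    by (simp add: mn_def n_def power2_eq_square algebra_simps)
  finally have A: "ang_op (2 * J * n) (disc_fps * disc_fps * E) =
     fps_const (4 * n ^ 2 * J * (of_nat m - J)) * (disc_fps * disc_fps * E) + fps_const (8 * n ^ 2 *
         J * (2 * of_nat m + 1 - 2 * J)) * (X * E)" .
  define Y where "Y = (fps_X ^ ((m - Suc k) * N) :: complex fps)"
  have hj: "mix (Suc k) = Y * (disc_fps * disc_fps * E)"
    by (simp add: mix_def Y_def E_def)
  have "m - k = Suc (m - Suc k)" using assms by simp
  then have "(m - k) * N = (m - Suc k) * N + N"
    by (simp only: mult_Suc add.commute)
  then have hk: "mix k = Y * (X * E)"
    by (simp add: mix_def Y_def X_def E_def power_add mult.assoc)
  have "2 * mn = of_nat (2 * ((m - Suc k) * N)) + 2 * J * n"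
  proof -
    have "m * N = (m - Suc k) * N + Suc k * N"
      using assms by (simp flip: distrib_right del: mult_Suc)
    then have "2 * (m * N) = 2 * ((m - Suc k) * N) + 2 * Suc k * N"
      by (simp only: distrib_left mult.assoc)
    then have "(of_nat (2 * (m * N)) :: complex) = of_nat (2 * ((m - Suc k) * N) + 2 * Suc k * N)"
      by (simp only:)
    then show ?thesis by (simp add: mn_def J_def j_def n_def algebra_simps)
  qed
  then have "ang_op (2 * mn) (mix (Suc k)) = Y * ang_op (2 * J * n) (disc_fps * disc_fps * E)"
    unfolding hj Y_def by (simp only: ang_op_X_power)
  then show ?thesis
    unfolding A hj hk J_def[symmetric, unfolded j_def] n_def[symmetric] by (simp only: algebra_simps)
qed

text \<open>
  The radial factor vanishes in degree \<open>2mN\<close>, so pairing with the constants cannot detect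
  \<open>\<pi>\<^sub>m(w\<^sub>m)\<close>; a generalised eigenvector over the constants does.
\<close>

lemma generalised_eigenvector:
  assumes "m > 0"
  shows "\<exists>g \<rho>. \<rho> \<noteq> 0 \<and> ang_op (2 * mn) g = fps_const \<rho> * mix 0"
proof -
  define b where "b k = 8 * of_nat N ^ 2 * of_nat (Suc k) * (2 * of_nat m + 1 - 2 * of_nat (Suc k)
      :: complex)" for k
  define a where "a k = 4 * of_nat N ^ 2 * of_nat (Suc k) * (of_nat m - of_nat (Suc k) :: complex)" for k
  have b: "b k \<noteq> 0" for k
  proof -
    have "2 * m + 1 \<noteq> 2 * Suc k" by presburger
    then have "(of_nat (2 * m + 1) :: complex) \<noteq> of_nat (2 * Suc k)"
      using of_nat_eq_iff[where 'a = complex] by blast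
    moreover have "2 * of_nat m + 1 - 2 * of_nat (Suc k) = (of_nat (2 * m + 1) - of_nat (2 * Suc k)
        :: complex)"
      by (simp only: of_nat_add of_nat_mult of_nat_1 of_nat_numeral)
    ultimately have "2 * of_nat m + 1 - 2 * of_nat (Suc k) \<noteq> (0 :: complex)"
      by (metis right_minus_eq)
    moreover have "(of_nat (Suc k) :: complex) \<noteq> 0" by (rule of_nat_neq_0)
    ultimately show ?thesis using N_pos(1) unfolding b_def by (simp del: of_nat_Suc)
  qed
  have step: "ang_op (2 * mn) (mix (Suc k)) = fps_const (a k) * mix (Suc k) + fps_const (b k) * mix
      k" if "k < m" for k
    unfolding a_def b_def by (rule ang_op_mix_Suc[OF that])
  \<comment> \<open>Modulo the image of \<open>ang_op\<close>, each \<open>mix k\<close> with k < m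
    is a nonzero multiple of \<open>mix 0\<close>, since the diagonal entries can be inverted up to
    there.\<close>
  have red: "\<exists>g \<rho>. \<rho> \<noteq> 0 \<and> mix k = ang_op (2 * mn) g + fps_const
      \<rho> * mix 0" if "k < m" for k
    using that
  proof (induction k)
    case 0
    show ?case by (rule exI[of _ 0], rule exI[of _ 1]) simp
  next
    case (Suc k)
    obtain g \<rho> where g: "\<rho> \<noteq> 0" "mix k = ang_op (2 * mn) g + fps_const \<rho> * mix 0"
      using Suc by auto
    have ak: "a k \<noteq> 0"
    proof -
      have "(of_nat m :: complex) \<noteq> of_nat (Suc k)" using Suc.prems by (metis nat_neq_iff
          of_nat_eq_iff)
      moreover have "(of_nat (Suc k) :: complex) \<noteq> 0" by (rule of_nat_neq_0)
      ultimately show ?thesis using N_pos(1) unfolding a_def by (simp del: of_nat_Suc)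
    qed
    have "fps_const (inverse (a k)) * ang_op (2 * mn) (mix (Suc k)) =
        fps_const (inverse (a k)) * (fps_const (a k) * mix (Suc k)) + fps_const (inverse (a k)) *
            (fps_const (b k) * mix k)"
      using step[of k] Suc.prems by (simp add: distrib_left)
    also have "fps_const (inverse (a k)) * (fps_const (a k) * mix (Suc k)) = mix (Suc k)"
      using ak by (simp flip: mult.assoc)
    also have "fps_const (inverse (a k)) * (fps_const (b k) * mix k) = fps_const (inverse (a k) * b
        k) * mix k"
      by (simp flip: mult.assoc)
    finally have "mix (Suc k) = fps_const (inverse (a k)) * ang_op (2 * mn) (mix (Suc k)) -
        fps_const (inverse (a k) * b k) * mix k"
      by simp
    also have "\<dots> = ang_op (2 * mn) (fps_const (inverse (a k)) * mix (Suc k) + fps_const (-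
        (inverse (a k) * b k)) * g)
        + fps_const (- (inverse (a k) * b k)) * (fps_const \<rho> * mix 0)"
      unfolding g(2) ang_op_add ang_op_const unfolding fps_const_neg[symmetric] by algebra
    finally have "mix (Suc k) = ang_op (2 * mn) (fps_const (inverse (a k)) * mix (Suc k) + fps_const
        (- (inverse (a k) * b k)) * g)
        + fps_const (- (inverse (a k) * b k) * \<rho>) * mix 0"
      by (simp add: mult.assoc flip: fps_const_mult fps_const_neg)
    moreover have "- (inverse (a k) * b k) * \<rho> \<noteq> 0" using ak b g(1) by simp
    ultimately show ?case by blast
  qed
  obtain k where k: "m = Suc k" using assms by (cases m) auto
  obtain g \<rho> where g: "\<rho> \<noteq> 0" "mix k = ang_op (2 * mn) g + fps_const \<rho> * mix 0"
    using red[of k] k by auto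
  \<comment> \<open>At the last index the diagonal entry is 0, so \<open>ang_op\<close> maps
    \<open>mix m\<close> to a multiple of \<open>mix k\<close> alone, and the reduction leads down
    to the constants.\<close>
  have "a k = 0" using k by (simp add: a_def)
  then have "ang_op (2 * mn) (mix m) = fps_const (b k) * (ang_op (2 * mn) g + fps_const \<rho> * mix 0)"
    using step[of k] k g(2) by simp
  then have "ang_op (2 * mn) (mix m + fps_const (- b k) * g) = fps_const (b k * \<rho>) * mix 0"
    unfolding ang_op_add ang_op_const by (simp add: algebra_simps flip: fps_const_mult fps_const_neg)
  then show ?thesis using b g(1) by (intro exI[of _ "mix m + fps_const (- b k) * g"] exI[of _ "b k *
      \<rho>"]) auto
qed

lemma pif_wpoly_nonzero: "pif M wpoly \<noteq> 0"
proof
  assume "pif M wpoly = 0"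
  then have L0: "CMiter M (M + M) (wpoly * wpoly) = 0" by (simp add: pif_def)
  define n where "n = M + M"
  define e where "e = mix 0"
  define P where "P k = CMfps k n (wpoly * wpoly)" for k
  \<comment> \<open>After \<open>k0\<close> steps the degree has dropped from 2M to 2mN, the zero of
    the radial factor.\<close>
  define k0 where "k0 = M - m * N"
  have PM: "P M = 0" by (simp add: P_def CMfps_def n_def L0)
  have mM: "m * N \<le> M" by (simp add: M_def)
  have qform: "qform n (wpoly * wpoly)" unfolding n_def by (intro qform_mult qform_wpoly)
  have deg: "of_nat n + 2 * mn = of_nat (2 * M) + 2 * mn" by (simp add: n_def)
  have eig: "ang_op (2 * mn) e = fps_const (- 0) * e" using ang_op_mix_0 by (simp add: e_def)
  have y: "radial (of_nat (n - 2 * i)) \<noteq> 0 \<longleftrightarrow> i \<noteq> k0" if "i < M" for i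
  proof -
    have "radial (of_nat (n - 2 * i)) = of_nat (n - 2 * i) * (of_nat (n - 2 * i) - of_nat (2 * (m * N)))"
      by (simp add: radial_def mn_def)
    moreover have "n - 2 * i \<noteq> 0" using that by (simp add: n_def)
    moreover have "n - 2 * i = 2 * (m * N) \<longleftrightarrow> i = k0"
      using that mM unfolding n_def k0_def by linarith
    ultimately show ?thesis
      by (simp only: mult_eq_0_iff right_minus_eq of_nat_eq_iff of_nat_eq_0_iff) simp
  qed
  have e_chain: "pairing M (P k) e = (\<Prod>i<k. radial (of_nat (n - 2 * i))) * pairing M
      (fps_of_poly (wpoly * wpoly)) e" if "k \<le> M" for k
    using pairing_CMfps_eigen[OF qform deg eig, of k] that unfolding P_def n_def by simp
  have e0: "pairing M (fps_of_poly (wpoly * wpoly)) e \<noteq> 0"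
  proof -
    have "e = fps_of_poly (monom 1 (m * N))"
      by (simp add: e_def mix_def fps_of_poly_monom)
    then have "pairing M (fps_of_poly (wpoly * wpoly)) e = coeff (monom 1 (m * N) * disc ^ (2 * m + 2)) M"
      by (simp only: pairing_wpoly) (simp add: wpoly_def mult_ac)
    also have "\<dots> = coeff (disc ^ (2 * m + 2)) ((m + 1) * N)"
    proof -
      have "M = (m + 1) * N + m * N" by (simp add: M_def algebra_simps)
      then have "M - m * N = (m + 1) * N" by (metis diff_add_inverse2)
      moreover have "\<not> M < m * N" using mM by simp
      ultimately show ?thesis
        by (simp only: coeff_monom_mult if_False mult_1_left)
    qed
    finally show ?thesis using middle_disc_nz by simp
  qed
  have k0M: "k0 \<le> M" by (simp add: k0_def)
  have ek0: "pairing M (P k0) e \<noteq> 0"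
    unfolding e_chain[OF k0M] using e0 y k0M by (auto simp: prod_zero_iff)
  show False
  proof (cases "m = 0")
    case True
    \<comment> \<open>The zero factor would enter only after the last step, so the pairing with
      \<open>e\<close> already suffices.\<close>
    then have "k0 = M" by (simp add: k0_def)
    then show False using ek0 PM by (simp add: pairing_def)
  next
    case False
    then have k0l: "k0 < M" using N_pos by (simp add: k0_def M_def)
    obtain g \<rho> where g: "\<rho> \<noteq> 0" "ang_op (2 * mn) g = fps_const \<rho> * e"
      using generalised_eigenvector False unfolding e_def by blast
    \<comment> \<open>At \<open>k0\<close> the radial factor removes the unknown pairing with
      \<open>g\<close> and leaves a nonzero multiple of the pairing with \<open>e\<close>. From then
      on the pairing with \<open>e\<close> is 0 and the remaining radial factors are not.\<close>
    have step: "pairing M (P (Suc k)) g = radial (of_nat (n - 2 * k)) * pairing M (P k) g + \<rho> *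
        pairing M (P k) e" if "k \<le> M" for k
    proof -
      have "2 * k \<le> n" using that by (simp add: n_def)
      then show ?thesis
        unfolding P_def
        by (simp only: CMfps_Suc[OF qform] pairing_linear pairing_selfadjoint[OF deg] g(2))
    qed
    have later: "pairing M (P k) e = 0" if "k0 < k" "k \<le> M" for k
      unfolding e_chain[OF that(2)] using that y[OF k0l] by (auto simp: prod_zero_iff)
    have "pairing M (P (Suc k0 + i)) g \<noteq> 0" if "Suc k0 + i \<le> M" for i
      using that
    proof (induction i)
      case 0
      then show ?case using step[OF k0M] y[OF k0l] ek0 g(1) by simp
    next
      case (Suc i)
      then show ?case
        using step[of "Suc k0 + i"] later[of "Suc k0 + i"] y[of "Suc k0 + i"] by simp
    qed
    from this[of "M - Suc k0"] have "pairing M (P M) g \<noteq> 0" using k0l by simp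
    then show False using PM by (simp add: pairing_def)
  qed
qed

lemma swap_CMiter:
  assumes "qform n u" "2 * k \<le> n"
  shows "CMiter k n (swap n u) = swap (n - 2 * k) (CMiter k n u)"
  using assms(2)
proof (induction k)
  case (Suc k)
  define j where "j = n - 2 * k"
  define v where "v = CMiter k n u"
  have j2: "2 \<le> j" using Suc.prems by (simp add: j_def)
  have v: "qform j v" unfolding j_def v_def by (rule qform_CMiter[OF assms(1)])
  have "pCons 0 (CMf j (swap j v)) = swap (j - 2 + 2) (pCons 0 (CMf j v))"
    using swap_t_CMf[OF v] j2 by (metis le_add_diff_inverse2)
  also have "\<dots> = pCons 0 (swap (j - 2) (CMf j v))"
    by (rule swap_pCons[OF degree_CMf])
  finally have "CMf j (swap j v) = swap (j - 2) (CMf j v)" by simp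
  then show ?case using Suc by (simp add: j_def v_def)
qed simp

text \<open>The reflection commutes with L and negates w_m, so the kernel is stable under
  it.\<close>

lemma pif_swap:
  assumes "qform d u" "pif d u = 0"
  shows "pif d (swap d u) = 0"
proof (cases "M < d")
  case False
  have "swap M wpoly = - wpoly" using isotyp_wpoly by (simp add: isotyp_def)
  then have "swap d u * wpoly = smult (- 1) (swap (d + M) (u * wpoly))"
    using swap_mult[OF qform_degree[OF assms(1)] degree_wpoly] by simp
  then have "pif d (swap d u) = smult (- 1) (CMiter d (d + M) (swap (d + M) (u * wpoly)))"
    by (simp only: pif_def CMiter_smult)
  also have "CMiter d (d + M) (swap (d + M) (u * wpoly)) = swap (d + M - 2 * d) (pif d u)"
    unfolding pif_def using False by (intro swap_CMiter qform_mult assms qform_wpoly) simp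
  finally show ?thesis using assms(2) by simp
qed (rule pif_large)

subsection \<open>The kernel\<close>

text \<open>Membership of \<open>form d u\<close> in the ideal, with homogeneous cofactors.\<close>

definition in_ideal :: "nat \<Rightarrow> complex poly \<Rightarrow> bool" where
  "in_ideal d u \<longleftrightarrow> (\<exists>p q. (p = 0 \<or> 2 \<le> d \<and> qform (d - 2) p)
      \<and> (q = 0 \<or> N \<le> d \<and> qform (d - N) q) \<and>
     u = pCons 0 p + q * sig2)"

lemma inJI:
  "p = 0 \<or> 2 \<le> d \<and> qform (d - 2) p \<Longrightarrow> q = 0 \<or> N \<le> d \<and> qform
      (d - N) q \<Longrightarrow> u = pCons 0 p + q * sig2 \<Longrightarrow> in_ideal d u"
  unfolding in_ideal_def by blast

lemma in_ideal_0 [simp]: "in_ideal d 0"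
  by (rule inJI[of 0 _ 0]) simp_all

lemma in_ideal_t: "2 \<le> d \<Longrightarrow> qform (d - 2) p \<Longrightarrow> in_ideal d (pCons 0 p)"
  by (rule inJI[of p _ 0]) simp_all

lemma in_ideal_sig2: "N \<le> d \<Longrightarrow> qform (d - N) q \<Longrightarrow> in_ideal d (q * sig2)"
  by (rule inJI[of 0 _ q]) simp_all

lemma in_ideal_add:
  assumes "in_ideal d u" "in_ideal d v"
  shows "in_ideal d (u + v)"
proof -
  obtain p q where 1: "p = 0 \<or> 2 \<le> d \<and> qform (d - 2) p" "q = 0 \<or> N \<le> d \<and>
      qform (d - N) q" "u = pCons 0 p + q * sig2"
    using assms(1) unfolding in_ideal_def by blast
  obtain p' q' where 2: "p' = 0 \<or> 2 \<le> d \<and> qform (d - 2) p'" "q' = 0 \<or> N \<le> d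
      \<and> qform (d - N) q'" "v = pCons 0 p' + q' * sig2"
    using assms(2) unfolding in_ideal_def by blast
  have "u + v = pCons 0 (p + p') + (q + q') * sig2"
    using 1(3) 2(3) by (simp add: algebra_simps flip: add_pCons[of 0 p 0 p', simplified])
  moreover have "p + p' = 0 \<or> 2 \<le> d \<and> qform (d - 2) (p + p')"
    using 1(1) 2(1) by (auto intro: qform_add)
  moreover have "q + q' = 0 \<or> N \<le> d \<and> qform (d - N) (q + q')"
    using 1(2) 2(2) by (auto intro: qform_add)
  ultimately show ?thesis by (intro inJI)
qed

lemma in_ideal_sum: "(\<And>a. a \<in> A \<Longrightarrow> in_ideal d (f a)) \<Longrightarrow>
    in_ideal d (sum f A)"
  by (induction A rule: infinite_finite_induct) (auto intro: in_ideal_add)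

lemma in_ideal_qform:
  assumes "in_ideal d u"
  shows "qform d u"
proof -
  obtain p q where 1: "p = 0 \<or> 2 \<le> d \<and> qform (d - 2) p" "q = 0 \<or> N \<le> d \<and>
      qform (d - N) q" "u = pCons 0 p + q * sig2"
    using assms(1) unfolding in_ideal_def by blast
  have "qform d (pCons 0 p)"
    using 1(1) qform_t[of p "d - 2"] qform_degree[of "d - 2" p] by (metis le_add_diff_inverse2
        pCons_0_0 qform_0)
  moreover have "qform d (q * sig2)"
    using 1(2) qform_mult[OF _ qform_sig2, of "d - N" q] by auto
  ultimately show ?thesis using 1(3) qform_add by simp
qed

lemma in_ideal_smult:
  assumes "in_ideal d u"
  shows "in_ideal d (smult c u)"
proof -
  obtain p q where 1: "p = 0 \<or> 2 \<le> d \<and> qform (d - 2) p" "q = 0 \<or> N \<le> d \<and>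
      qform (d - N) q" "u = pCons 0 p + q * sig2"
    using assms(1) unfolding in_ideal_def by blast
  show ?thesis
    by (rule inJI[of "smult c p" _ "smult c q"]) (use 1 in \<open>auto intro: qform_smult simp:
        smult_add_right\<close>)
qed

lemma in_ideal_swap:
  assumes "in_ideal d u"
  shows "in_ideal d (swap d u)"
proof -
  obtain p q where 1: "p = 0 \<or> 2 \<le> d \<and> qform (d - 2) p" "q = 0 \<or> N \<le> d \<and>
      qform (d - N) q" "u = pCons 0 p + q * sig2"
    using assms(1) unfolding in_ideal_def by blast
  have "in_ideal d (swap d (pCons 0 p))"
  proof (cases "p = 0")
    case False
    then have p: "2 \<le> d" "qform (d - 2) p" using 1 by auto
    have "swap d (pCons 0 p) = pCons 0 (swap (d - 2) p)"
      using swap_pCons[OF qform_degree[OF p(2)]] p(1) by (metis le_add_diff_inverse2)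
    then show ?thesis using in_ideal_t[OF p(1) qform_swap[OF p(2)]] by simp
  qed simp
  moreover have "in_ideal d (swap d (q * sig2))"
  proof (cases "q = 0")
    case False
    then have q: "N \<le> d" "qform (d - N) q" using 1 by auto
    have "swap (d - N + N) (q * sig2) = swap (d - N) q * swap N sig2"
      by (rule swap_mult[OF qform_degree[OF q(2)] degree_sig2])
    then show ?thesis using q in_ideal_sig2[OF q(1) qform_swap[OF q(2)]] isotyp_sig2 by (simp add: isotyp_def)
  qed simp
  ultimately show ?thesis using 1(3) by (simp add: swap_add in_ideal_add)
qed

lemma pif_in_ideal:
  assumes "in_ideal d u"
  shows "pif d u = 0"
proof -
  obtain p q where 1: "p = 0 \<or> 2 \<le> d \<and> qform (d - 2) p" "q = 0 \<or> N \<le> d \<and>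
      qform (d - N) q" "u = pCons 0 p + q * sig2"
    using assms(1) unfolding in_ideal_def by blast
  have "pif d (pCons 0 p) = 0"
    using 1(1) kill_t[of "d - 2" p] unfolding pif_def by (metis CMiter_0 le_add_diff_inverse2
        mult_zero_left pCons_0_0)
  moreover have "pif d (q * sig2) = 0"
    using 1(2) kill_sig2[of "d - N" q] unfolding pif_def by (metis CMiter_0 le_add_diff_inverse2
        mult_zero_left)
  ultimately show ?thesis using 1(3) pif_add by simp
qed

lemma in_ideal_ends_vanish: "qform d u \<Longrightarrow> coeff u 0 = 0 \<Longrightarrow> coeff u d =
    0 \<Longrightarrow> in_ideal d u"
  using qform_pCons_cancel[of d u] in_ideal_t by force

lemma coeff_mult_sig2: "coeff (p * sig2) a = (if N \<le> a then coeff p (a - N) else 0) + coeff p a"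
  by (simp add: sig2_def distrib_left coeff_monom_mult mult.commute[of p])

text \<open>In the lowest degree mN + l the kernel condition is contradicted. Above it, a multiple
  of sigma_2 removes the top coefficient; 0 is not an exponent of the class, so the rest is
  divisible by sigma_1.\<close>

lemma kernel_generic_top:
  assumes u: "isotyp d e \<epsilon> u" and gen: "\<not> int N dvd 2 * e - int d" and pi: "pif d u =
      0" and top: "coeff u d \<noteq> 0"
  shows "in_ideal d u"
proof -
  have qform: "qform d u" by (rule isotyp_qform[OF u])
  define l where "l = d mod N"
  define k where "k = d div N"
  have d: "d = l + k * N" by (simp add: l_def k_def)
  have lN: "l < N" using N_pos by (simp add: l_def)
  have de: "int N dvd int d - e" using u top unfolding isotyp_def by blast
  have l0: "0 < l"
  proof (rule ccontr)
    assume "\<not> 0 < l"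
    then have "int N dvd int d" using d by simp
    then have "int N dvd int d - 2 * (int d - e)" by (rule dvd_diff[OF _ dvd_mult[OF de]])
    then show False using gen by (simp add: algebra_simps)
  qed
  have nl: "\<not> int N dvd int l" using l0 lN by (auto dest: zdvd_imp_le)
  have el: "int N dvd e - int l"
  proof -
    have "e - int l = int N * int k - (int d - e)" by (simp add: d algebra_simps)
    then show ?thesis using de by (metis dvd_diff dvd_triv_left)
  qed
  have ul: "isotyp d (int l) \<epsilon> u" by (rule isotyp_cong[OF u el])
  have c0: "coeff v 0 = 0" if "isotyp n (int l) \<delta> v" for v n \<delta>
  proof (rule ccontr)
    assume "coeff v 0 \<noteq> 0"
    then have "int N dvd int 0 - int l" using that unfolding isotyp_def by blast
    then show False using nl by simp
  qed
  have "u \<noteq> 0" using top by auto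
  have gen': "\<not> int N dvd 2 * int l - int d"
  proof
    assume "int N dvd 2 * int l - int d"
    moreover have "2 * int l - int d = int l - int N * int k" by (simp add: d algebra_simps)
    ultimately have "int N dvd int l" by (metis diff_add_cancel dvd_add dvd_triv_left)
    then show False using nl by simp
  qed
  have "int d \<ge> int (m * N) + int l mod int N + (int d - int l) mod int N"
    by (rule generic_gap[OF ul gen' \<open>u \<noteq> 0\<close>])
  moreover have "int l mod int N = int l" using lN by simp
  moreover have "0 \<le> (int d - int l) mod int N" using N_pos by simp
  ultimately have "int (m * N) \<le> int (k * N)" unfolding d of_nat_add by linarith
  then have "m * N \<le> k * N" by (simp only: of_nat_le_iff)
  then have mk: "m \<le> k" using N_pos(1) by simp
  show ?thesis
  proof (cases "m = k")
    case True
    then have "d = m * N + l" using d by simp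
    then show ?thesis
      using pif_generic_nonzero[OF l0 lN, of \<epsilon> u] ul pi \<open>u \<noteq> 0\<close> by simp
  next
    case False
    then have k1: "m \<le> k - 1" "k = Suc (k - 1)" using mk by auto
    obtain p where p: "isotyp (l + (k - 1) * N) (int l) 0 p" "coeff p (l + (k - 1) * N) \<noteq> 0"
      using generic_exists[OF l0 lN k1(1)] by blast
    have "k * N = N + (k - 1) * N" using k1(2) by (metis mult_Suc)
    then have dN: "d - N = l + (k - 1) * N" "N \<le> d" using d by auto
    have qp: "qform (d - N) p" using isotyp_qform[OF p(1)] dN by simp
    define c where "c = coeff u d / coeff p (d - N)"
    have "coeff p d = 0" using qform_coeff[OF qp, of d] dN N_pos by simp
    then have cd: "coeff (smult c (p * sig2)) d = coeff u d"
      using p(2) dN by (simp add: coeff_mult_sig2 c_def)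
    have cz: "coeff (smult c (p * sig2)) 0 = 0"
      using c0[OF p(1)] N_pos by (simp add: coeff_mult_sig2)
    have J: "in_ideal d (smult c (p * sig2))"
      by (intro in_ideal_smult in_ideal_sig2 dN qp)
    have "in_ideal d (u - smult c (p * sig2))"
      using cd cz c0[OF ul] by (intro in_ideal_ends_vanish qform_diff qform in_ideal_qform[OF J]) simp_all
    from in_ideal_add[OF this J] show ?thesis by simp
  qed
qed

text \<open>A nonzero bottom coefficient becomes a top coefficient under the reflection, which
  preserves both kernel and ideal.\<close>

lemma kernel_generic:
  assumes u: "isotyp d e 0 u" and gen: "\<not> int N dvd 2 * e - int d" and pi: "pif d u = 0"
  shows "in_ideal d u"
proof -
  have qform: "qform d u" by (rule isotyp_qform[OF u])
  consider "coeff u d \<noteq> 0" | "coeff u 0 \<noteq> 0" | "coeff u d = 0" "coeff u 0 = 0" by blast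
  then show ?thesis
  proof cases
    case 1
    then show ?thesis using kernel_generic_top[OF u gen pi] by simp
  next
    case 2
    have sw: "isotyp d (int d - e) 0 (swap d u)"
      unfolding isotyp_def
    proof (intro conjI allI impI qform_swap qform)
      fix a assume "coeff (swap d u) a \<noteq> 0"
      then have a: "a \<le> d" "coeff u (d - a) \<noteq> 0" by (auto simp: coeff_swap split: if_splits)
      have "int N dvd int (d - a) - e" using u a(2) unfolding isotyp_def by blast
      then have "int N dvd - (int (d - a) - e)" by (simp only: dvd_minus_iff)
      then show "int N dvd int a - (int d - e)" using a(1) by (simp add: of_nat_diff algebra_simps)
    qed simp
    have gen': "\<not> int N dvd 2 * (int d - e) - int d"
    proof
      assume "int N dvd 2 * (int d - e) - int d"
      then have "int N dvd - (2 * (int d - e) - int d)" by (simp only: dvd_minus_iff)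
      then show False using gen by (simp add: algebra_simps)
    qed
    have "coeff (swap d u) d \<noteq> 0" using 2 by (simp add: coeff_swap)
    then have "in_ideal d (swap d u)"
      by (rule kernel_generic_top[OF sw gen' pif_swap[OF qform pi]])
    from in_ideal_swap[OF this] show ?thesis by (simp add: swap_swap[OF qform_degree[OF qform]])
  next
    case 3
    then show ?thesis using in_ideal_ends_vanish[OF qform] by simp
  qed
qed

lemma sig2_power_ends: "coeff (sig2 ^ k) (k * N) = 1" "coeff (sig2 ^ k) 0 = 1" "swap (k * N) (sig2 ^
    k) = sig2 ^ k"
proof -
  have sw: "swap (k * N) (sig2 ^ k) = sig2 ^ k" for k
  proof (induction k)
    case (Suc k)
    have "swap (N + k * N) (sig2 * sig2 ^ k) = swap N sig2 * swap (k * N) (sig2 ^ k)"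
      by (rule swap_mult[OF degree_sig2 qform_degree[OF qform_power[OF qform_sig2]]])
    then show ?case using Suc isotyp_sig2 by (simp add: isotyp_def)
  qed (simp add: swap_1)
  then show "swap (k * N) (sig2 ^ k) = sig2 ^ k" .
  show c0: "coeff (sig2 ^ k) 0 = 1"
    using N_pos by (simp add: sig2_def coeff_0_power)
  show "coeff (sig2 ^ k) (k * N) = 1"
    using arg_cong[OF sw[of k], of "\<lambda>p. coeff p 0"] c0 by (simp add: coeff_swap)
qed

text \<open>A nonzero end coefficient forces d = kN. The ends of the symmetric part are matched by
  sigma_2^k, those of the antisymmetric part by sigma_2^i w_m. For i > 0 the latter is a multiple of
  sigma_2; for i = 0 its coefficient is 0 by \<open>pif_wpoly_nonzero\<close>.\<close>

lemma kernel_special: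
  assumes u: "isotyp d e 0 u" and e: "int N dvd 2 * e - int d" and pi: "pif d u = 0"
  shows "in_ideal d u"
proof (cases "coeff u 0 = 0 \<and> coeff u d = 0")
  case True
  then show ?thesis using in_ideal_ends_vanish[OF isotyp_qform[OF u]] by simp
next
  case False
  have qform: "qform d u" by (rule isotyp_qform[OF u])
  have "int N dvd int d"
  proof (cases "coeff u 0 = 0")
    case True
    then have "coeff u d \<noteq> 0" using False by simp
    then have "int N dvd int d - e" using u unfolding isotyp_def by blast
    then have "int N dvd 2 * (int d - e) + (2 * e - int d)"
      by (rule dvd_add[OF dvd_mult e])
    then show ?thesis by (simp add: algebra_simps)
  next
    case False
    then have "int N dvd int 0 - e" using u unfolding isotyp_def by blast
    then have "int N dvd - 2 * (int 0 - e) - (2 * e - int d)"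
      by (rule dvd_diff[OF dvd_mult e])
    then show ?thesis by (simp add: algebra_simps)
  qed
  then have "N dvd d" by simp
  then obtain k where "d = N * k" by (rule dvdE)
  then have d: "d = k * N" by (simp add: mult.commute)
  show ?thesis
  proof (cases "k = 0")
    case True
    \<comment> \<open>In degree 0 no L is applied, so \<open>pif 0 u\<close> is the product
      itself.\<close>
    then have "u * wpoly = 0" using pi d by (simp add: pif_def)
    moreover have "wpoly \<noteq> 0" using disc_nz by (simp add: wpoly_def)
    ultimately show ?thesis by simp
  next
    case False
    then obtain j where j: "k = Suc j" by (cases k) auto
    have dN: "N \<le> d" "d - N = j * N" "0 < d" using d j N_pos by auto
    define s where "s = smult (1/2) (u + smult 1 (swap d u))"
    define a where "a = smult (1/2) (u + smult (- 1) (swap d u))"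
    have s: "isotyp d e 1 s" unfolding s_def by (rule isotyp_halves[OF u e]) simp
    have a: "isotyp d e (- 1) a" unfolding a_def by (rule isotyp_halves[OF u e]) simp
    have u_sa: "u = s + a" by (rule poly_eqI) (simp add: s_def a_def field_simps)
    have Js: "in_ideal d s"
    proof -
      define c where "c = coeff s d"
      have "coeff (swap d s) 0 = coeff s 0" using s by (simp add: isotyp_def)
      then have s0: "coeff s 0 = c" by (simp add: coeff_swap c_def)
      have J: "in_ideal d (smult c (sig2 ^ j * sig2))"
        using dN by (intro in_ideal_smult in_ideal_sig2) (simp_all add: qform_power[OF qform_sig2])
      have "sig2 ^ j * sig2 = sig2 ^ k" by (simp add: j mult.commute)
      then have "coeff (smult c (sig2 ^ j * sig2)) d = c" "coeff (smult c (sig2 ^ j * sig2)) 0 = c"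
        using sig2_power_ends[of k] d by simp_all
      then have "in_ideal d (s - smult c (sig2 ^ j * sig2))"
        using s0 by (intro in_ideal_ends_vanish qform_diff isotyp_qform[OF s] in_ideal_qform[OF J])
            (simp_all add: c_def)
      from in_ideal_add[OF this J] show ?thesis by simp
    qed
    have Ja: "in_ideal d a"
    proof (cases "k < 2 * m + 1")
      case True
      have "a = 0"
      proof (rule ccontr)
        assume "a \<noteq> 0"
        then have "int d \<ge> int ((2 * m + 1) * N) + 2 * (e mod int N)"
          using antisym_gap[OF a e] by simp
        moreover have "0 \<le> e mod int N" using N_pos by simp
        ultimately have "int ((2 * m + 1) * N) \<le> int (k * N)" unfolding d by linarith
        then have "(2 * m + 1) * N \<le> k * N" by (simp only: of_nat_le_iff)
        then have "2 * m + 1 \<le> k" using N_pos(1) by (simp only: mult_le_cancel2)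
        then show False using True by simp
      qed
      then show ?thesis by simp
    next
      case False
      define i where "i = k - (2 * m + 1)"
      have k: "k = i + (2 * m + 1)" using False by (simp add: i_def)
      have diM: "d = i * N + M" by (simp add: d k M_def algebra_simps)
      define q where "q = sig2 ^ i * wpoly"
      have qq: "qform d q" unfolding q_def diM by (intro qform_mult qform_power qform_sig2 qform_wpoly)
      have q0: "coeff q 0 = - 1"
        using sig2_power_ends(2)[of i] coeff_wpoly_ends by (simp add: q_def coeff_mult)
      have qswp: "swap d q = - q"
      proof -
        have "swap d q = swap (i * N) (sig2 ^ i) * swap M wpoly"
          unfolding q_def diM by (rule swap_mult[OF qform_degree[OF qform_power[OF qform_sig2]] degree_wpoly])
        then show ?thesis using sig2_power_ends(3)[of i] isotyp_wpoly by (simp add: q_def isotyp_def)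
      qed
      have qd: "coeff q d = 1"
        using arg_cong[OF qswp, of "\<lambda>p. coeff p 0"] q0 by (simp add: coeff_swap)
      define c where "c = coeff a d"
      have "coeff (swap d a) 0 = - coeff a 0" using a by (simp add: isotyp_def)
      then have a0: "coeff a 0 = - c" by (simp add: coeff_swap c_def)
      have Jr: "in_ideal d (a - smult c q)"
        using q0 qd a0 by (intro in_ideal_ends_vanish qform_diff qform_smult isotyp_qform[OF a] qq)
            (simp_all add: c_def)
      have "in_ideal d (smult c q)"
      proof (cases i)
        case 0
        \<comment> \<open>Here d = M and q = \<open>wpoly\<close>. The other two summands lie in the
          ideal, so the kernel condition falls on c alone.\<close>
        have "pif d u = pif d s + (pif d (a - smult c q) + smult c (pif d q))"
          unfolding pif_smult[symmetric] pif_add[symmetric] using u_sa by simp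
        then have "smult c (pif M wpoly) = 0"
          using pi pif_in_ideal[OF Js] pif_in_ideal[OF Jr] 0 diM by (simp add: q_def)
        then have "c = 0" using pif_wpoly_nonzero by simp
        then show ?thesis by simp
      next
        case (Suc i')
        have "q = (sig2 ^ i' * wpoly) * sig2" by (simp add: q_def Suc mult_ac)
        moreover have "d - N = i' * N + M" by (simp add: diM Suc)
        then have "qform (d - N) (sig2 ^ i' * wpoly)"
          by (simp add: qform_mult qform_power[OF qform_sig2] qform_wpoly)
        ultimately show ?thesis using in_ideal_smult[OF in_ideal_sig2[OF dN(1)]] by simp
      qed
      from in_ideal_add[OF Jr this] show ?thesis by simp
    qed
    show ?thesis unfolding u_sa by (rule in_ideal_add[OF Js Ja])
  qed
qed

lemma res_part_isotyp:
  assumes "isotyp n e' \<epsilon> v"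
  shows "res_part e v = (if int N dvd e' - e then v else 0)"
proof (rule poly_eqI)
  fix a
  have "int N dvd int a - e \<longleftrightarrow> int N dvd e' - e" if "coeff v a \<noteq> 0"
  proof -
    have "int N dvd int a - e'" using assms that unfolding isotyp_def by blast
    moreover have "int a - e = (int a - e') + (e' - e)" by simp
    ultimately show ?thesis by (metis dvd_add_right_iff)
  qed
  then show "coeff (res_part e v) a = coeff (if int N dvd e' - e then v else 0) a"
    by (cases "coeff v a = 0") (auto simp: coeff_res_part)
qed

lemma res_part_add: "res_part e (u + v) = res_part e u + res_part e v"
  by (rule poly_eqI) (simp add: coeff_res_part)

lemma res_part_sum: "res_part e (sum f A) = (\<Sum>a\<in>A. res_part e (f a))"
  by (induction A rule: infinite_finite_induct) (simp_all add: res_part_add)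

lemma pif_sum: "pif d (sum f A) = (\<Sum>a\<in>A. pif d (f a))"
proof -
  have "pif d 0 = 0" by (simp add: pif_def)
  then show ?thesis
    by (induction A rule: infinite_finite_induct) (simp_all add: pif_add)
qed

text \<open>\<open>pif d\<close> maps class i to class i - d, so the images of the components of
  \<open>u\<close> lie in different classes and cannot cancel.\<close>

lemma pif_res_part:
  assumes "qform d u" "pif d u = 0" "e < N"
  shows "pif d (res_part (int e) u) = 0"
proof (cases "M < d")
  case False
  have "0 = res_part (int e - int d) (pif d (\<Sum>i<N. res_part (int i) u))"
    using assms(2) by (simp add: sum_res_part)
  also have "\<dots> = (\<Sum>i<N. res_part (int e - int d) (pif d (res_part (int i) u)))"
    by (simp only: pif_sum res_part_sum)
  also have "\<dots> = (\<Sum>i<N. if i = e then pif d (res_part (int e) u) else 0)"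
  proof (intro sum.cong refl)
    fix i assume "i \<in> {..<N}"
    then have "int N dvd int i - int e \<longleftrightarrow> i = e"
      using assms(3) by (metis lessThan_iff mod_eq_dvd_iff mod_less of_nat_eq_iff of_nat_mod)
    moreover have "isotyp (M - d) (int i - int d) (- 0) (pif d (res_part (int i) u))"
      using False by (intro isotyp_pif isotyp_res_part assms(1)) simp
    ultimately show "res_part (int e - int d) (pif d (res_part (int i) u)) = (if i = e then pif d
        (res_part (int e) u) else 0)"
      by (simp add: res_part_isotyp)
  qed
  finally show ?thesis using assms(3) by simp
qed (rule pif_large)

lemma pif_eq_0_imp_in_ideal:
  assumes "qform d u" "pif d u = 0"
  shows "in_ideal d u"
proof -
  have "in_ideal d (res_part (int e) u)" if "e < N" for e
    using kernel_generic[OF isotyp_res_part[OF assms(1)] _ pif_res_part[OF assms that]]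
      kernel_special[OF isotyp_res_part[OF assms(1)] _ pif_res_part[OF assms that]] by blast
  then have "in_ideal d (\<Sum>e<N. res_part (int e) u)"
    by (intro in_ideal_sum) simp
  then show ?thesis by (simp only: sum_res_part)
qed

end

section \<open>From forms back to arbitrary quasiinvariants\<close>

lemma hcomp_add: "hcomp d (p + q) = hcomp d p + hcomp d q"
  by (intro poly_eqI) (simp add: coeff_hcomp)

lemma form_part_add: "form_part d (p + q) = form_part d p + form_part d q"
proof -
  have "form d (form_part d (p + q) - (form_part d p + form_part d q)) = 0"
    using form_part(2)[of d p] form_part(2)[of d q] form_part(2)[of d "p + q"]
    by (simp add: form_diff form_add hcomp_add)
  moreover have "degree (form_part d (p + q) - (form_part d p + form_part d q)) \<le> d"
    by (intro degree_diff_le degree_add_le form_part(1))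
  ultimately show ?thesis by (simp add: form_eq_0_iff)
qed

lemma form_part_0: "form_part d 0 = 0"
  using form_part_sum_form[of "{}" "\<lambda>_. 0" d] by simp

lemma form_part_sum: "form_part d (sum f A) = (\<Sum>a\<in>A. form_part d (f a))"
  by (induction A rule: infinite_finite_induct) (simp_all add: form_part_0 form_part_add)

lemma form_part_form: "degree u \<le> n \<Longrightarrow> form_part d (form n u) = (if d = n then u else 0)"
  using form_part_sum_form[of "{n}" "\<lambda>_. u" d] by simp

text \<open>In L (X f) - X (L f) the second term is X 0, which is 0 for every iterate X of the
  commutator.\<close>

lemma ad_op_kernel:
  assumes "L f = 0" "L 0 = 0" "B 0 = 0"
  shows "(ad_op L ^^ k) B f = (L ^^ k) (B f)"
proof -
  have 0: "(ad_op L ^^ k) B 0 = 0" for k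
    using assms by (induction k) (simp_all add: ad_op_def)
  have "ad_op L X f = L (X f) - X 0" for X
    by (simp add: ad_op_def assms(1))
  then show ?thesis
    by (induction k) (simp_all add: 0)
qed

lemma chi_kernel:
  assumes "CM_op N m f = 0"
  shows "chi N m q f = (\<Sum>d | hcomp d q \<noteq> 0.
    to_fract (const2 (1 / (2 ^ d * fact d))) * (CM_op N m ^^ d) (to_fract (hcomp d q) * f))"
  unfolding chi_def chi_hom_def
  by (intro sum.cong refl) (simp add: ad_op_kernel assms CM_op_0 mult_op_def)

context dihedral
begin

lemma sigma_quasi: "sigma1 \<in> quasiinvariants N m" "sigma2 N \<in> quasiinvariants N m"
  using quasi_form_iff[of "monom 1 1" 2] qform_s1 quasi_form_iff[OF degree_sig2] qform_sig2
      degree_monom_le[of "1::complex" 1]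
  unfolding sigma1_form sigma2_form sig2_def by auto

lemma form_sig2: "sigma2 N = form N sig2"
  unfolding sigma2_form sig2_def ..

lemma form_in_ideal:
  assumes "in_ideal d u"
  shows "form d u \<in> invariant_ideal N m"
proof -
  obtain p q where 1: "p = 0 \<or> 2 \<le> d \<and> qform (d - 2) p" "q = 0 \<or> N \<le> d \<and>
      qform (d - N) q" "u = pCons 0 p + q * sig2"
    using assms(1) unfolding in_ideal_def by blast
  have p: "\<exists>P\<in>quasiinvariants N m. form d (pCons 0 p) = P * sigma1"
  proof (cases "p = 0")
    case True
    then show ?thesis using quasiinvariants_const2[of 0 N m] by (intro bexI[of _ 0]) (simp_all add:
        const2_hom)
  next
    case False
    then have p: "2 \<le> d" "qform (d - 2) p" using 1 by auto
    have "form (d - 2 + 2) (pCons 0 p) = form (d - 2) p * sigma1"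
      unfolding form_pCons[OF qform_degree[OF p(2)]] by (rule mult.commute)
    then have "form d (pCons 0 p) = form (d - 2) p * sigma1"
      using p(1) by (metis le_add_diff_inverse2)
    then show ?thesis using quasi_form_iff[OF qform_degree[OF p(2)]] p by blast
  qed
  have q: "\<exists>Q\<in>quasiinvariants N m. form d (q * sig2) = Q * sigma2 N"
  proof (cases "q = 0")
    case True
    then show ?thesis using quasiinvariants_const2[of 0 N m] by (intro bexI[of _ 0]) (simp_all add:
        const2_hom)
  next
    case False
    then have q: "N \<le> d" "qform (d - N) q" using 1 by auto
    have "form (d - N + N) (q * sig2) = form (d - N) q * sigma2 N"
      unfolding form_sig2 by (rule form_mult[OF qform_degree[OF q(2)] degree_sig2])
    then have "form d (q * sig2) = form (d - N) q * sigma2 N"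
      using q(1) by (metis le_add_diff_inverse2)
    then show ?thesis using quasi_form_iff[OF qform_degree[OF q(2)]] q by blast
  qed
  from p q obtain P Q where "P \<in> quasiinvariants N m" "Q \<in> quasiinvariants N m"
    "form d (pCons 0 p) = P * sigma1" "form d (q * sig2) = Q * sigma2 N"
    by blast
  moreover from this have "form d u = P * sigma1 + Q * sigma2 N"
    by (simp only: 1(3) form_add)
  ultimately show ?thesis
    unfolding invariant_ideal_def by blast
qed

lemma invariant_ideal_sum:
  assumes "finite A" "\<And>a. a \<in> A \<Longrightarrow> f a \<in> invariant_ideal N m"
  shows "sum f A \<in> invariant_ideal N m"
  using assms
proof (induction A rule: finite_induct)
  case empty
  then show ?case
    using quasiinvariants_const2[of 0 N m] unfolding invariant_ideal_def
    by (auto intro!: exI[of _ 0] simp: const2_hom)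
next
  case (insert a A)
  obtain p q where 1: "f a = p * sigma1 + q * sigma2 N" "p \<in> quasiinvariants N m" "q \<in>
      quasiinvariants N m"
    using insert unfolding invariant_ideal_def by blast
  obtain p' q' where 2: "sum f A = p' * sigma1 + q' * sigma2 N" "p' \<in> quasiinvariants N m" "q'
      \<in> quasiinvariants N m"
    using insert unfolding invariant_ideal_def by blast
  have "sum f (insert a A) = (p + p') * sigma1 + (q + q') * sigma2 N"
    using insert 1 2 by (simp add: algebra_simps)
  then show ?case
    using 1 2 quasiinvariants_add unfolding invariant_ideal_def by blast
qed

lemma form_part_ideal:
  assumes "q \<in> invariant_ideal N m"
  shows "in_ideal d (form_part d q)"
proof -
  obtain p p' where 1: "q = p * sigma1 + p' * sigma2 N" "p \<in> quasiinvariants N m" "p' \<in>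
      quasiinvariants N m"
    using assms unfolding invariant_ideal_def by blast
  have fin: "finite {d. hcomp d p \<noteq> 0}" for p by (rule finite_hcomp)
  have "in_ideal d (form_part d (p * sigma1))"
  proof -
    have deg: "degree (pCons 0 (form_part k p)) \<le> k + 2" for k
      using form_part(1)[of k p] degree_pCons_le[of 0 "form_part k p"] by linarith
    have "p * sigma1 = (\<Sum>k | hcomp k p \<noteq> 0. form k (form_part k p)) * sigma1"
      by (simp only: sum_form_part)
    also have "\<dots> = (\<Sum>k | hcomp k p \<noteq> 0. form (k + 2) (pCons 0 (form_part k p)))"
      by (simp only: sum_distrib_right form_pCons[OF form_part(1)] mult.commute[of sigma1])
    finally have "form_part d (p * sigma1) = (\<Sum>k | hcomp k p \<noteq> 0. if d = k + 2 then
        pCons 0 (form_part k p) else 0)"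
      by (simp only: form_part_sum form_part_form[OF deg])
    also have "in_ideal d \<dots>"
      by (rule in_ideal_sum) (auto intro!: in_ideal_t quasi_form_part[OF 1(2)])
    finally show ?thesis .
  qed
  moreover have "in_ideal d (form_part d (p' * sigma2 N))"
  proof -
    have deg: "degree (form_part k p' * sig2) \<le> k + N" for k
      using form_part(1)[of k p'] degree_sig2 degree_mult_le[of "form_part k p'" sig2] by linarith
    have "p' * sigma2 N = (\<Sum>k | hcomp k p' \<noteq> 0. form k (form_part k p')) * sigma2 N"
      by (simp only: sum_form_part)
    also have "\<dots> = (\<Sum>k | hcomp k p' \<noteq> 0. form (k + N) (form_part k p' * sig2))"
      by (simp only: sum_distrib_right form_mult[OF form_part(1) degree_sig2] form_sig2)
    finally have "form_part d (p' * sigma2 N) = (\<Sum>k | hcomp k p' \<noteq> 0. if d = k + N then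
        form_part k p' * sig2 else 0)"
      by (simp only: form_part_sum form_part_form[OF deg])
    also have "in_ideal d \<dots>"
      by (rule in_ideal_sum) (auto intro!: in_ideal_sig2 quasi_form_part[OF 1(3)])
    finally show ?thesis .
  qed
  ultimately show ?thesis unfolding 1(1) form_part_add by (rule in_ideal_add)
qed

lemma invariant_ideal_quasi: "q \<in> invariant_ideal N m \<Longrightarrow> q \<in> quasiinvariants N m"
  unfolding invariant_ideal_def using sigma_quasi quasiinvariants_add quasiinvariants_mult by blast

lemma CM_op_single:
  assumes "qform n u"
  shows "(CM_op N m ^^ k) (to_fract (form n u)) = to_fract (form (n - 2 * k) (smult (4 ^ k) (CMiter k n u)))"
  using CM_op_iter[of "{n}" "\<lambda>n. n" "\<lambda>_. u" k] assms by simp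

text \<open>The factor \<open>C d\<close> collects 1/(2^d d!), the power 4^d from L = 4
  \<open>CMf\<close>, and the constant relating \<open>w_poly\<close> to
  \<open>wpoly\<close>.\<close>

lemma pi_map_pif:
  "\<exists>C. (\<forall>d. C d \<noteq> 0) \<and> (\<forall>q\<in>quasiinvariants N m.
      pi_map N m q = to_fract (\<Sum>d | hcomp d q \<noteq> 0. form (M - d) (smult (C d) (pif d
          (form_part d q)))))"
proof -
  obtain c where c: "c \<noteq> 0" "w_poly N m = const2 c * form M wpoly"
    using w_poly_form by blast
  have w: "w_poly N m = form M (smult c wpoly)"
    by (simp add: c form_smult)
  have qiw: "qform M (smult c wpoly)" by (intro qform_smult qform_wpoly)
  \<comment> \<open>L(w_m) = 0 is the case q = 1 of \<open>CMf_pif\<close>.\<close>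
  have "CMf M wpoly = 0"
    using CMf_pif[OF qform_1] by (simp add: pif_def)
  then have w0: "CM_op N m (to_fract (w_poly N m)) = 0"
    unfolding w CM_op_form[OF qiw] by (simp add: CMf_smult)
  define C where "C d = 1 / (2 ^ d * fact d) * (4 ^ d * c)" for d :: nat
  show ?thesis
  proof (intro exI[of _ C] conjI allI ballI)
    show "C d \<noteq> 0" for d using c(1) by (simp add: C_def)
    fix q assume q: "q \<in> quasiinvariants N m"
    have "to_fract (const2 (1 / (2 ^ d * fact d))) * (CM_op N m ^^ d) (to_fract (hcomp d q) *
        to_fract (w_poly N m)) =
       to_fract (form (M - d) (smult (C d) (pif d (form_part d q))))" for d
    proof -
      have qd: "qform d (form_part d q)" by (rule quasi_form_part[OF q])
      have "to_fract (hcomp d q) * to_fract (w_poly N m) = to_fract (form (d + M) (form_part d q *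
          smult c wpoly))"
        unfolding w form_part(2) form_mult[OF qform_degree[OF qd] qform_degree[OF qiw]] by simp
      then have "(CM_op N m ^^ d) (to_fract (hcomp d q) * to_fract (w_poly N m)) =
         to_fract (form (d + M - 2 * d) (smult (4 ^ d) (CMiter d (d + M) (form_part d q * smult c wpoly))))"
        by (simp only: CM_op_single[OF qform_mult[OF qd qiw]])
      also have "CMiter d (d + M) (form_part d q * smult c wpoly) = smult c (pif d (form_part d q))"
        by (simp add: pif_def CMiter_smult)
      also have "d + M - 2 * d = M - d" by simp
      finally show ?thesis
        unfolding C_def by (simp only: form_smult const2_hom(6) to_fract_mult mult.assoc)
    qed
    then show "pi_map N m q = to_fract (\<Sum>d | hcomp d q \<noteq> 0. form (M - d) (smult (C d)
        (pif d (form_part d q))))"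
      unfolding pi_map_def chi_kernel[OF w0] by (simp only: to_fract_sum)
  qed
qed

lemma chi_homogeneous:
  assumes "CM_op N m f = 0" "degree u \<le> n" "form n u \<noteq> 0"
  shows "chi N m (form n u) f = to_fract (const2 (1 / (2 ^ n * fact n))) * (CM_op N m ^^ n)
      (to_fract (form n u) * f)"
proof -
  have "{d. hcomp d (form n u) \<noteq> 0} = {n}"
    using assms(2,3) by (auto simp: hcomp_form split: if_splits)
  then show ?thesis
    using assms(2) by (simp add: chi_kernel[OF assms(1)] hcomp_form)
qed

lemma pi_map_harmonic:
  assumes q: "q \<in> quasiinvariants N m"
  shows "pi_map N m q \<in> to_fract ` harmonics N m"
proof -
  obtain C where C: "pi_map N m q = to_fract (\<Sum>d | hcomp d q \<noteq> 0. form (M - d) (smult (C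
      d) (pif d (form_part d q))))"
    using pi_map_pif q by blast
  define A where "A = {d. hcomp d q \<noteq> 0}"
  define v where "v d = smult (C d) (pif d (form_part d q))" for d
  define F where "F = (\<Sum>d\<in>A. form (M - d) (v d))"
  have qd: "qform d (form_part d q)" for d by (rule quasi_form_part[OF q])
  have qv: "qform (M - d) (v d)" for d unfolding v_def by (intro qform_smult qform_pif qd)
  have "(CM_op N m ^^ 1) (to_fract F) = to_fract (\<Sum>d\<in>A. form (M - d - 2 * 1) (smult (4 ^ 1)
      (CMiter 1 (M - d) (v d))))"
    unfolding F_def by (rule CM_op_iter) (rule qv)
  also have "\<dots> = 0"
    by (simp add: v_def CMf_smult CMf_pif[OF qd])
  finally have F0: "CM_op N m (to_fract F) = 0" by simp
  have "chi N m sigma1 (to_fract F) = 0"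
  proof -
    have deg: "degree (monom (1::complex) 1) \<le> 2" using degree_monom_le[of "1::complex" 1] by simp
    have nz: "form 2 (monom 1 1) \<noteq> 0" using form_eq_0_iff[OF deg] by simp
    have L0: "CMiter 2 (M - d + 2) (pCons 0 (v d)) = 0" for d
    proof -
      have "pCons 0 (v d) = smult (C d) (pCons 0 (pif d (form_part d q)))" by (simp add: v_def)
      then show ?thesis by (simp only: CMiter_smult kill_pif_t[OF qd] smult_0_right)
    qed
    have "sigma1 * F = (\<Sum>d\<in>A. form (M - d + 2) (pCons 0 (v d)))"
      unfolding F_def sum_distrib_left by (simp only: form_pCons[OF qform_degree[OF qv]])
    then have "(CM_op N m ^^ 2) (to_fract (sigma1 * F)) =
       (CM_op N m ^^ 2) (to_fract (\<Sum>d\<in>A. form (M - d + 2) (pCons 0 (v d))))"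
      by (simp only:)
    also have "\<dots> = to_fract (\<Sum>d\<in>A. form (M - d + 2 - 2 * 2) (smult (4 ^ 2) (CMiter 2
        (M - d + 2) (pCons 0 (v d)))))"
      by (rule CM_op_iter) (use qform_t[OF qform_degree[OF qv]] qv in blast)
    also have "\<dots> = 0" by (simp only: L0 smult_0_right form_0 sum.neutral_const to_fract_0)
    finally have "(CM_op N m ^^ 2) (to_fract (sigma1 * F)) = 0" by simp
    then show ?thesis
      using chi_homogeneous[OF F0 deg nz] unfolding sigma1_form[symmetric] to_fract_mult by (simp
          only: mult_zero_right)
  qed
  moreover have "chi N m (sigma2 N) (to_fract F) = 0"
  proof -
    have "coeff sig2 0 = 1" using N_pos by (simp add: sig2_def)
    then have "sig2 \<noteq> 0" by auto
    then have nz: "form N sig2 \<noteq> 0" using form_eq_0_iff[OF degree_sig2] by simp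
    have L0: "CMiter N (M - d + N) (v d * sig2) = 0" for d
    proof -
      have "v d * sig2 = smult (C d) (pif d (form_part d q) * sig2)" by (simp add: v_def)
      then show ?thesis by (simp only: CMiter_smult kill_pif_sig2[OF qd] smult_0_right)
    qed
    have "sigma2 N * F = (\<Sum>d\<in>A. form (M - d + N) (v d * sig2))"
      unfolding F_def sum_distrib_left form_mult[OF qform_degree[OF qv] degree_sig2] form_sig2
      by (simp only: mult.commute)
    then have "(CM_op N m ^^ N) (to_fract (sigma2 N * F)) =
       (CM_op N m ^^ N) (to_fract (\<Sum>d\<in>A. form (M - d + N) (v d * sig2)))"
      by (simp only:)
    also have "\<dots> = to_fract (\<Sum>d\<in>A. form (M - d + N - 2 * N) (smult (4 ^ N) (CMiter N
        (M - d + N) (v d * sig2))))"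
      by (rule CM_op_iter) (intro qform_mult qv qform_sig2)
    also have "\<dots> = 0" by (simp only: L0 smult_0_right form_0 sum.neutral_const to_fract_0)
    finally have "(CM_op N m ^^ N) (to_fract (sigma2 N * F)) = 0" by simp
    then show ?thesis
      using chi_homogeneous[OF F0 degree_sig2 nz] unfolding form_sig2[symmetric] to_fract_mult by
          (simp only: mult_zero_right)
  qed
  ultimately have "F \<in> harmonics N m" by (simp add: harmonics_def)
  then show ?thesis unfolding C F_def A_def v_def by (rule imageI)
qed

lemma pi_map_eq_0_iff:
  assumes q: "q \<in> quasiinvariants N m"
  shows "pi_map N m q = 0 \<longleftrightarrow> q \<in> invariant_ideal N m"
proof -
  obtain C where C: "\<And>d. C d \<noteq> 0"
    "pi_map N m q = to_fract (\<Sum>d | hcomp d q \<noteq> 0. form (M - d) (smult (C d) (pif d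
        (form_part d q))))"
    using pi_map_pif q by blast
  define A where "A = {d. hcomp d q \<noteq> 0}"
  have A: "finite A" unfolding A_def by (rule finite_hcomp)
  have qd: "qform d (form_part d q)" for d by (rule quasi_form_part[OF q])
  show ?thesis
  proof
    assume "pi_map N m q = 0"
    then have sum0: "(\<Sum>d\<in>A. form (M - d) (smult (C d) (pif d (form_part d q)))) = 0"
      using C(2) unfolding A_def by (simp del: to_fract_sum)
    \<comment> \<open>For d \<le> M the degrees M - d are distinct, so the summands vanish
      separately. For d > M the truncated degrees collide, but there \<open>pif\<close> is
      0.\<close>
    define A' where "A' = {d \<in> A. d \<le> M}"
    have "(\<Sum>d\<in>A. form (M - d) (smult (C d) (pif d (form_part d q)))) = (\<Sum>d\<in>A'.
        form (M - d) (smult (C d) (pif d (form_part d q))))"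
    proof (intro sum.mono_neutral_right ballI)
      fix d assume "d \<in> A - A'"
      then have "M < d" by (auto simp: A'_def)
      then show "form (M - d) (smult (C d) (pif d (form_part d q))) = 0" by (simp add: pif_large)
    qed (use A in \<open>auto simp: A'_def\<close>)
    also have "\<dots> = (\<Sum>k\<in>(\<lambda>d. M - d) ` A'. form k (smult (C (M - k)) (pif (M -
        k) (form_part (M - k) q))))"
      by (subst sum.reindex) (auto simp: inj_on_def A'_def intro!: sum.cong)
    finally have sum0': "(\<Sum>k\<in>(\<lambda>d. M - d) ` A'. form k (smult (C (M - k)) (pif (M -
        k) (form_part (M - k) q)))) = 0"
      using sum0 by simp
    have fin: "finite ((\<lambda>d. M - d) ` A')" using A by (simp add: A'_def)
    have deg: "degree (smult (C (M - k)) (pif (M - k) (form_part (M - k) q))) \<le> k" if "k \<in>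
        (\<lambda>d. M - d) ` A'" for k
    proof -
      have "M - (M - k) = k" using that by (auto simp: A'_def)
      then show ?thesis using qform_degree[OF qform_smult[OF qform_pif[OF qd]], of "C (M - k)" "M -
          k"] by simp
    qed
    have "pif d (form_part d q) = 0" for d
    proof (cases "d \<in> A'")
      case True
      then have "smult (C (M - (M - d))) (pif (M - (M - d)) (form_part (M - (M - d)) q)) = 0"
        by (intro form_sum_eq_0[OF fin deg sum0']) auto
      then show ?thesis using True C(1) by (simp add: A'_def)
    next
      case False
      then show ?thesis
      proof (cases "d \<in> A")
        case True
        then show ?thesis using False pif_large by (simp add: A'_def)
      next
        case False
        then have "form_part d q = 0"
          using form_part[of d q] form_eq_0_iff[of "form_part d q" d] by (simp add: A_def)
        then show ?thesis by (simp add: pif_def)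
      qed
    qed
    then have "form d (form_part d q) \<in> invariant_ideal N m" for d
      by (intro form_in_ideal pif_eq_0_imp_in_ideal qd)
    then have "(\<Sum>d | hcomp d q \<noteq> 0. form d (form_part d q)) \<in> invariant_ideal N m"
      by (intro invariant_ideal_sum finite_hcomp)
    then show "q \<in> invariant_ideal N m" by (simp only: sum_form_part)
  next
    assume "q \<in> invariant_ideal N m"
    then have "pif d (form_part d q) = 0" for d
      by (intro pif_in_ideal form_part_ideal)
    then show "pi_map N m q = 0" unfolding C(2) by simp
  qed
qed

end

theorem theorem10:
  fixes N m :: nat
  assumes "N \<ge> 2"
  shows "(\<forall>q\<in>quasiinvariants N m. pi_map N m q \<in> to_fract ` harmonics N m) \<and>
         {q \<in> quasiinvariants N m. pi_map N m q = 0} = invariant_ideal N m"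
proof -
  interpret dihedral N m by unfold_locales (rule assms)
  show ?thesis
    using pi_map_harmonic pi_map_eq_0_iff invariant_ideal_quasi by blast
qed

end
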